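(* Let $\{Y_{t,T}\}_{t=1,\dots,T}$, $T\ge 1$, be a Gaussian locally stationary process (defined in the context) specified by a parameter vector in a compact set $\Theta$ contained in a finite-dimensional Euclidean space, and let $\theta_0\in\Theta$ be the true value of the parameter $\theta$. Let $f_\theta(u,\lambda)=|A_\theta(u,\lambda)|^2$ be the time-varying spectral density and let $\widehat\theta_T$ be the Whittle estimator (defined in the context), built with data taper $h$ and block parameters $N,S,M$. Assume: (A1) $f_\theta$ is strictly positive and $f_\theta(u,\lambda)\sim C_f(\theta,u)|\lambda|^{-2d_\theta(u)}$ as $|\lambda|\to0$, where $C_f(\theta,u)>0$, $0<\inf_{\theta,u}d_\theta(u)$, $\sup_{\theta,u}d_\theta(u)<\tfrac12$, and $d_\theta(u)$ has bounded first derivative with respect to $u$. There is an integrable function $g(\lambda)$ such that $|\nabla_\theta\log f_\theta(u,\lambda)|\le g(\lambda)$ for all $\theta\in\Theta$, $u\in[0,1]$, $\lambda\in[-\pi,\pi]$. The function $A_\theta(u,\lambda)$ is twice differentiable with respect to $u$ and satisfies $\int_{-\pi}^{\pi}A_\theta(u,\lambda)A_\theta(v,-\lambda)e^{ik\lambda}\,d\lambda\sim C(\theta,u,v)\,k^{d_\theta(u)+d_\theta(v)-1}$ as $k\to\infty$, where $|C(\theta,u,v)|\le K$ for $u,v\in[0,1]$, $\theta\in\Theta$, for some constant $K>0$. The function $f_\theta(u,\lambda)^{-1}$ is twice differentiable with respect to $\theta$, $u$ and $\lambda$. (A2) $h(u)$ is a positive, bounded function on $[0,1]$, symmetric around $\tfrac12$,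 with bounded derivative. (A3) $T,N,S,M$ tend to infinity with $S/N\to0$, $\sqrt T\log^2N/N\to0$, $\sqrt T/M\to0$ and $N^3\log^2N/T^2\to0$. Then $\widehat\theta_T\to\theta_0$ in probability as $T\to\infty$.
   Context: Model. A Gaussian locally stationary process is a triangular array of the form $$Y_{t,T}=\int_{-\pi}^{\pi}A^0_{t,T}(\lambda)e^{i\lambda t}\,dB(\lambda),\qquad t=1,\dots,T,$$ where $B(\lambda)$ is a Brownian motion on $[-\pi,\pi]$ (complex Gaussian with $dB(-\lambda)=\overline{dB(\lambda)}$ and $E[dB(\lambda)\overline{dB(\mu)}]=\delta(\lambda-\mu)\,d\lambda\,d\mu$, so that $Y_{t,T}$ is real), and there are a constant $K>0$ and a function $A:(0,1]\times\mathbb R\to\mathbb C$, $2\pi$-periodic in $\lambda$, with $A(u,-\lambda)=\overline{A(u,\lambda)}$, such that $\sup_{t,\lambda}|A^0_{t,T}(\lambda)-A(t/T,\lambda)|\le K/T$ for all $T$. The model is specified by a parameter $\theta\in\Theta$; one writes $A=A_\theta$, and $f_\theta(u,\lambda)=|A_\theta(u,\lambda)|^2$ is the time-varying spectral density of the limiting process. Whittle estimator. Let $T=S(M-1)+N$, $t_j=S(j-1)+N/2$, $u_j=t_j/T$ for $j=1,\dots,M$ ($N,S,M$ depend on $T$). With data taper $h$ put $$D_N(u,\lambda)=\sum_{s=0}^{N-1}h\!\left(\tfrac sN\right)Y_{[uT]-N/2+s+1,T}\,e^{-i\lambda s},\quad H_{k,N}(\lambda)=\sum_{s=0}^{N-1}h\!\left(\tfrac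 sN\right)^k e^{-i\lambda s},\quad I_N(u,\lambda)=\frac{|D_N(u,\lambda)|^2}{2\pi H_{2,N}(0)},$$ $$\mathcal L_T(\theta)=\frac1{4\pi}\frac1M\int_{-\pi}^{\pi}\sum_{j=1}^M\Big\{\log f_\theta(u_j,\lambda)+\frac{I_N(u_j,\lambda)}{f_\theta(u_j,\lambda)}\Big\}d\lambda,\qquad \widehat\theta_T=\arg\min_{\theta\in\Theta}\mathcal L_T(\theta).$$
   Formalization: Added: no other θ in Θ has the same spectral density as θ_0 (identifiability); the relation f_θ ~ C_f|λ|^{-2d} holds uniformly in (θ,u). Pointwise conditions, including differentiability of 1/f_θ (jointly in θ,u,λ), are imposed only for λ≠0. *)

theory Defs
  imports "HOL-Probability.Probability" "HOL-Library.Landau_Symbols"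
begin

text \<open>
  The spectral density of a long-memory process has a pole at frequency \<open>0\<close>, so it has no
  (finite) value there.  Pointwise requirements are imposed on the following punctured
  frequency domain only; integrals over \<open>[-\<pi>, \<pi>]\<close> do not see the point \<open>0\<close>.
\<close>

definition frequencies :: "real set" where
  "frequencies = {-pi..pi} - {0}"

subsection \<open>Brownian motion on the frequency domain and its stochastic integral\<close>

text \<open>The degenerate case is separate because \<^const>\<open>normal_density\<close> needs a positive
  standard deviation.\<close>

definition centred_gaussian :: "'w measure \<Rightarrow> ('w \<Rightarrow> real) \<Rightarrow> bool" where
  "centred_gaussian P X \<longleftrightarrow>
     X \<in> borel_measurable P \<and>
     ((AE \<omega> in P. X \<omega> = 0) \<or> (\<exists>\<sigma>>0. distributed P lborel X (normal_density 0 \<sigma>)))"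

text \<open>
  Complex Brownian motion with \<open>dB(-\<lambda>) = cnj dB(\<lambda>)\<close> and
  \<open>E[dB(\<lambda>) cnj dB(\<mu>)] = \<delta>(\<lambda> - \<mu>) d\<lambda> d\<mu>\<close>, both read on increments.  Joint Gaussianity:
  the real parts of the complex linear combinations of increments are exactly the real linear
  combinations of their real and imaginary parts.  Only increments are constrained, so no
  normalisation such as \<open>B(-\<pi>) = 0\<close> or \<open>B(0) = 0\<close> is fixed.
\<close>

definition hermitian_brownian_motion :: "'w measure \<Rightarrow> (real \<Rightarrow> 'w \<Rightarrow> complex) \<Rightarrow> bool" where
  "hermitian_brownian_motion P B \<longleftrightarrow>
     (\<forall>x\<in>{-pi..pi}. B x \<in> borel_measurable P) \<and>
     (AE \<omega> in P. continuous_on {-pi..pi} (\<lambda>x. B x \<omega>)) \<and>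
     (\<forall>(n::nat) (c :: nat \<Rightarrow> complex) a b. (\<forall>i<n. a i \<in> {-pi..pi} \<and> b i \<in> {-pi..pi}) \<longrightarrow>
        centred_gaussian P (\<lambda>\<omega>. Re (\<Sum>i<n. c i * (B (b i) \<omega> - B (a i) \<omega>)))) \<and>
     (\<forall>a\<in>{-pi..pi}. \<forall>b\<in>{-pi..pi}.
        AE \<omega> in P. B (-a) \<omega> - B (-b) \<omega> = cnj (B b \<omega> - B a \<omega>)) \<and>
     (\<forall>a b c d. -pi \<le> a \<and> a \<le> b \<and> b \<le> pi \<and> -pi \<le> c \<and> c \<le> d \<and> d \<le> pi \<longrightarrow>
        (LINT \<omega>|P. (B b \<omega> - B a \<omega>) * cnj (B d \<omega> - B c \<omega>))
          = of_real (measure lborel ({a<..b} \<inter> {c<..d})))"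

text \<open>A list of triples \<open>(c, a, b)\<close> represents the step function \<open>\<Sum> c \<cdot> 1\<^bsub>(a,b]\<^esub>\<close>.\<close>

definition step_fun :: "(complex \<times> real \<times> real) list \<Rightarrow> real \<Rightarrow> complex" where
  "step_fun cs x = (\<Sum>(c, a, b)\<leftarrow>cs. c * indicator {a<..b} x)"

definition step_integral ::
  "(real \<Rightarrow> 'w \<Rightarrow> complex) \<Rightarrow> (complex \<times> real \<times> real) list \<Rightarrow> 'w \<Rightarrow> complex" where
  "step_integral B cs \<omega> = (\<Sum>(c, a, b)\<leftarrow>cs. c * (B b \<omega> - B a \<omega>))"

text \<open>\<open>X = \<integral>\<^bsub>[-\<pi>,\<pi>]\<^esub> \<phi>(\<lambda>) dB(\<lambda>)\<close> as the mean-square limit of integrals of step functions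
  converging to \<open>\<phi>\<close> in \<open>L\<^sup>2[-\<pi>, \<pi>]\<close>; this entails that \<open>\<phi>\<close> is square integrable.\<close>

definition has_stochastic_integral ::
  "'w measure \<Rightarrow> (real \<Rightarrow> 'w \<Rightarrow> complex) \<Rightarrow> (real \<Rightarrow> complex) \<Rightarrow> ('w \<Rightarrow> complex) \<Rightarrow> bool" where
  "has_stochastic_integral P B \<phi> X \<longleftrightarrow>
     \<phi> \<in> borel_measurable (lebesgue_on {-pi..pi}) \<and> X \<in> borel_measurable P \<and>
     (\<exists>cs :: nat \<Rightarrow> (complex \<times> real \<times> real) list.
        (\<forall>n. \<forall>(c, a, b)\<in>set (cs n). -pi \<le> a \<and> a \<le> b \<and> b \<le> pi) \<and>
        (\<lambda>n. \<integral>\<^sup>+x. ennreal ((cmod (step_fun (cs n) x - \<phi> x))\<^sup>2) \<partial>lebesgue_on {-pi..pi})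
           \<longlonglongrightarrow> 0 \<and>
        (\<lambda>n. \<integral>\<^sup>+\<omega>. ennreal ((cmod (step_integral B (cs n) \<omega> - X \<omega>))\<^sup>2) \<partial>P) \<longlonglongrightarrow> 0)"

subsection \<open>Gaussian locally stationary processes\<close>

definition transfer_function :: "(real \<Rightarrow> real \<Rightarrow> complex) \<Rightarrow> bool" where
  "transfer_function A \<longleftrightarrow>
     (\<forall>u\<in>{0<..1}. \<forall>x. A u (x + 2 * pi) = A u x \<and> A u (-x) = cnj (A u x))"

text \<open>\<open>Y T t\<close> is \<open>Y\<^bsub>t,T\<^esub>\<close>, meaningful for \<open>1 \<le> t \<le> T\<close>, and \<open>A0 T t\<close> is \<open>A\<^sup>0\<^bsub>t,T\<^esub>\<close>.\<close>

definition gaussian_locally_stationary ::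
  "'w measure \<Rightarrow> (nat \<Rightarrow> nat \<Rightarrow> 'w \<Rightarrow> real) \<Rightarrow> (real \<Rightarrow> real \<Rightarrow> complex) \<Rightarrow> bool" where
  "gaussian_locally_stationary P Y A \<longleftrightarrow>
     transfer_function A \<and>
     (\<exists>B A0. hermitian_brownian_motion P B \<and>
        (\<forall>T\<ge>1. \<forall>t\<in>{1..T}.
           has_stochastic_integral P B
             (\<lambda>x. A0 T t x * exp (\<i> * of_real (x * real t))) (\<lambda>\<omega>. of_real (Y T t \<omega>))) \<and>
        (\<exists>K>0. \<forall>T\<ge>1. \<forall>t\<in>{1..T}. \<forall>x\<in>frequencies.
           cmod (A0 T t x - A (real t / real T) x) \<le> K / real T))"

definition tv_spectral_density :: "(real \<Rightarrow> real \<Rightarrow> complex) \<Rightarrow> real \<Rightarrow> real \<Rightarrow> real" where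
  "tv_spectral_density A u x = (cmod (A u x))\<^sup>2"

text \<open>
  \<open>\<theta>\<^sub>0\<close> is \<^emph>\<open>the\<close> true value: the process follows the model at \<open>\<theta>\<^sub>0\<close>, and the parameter
  specifies the model, i.e. no other parameter in \<open>\<Theta>\<close> has the same time-varying spectral density.
  Without the second part the target of the estimation is not well defined: the Whittle function
  depends on \<open>\<theta>\<close> through the spectral density only.
\<close>

definition true_value ::
  "'w measure \<Rightarrow> (nat \<Rightarrow> nat \<Rightarrow> 'w \<Rightarrow> real) \<Rightarrow> 'p set \<Rightarrow> ('p \<Rightarrow> real \<Rightarrow> real \<Rightarrow> complex) \<Rightarrow> 'p \<Rightarrow> bool"
  where
  "true_value P Y \<Theta> A \<theta>0 \<longleftrightarrow>
     \<theta>0 \<in> \<Theta> \<and> gaussian_locally_stationary P Y (A \<theta>0) \<and>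
     (\<forall>\<theta>\<in>\<Theta>. (\<forall>u\<in>{0..1}. \<forall>x\<in>frequencies.
         tv_spectral_density (A \<theta>) u x = tv_spectral_density (A \<theta>0) u x) \<longrightarrow> \<theta> = \<theta>0)"

subsection \<open>The Whittle estimator\<close>

text \<open>
  The rows of the array, the block length and the number of blocks are passed explicitly.
  For odd \<open>N\<close> the index \<open>[uT] - N/2 + s + 1\<close> is not an integer; \<open>N/2\<close> is rounded down there
  (and only there), so that the \<open>j\<close>-th block is \<open>S(j-1)+1, \<dots>, S(j-1)+N\<close> for every \<open>N\<close>.
\<close>

definition tapered_dft ::
  "(real \<Rightarrow> real) \<Rightarrow> (nat \<Rightarrow> real) \<Rightarrow> nat \<Rightarrow> nat \<Rightarrow> real \<Rightarrow> real \<Rightarrow> complex" where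
  "tapered_dft h y T N u x =
     (\<Sum>s<N. of_real (h (real s / real N) * y (nat (\<lfloor>u * real T\<rfloor> - int (N div 2) + int s + 1)))
        * exp (- \<i> * of_real (x * real s)))"

definition taper_sum :: "(real \<Rightarrow> real) \<Rightarrow> nat \<Rightarrow> nat \<Rightarrow> real \<Rightarrow> complex" where
  "taper_sum h k N x = (\<Sum>s<N. of_real (h (real s / real N) ^ k) * exp (- \<i> * of_real (x * real s)))"

text \<open>\<open>H\<^bsub>2,N\<^esub>(0)\<close> is real.\<close>

definition tapered_periodogram ::
  "(real \<Rightarrow> real) \<Rightarrow> (nat \<Rightarrow> real) \<Rightarrow> nat \<Rightarrow> nat \<Rightarrow> real \<Rightarrow> real \<Rightarrow> real" where
  "tapered_periodogram h y T N u x =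
     (cmod (tapered_dft h y T N u x))\<^sup>2 / (2 * pi * Re (taper_sum h 2 N 0))"

definition block_midpoint :: "nat \<Rightarrow> nat \<Rightarrow> nat \<Rightarrow> nat \<Rightarrow> real" where
  "block_midpoint T N S j = (real S * (real j - 1) + real N / 2) / real T"

definition whittle_function ::
  "(real \<Rightarrow> real) \<Rightarrow> ('p \<Rightarrow> real \<Rightarrow> real \<Rightarrow> complex) \<Rightarrow> (nat \<Rightarrow> real) \<Rightarrow>
     nat \<Rightarrow> nat \<Rightarrow> nat \<Rightarrow> nat \<Rightarrow> 'p \<Rightarrow> real" where
  "whittle_function h A y T N S M \<theta> =
     1 / (4 * pi) * (1 / real M) *
     (LINT x|lebesgue_on {-pi..pi}. (\<Sum>j=1..M.
        ln (tv_spectral_density (A \<theta>) (block_midpoint T N S j) x)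
        + tapered_periodogram h y T N (block_midpoint T N S j) x
          / tv_spectral_density (A \<theta>) (block_midpoint T N S j) x))"

definition whittle_estimator ::
  "'w measure \<Rightarrow> (nat \<Rightarrow> nat \<Rightarrow> 'w \<Rightarrow> real) \<Rightarrow> 'p::euclidean_space set \<Rightarrow>
     ('p \<Rightarrow> real \<Rightarrow> real \<Rightarrow> complex) \<Rightarrow> (real \<Rightarrow> real) \<Rightarrow>
     (nat \<Rightarrow> nat) \<Rightarrow> (nat \<Rightarrow> nat) \<Rightarrow> (nat \<Rightarrow> nat) \<Rightarrow> (nat \<Rightarrow> 'w \<Rightarrow> 'p) \<Rightarrow> bool" where
  "whittle_estimator P Y \<Theta> A h N S M \<theta>h \<longleftrightarrow>
     (\<forall>T\<ge>1. \<theta>h T \<in> borel_measurable P \<and>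
        (\<forall>\<omega>\<in>space P. is_arg_min
           (whittle_function h A (\<lambda>t. Y T t \<omega>) T (N T) (S T) (M T)) (\<lambda>\<theta>. \<theta> \<in> \<Theta>) (\<theta>h T \<omega>)))"

subsection \<open>Assumptions\<close>

text \<open>A choice of derivative is differentiable again; at points where the derivative within
  \<open>S\<close> is unique this is the usual notion.\<close>

definition twice_differentiable_on ::
  "('a::real_normed_vector \<Rightarrow> 'b::real_normed_vector) \<Rightarrow> 'a set \<Rightarrow> bool" where
  "twice_differentiable_on F S \<longleftrightarrow>
     (\<exists>F' :: 'a \<Rightarrow> 'a \<Rightarrow>\<^sub>L 'b.
        (\<forall>p\<in>S. (F has_derivative blinfun_apply (F' p)) (at p within S)) \<and> F' differentiable_on S)"

text \<open>
  The asymptotic relation for \<open>|\<lambda>| \<rightarrow> 0\<close> is a relation between families of functions indexed by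
  \<open>(\<theta>, u)\<close> and is taken uniformly in the index (the filter constrains \<open>\<lambda>\<close> only); the one for
  \<open>k \<rightarrow> \<infinity>\<close> is only required for each fixed \<open>(\<theta>, u, v)\<close>.  The existence of the gradient, and of
  derivatives at the boundary of \<open>\<Theta>\<close> and \<open>[0,1]\<close>, is relative to the domain.
\<close>

definition assumption_A1 ::
  "'p::euclidean_space set \<Rightarrow> ('p \<Rightarrow> real \<Rightarrow> real \<Rightarrow> complex) \<Rightarrow> bool" where
  "assumption_A1 \<Theta> A \<longleftrightarrow>
     (let f = (\<lambda>\<theta>. tv_spectral_density (A \<theta>)) in
     (\<forall>\<theta>\<in>\<Theta>. \<forall>u\<in>{0..1}. \<forall>x\<in>frequencies. f \<theta> u x > 0) \<and>
     (\<exists>(d :: 'p \<Rightarrow> real \<Rightarrow> real) (Cf :: 'p \<Rightarrow> real \<Rightarrow> real) (C :: 'p \<Rightarrow> real \<Rightarrow> real \<Rightarrow> complex).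
        (\<forall>\<theta>\<in>\<Theta>. \<forall>u\<in>{0..1}. Cf \<theta> u > 0) \<and>
        (\<exists>d1 d2. 0 < d1 \<and> d2 < 1 / 2 \<and> (\<forall>\<theta>\<in>\<Theta>. \<forall>u\<in>{0..1}. d1 \<le> d \<theta> u \<and> d \<theta> u \<le> d2)) \<and>
        (\<forall>\<theta>\<in>\<Theta>. \<exists>K. \<forall>u\<in>{0..1}. \<exists>D.
           (d \<theta> has_real_derivative D) (at u within {0..1}) \<and> \<bar>D\<bar> \<le> K) \<and>
        (\<lambda>((\<theta>, u), x). f \<theta> u x) \<sim>[principal (\<Theta> \<times> {0..1}) \<times>\<^sub>F at 0]
          (\<lambda>((\<theta>, u), x). Cf \<theta> u * \<bar>x\<bar> powr (- 2 * d \<theta> u)) \<and>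
        (\<forall>\<theta>\<in>\<Theta>. \<forall>u\<in>{0..1}. \<forall>v\<in>{0..1}.
           integrable (lebesgue_on {-pi..pi}) (\<lambda>x. A \<theta> u x * A \<theta> v (-x)) \<and>
           (\<lambda>k::nat. LINT x|lebesgue_on {-pi..pi}.
               A \<theta> u x * A \<theta> v (-x) * exp (\<i> * of_real (real k * x)))
             \<sim>[at_top] (\<lambda>k. C \<theta> u v * of_real (real k powr (d \<theta> u + d \<theta> v - 1)))) \<and>
        (\<exists>K>0. \<forall>\<theta>\<in>\<Theta>. \<forall>u\<in>{0..1}. \<forall>v\<in>{0..1}. cmod (C \<theta> u v) \<le> K)) \<and>
     (\<exists>g :: real \<Rightarrow> real. integrable (lebesgue_on {-pi..pi}) g \<and>
        (\<forall>\<theta>\<in>\<Theta>. \<forall>u\<in>{0..1}. \<forall>x\<in>frequencies. \<exists>G.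
           ((\<lambda>\<theta>. ln (f \<theta> u x)) has_derivative (\<lambda>v. G \<bullet> v)) (at \<theta> within \<Theta>) \<and> norm G \<le> g x)) \<and>
     (\<forall>\<theta>\<in>\<Theta>. \<forall>x\<in>frequencies. twice_differentiable_on (\<lambda>u. A \<theta> u x) {0..1}) \<and>
     twice_differentiable_on (\<lambda>(\<theta>, u, x). inverse (f \<theta> u x)) (\<Theta> \<times> {0..1} \<times> frequencies))"

definition assumption_A2 :: "(real \<Rightarrow> real) \<Rightarrow> bool" where
  "assumption_A2 h \<longleftrightarrow>
     (\<forall>x\<in>{0..1}. h x > 0 \<and> h (1 - x) = h x) \<and>
     (\<exists>K. \<forall>x\<in>{0..1}. h x \<le> K) \<and>
     (\<exists>K. \<forall>x\<in>{0..1}. \<exists>D. (h has_real_derivative D) (at x within {0..1}) \<and> \<bar>D\<bar> \<le> K)"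

definition assumption_A3 :: "(nat \<Rightarrow> nat) \<Rightarrow> (nat \<Rightarrow> nat) \<Rightarrow> (nat \<Rightarrow> nat) \<Rightarrow> bool" where
  "assumption_A3 N S M \<longleftrightarrow>
     filterlim N at_top at_top \<and> filterlim S at_top at_top \<and> filterlim M at_top at_top \<and>
     (\<lambda>T. real (S T) / real (N T)) \<longlonglongrightarrow> 0 \<and>
     (\<lambda>T. sqrt (real T) * (ln (real (N T)))\<^sup>2 / real (N T)) \<longlonglongrightarrow> 0 \<and>
     (\<lambda>T. sqrt (real T) / real (M T)) \<longlonglongrightarrow> 0 \<and>
     (\<lambda>T. real (N T) ^ 3 * (ln (real (N T)))\<^sup>2 / (real T)\<^sup>2) \<longlonglongrightarrow> 0"

end

theory Submission
  imports Defs
begin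

text \<open>
  The Whittle function depends on the data linearly through the local periodograms, and
  \<open>1 / f\<^sub>\<theta>\<close>, extended by \<open>0\<close> at frequency \<open>0\<close>, is continuous on the compact set
  \<open>\<Theta> \<times> [0, 1] \<times> [0, \<pi>]\<close>.  By Stone-Weierstrass it is uniformly close to a finite sum of
  products \<open>p(\<theta>) q(u) cos(k \<lambda>)\<close>, so that only the cosine coefficients of the periodograms
  matter, i.e. the tapered sample autocovariances of the blocks.  These converge in \<open>L\<^sup>1\<close>,
  uniformly over the blocks, to the autocovariances of the limiting process: within a block
  the process is almost stationary because \<open>N / T \<rightarrow> 0\<close>, and by Isserlis' formula the
  fluctuations are controlled by the average of the squared covariances, which vanishes because
  the autocovariances tend to \<open>0\<close> uniformly in \<open>u\<close>.  The limiting criterion is a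
  divergence of \<open>f\<^sub>\<theta>\<close> from the true spectral density, which is bounded away from its minimum
  outside every neighbourhood of \<open>\<theta>\<^sub>0\<close> by compactness and identifiability.
\<close>

section \<open>Square-integrable functions\<close>

text \<open>The pole at frequency 0 is the first obstacle: \<open>f\<close> is unbounded there, and
  the factors \<open>Cf\<close> of its asymptotics are assumed neither bounded nor continuous in
  (\<theta>, u). Only \<open>1 / f\<close> is ever approximated, and near 0 it is controlled by its
  own values at one fixed frequency. Decay of the covariances is assumed for each fixed (\<theta>,
  u, v). Uniformity in u is recovered from the L2-continuity of u -> A(u, .), which makes the
  autocovariances of all lags equicontinuous in u at once, together with a finite grid. A sup-norm
  approximation of \<open>1 / f\<close> can be integrated against the periodogram because the latter
  is nonnegative: its L1 mass is its zeroth cosine coefficient, which converges as well. No supremum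
  over \<open>\<Theta>\<close> is taken as a random variable. Each deviation is dominated by an
  integrable variable free of \<theta> with vanishing expectation, so that Markov's inequality
  applies. Stochastic integrals are given only as mean-square limits. Their Gaussianity is never
  proved: the fourth-moment bound is shown for step integrands, and the resulting L1 inequality is
  carried to the limit.\<close>

definition L2_space :: "'a measure \<Rightarrow> ('a \<Rightarrow> 'b::{banach, second_countable_topology}) set" where
  "L2_space M = {f \<in> borel_measurable M. integrable M (\<lambda>x. (norm (f x))\<^sup>2)}"

text \<open>The Bochner integral is 0 for non-integrable functions, so this value is meaningful on
  \<open>L2_space\<close> only and membership has to accompany every estimate.\<close>

definition L2_norm :: "'a measure \<Rightarrow> ('a \<Rightarrow> 'b::{banach, second_countable_topology}) \<Rightarrow> real" where
  "L2_norm M f = sqrt (LINT x|M. (norm (f x))\<^sup>2)"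

lemma L2_norm_nonneg: "0 \<le> L2_norm M f"
  by (simp add: L2_norm_def)

lemma L2_norm_power2: "(L2_norm M f)\<^sup>2 = (LINT x|M. (norm (f x))\<^sup>2)"
  by (simp add: L2_norm_def)

lemma L2_measurable: "f \<in> L2_space M \<Longrightarrow> f \<in> borel_measurable M"
  by (simp add: L2_space_def)

lemma L2_norm_le_sqrt:
  assumes "(LINT x|M. (norm (f x))\<^sup>2) \<le> c"
  shows "L2_norm M f \<le> sqrt c"
  using assms by (simp add: L2_norm_def)

lemma L2_minus: "f \<in> L2_space M \<Longrightarrow> (\<lambda>x. - f x) \<in> L2_space M"
  by (simp add: L2_space_def)

lemma L2_norm_product_integrable:
  assumes "f \<in> L2_space M" "g \<in> L2_space M"
  shows "integrable M (\<lambda>x. norm (f x) * norm (g x))"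
proof (rule Bochner_Integration.integrable_bound[where f = "\<lambda>x. (norm (f x))\<^sup>2 + (norm (g x))\<^sup>2"])
  show "integrable M (\<lambda>x. (norm (f x))\<^sup>2 + (norm (g x))\<^sup>2)"
    using assms by (simp add: L2_space_def)
  show "(\<lambda>x. norm (f x) * norm (g x)) \<in> borel_measurable M"
    using assms by (auto simp: L2_space_def)
  have "norm (f x) * norm (g x) \<le> (norm (f x))\<^sup>2 + (norm (g x))\<^sup>2" for x
    using sum_squares_bound[of "norm (f x)" "norm (g x)"]
      mult_nonneg_nonneg[OF norm_ge_zero norm_ge_zero, of "f x" "g x"] by linarith
  then show "AE x in M. norm (norm (f x) * norm (g x)) \<le> norm ((norm (f x))\<^sup>2 + (norm (g x))\<^sup>2)"
    by simp
qed

text \<open>The quadratic form in (s, t) given by the integral of (s |f| - t |g|)^2 is nonnegative;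
  the best s and t give the claim, and a vanishing norm is handled by letting the other coefficient
  dominate.\<close>

lemma L2_Cauchy_Schwarz:
  assumes "f \<in> L2_space M" "g \<in> L2_space M"
  shows "(LINT x|M. norm (f x) * norm (g x)) \<le> L2_norm M f * L2_norm M g"
proof -
  define a where "a = (LINT x|M. (norm (f x))\<^sup>2)"
  define b where "b = (LINT x|M. (norm (g x))\<^sup>2)"
  define c where "c = (LINT x|M. norm (f x) * norm (g x))"
  have i: "integrable M (\<lambda>x. (norm (f x))\<^sup>2)" "integrable M (\<lambda>x. (norm (g x))\<^sup>2)"
    "integrable M (\<lambda>x. norm (f x) * norm (g x))"
    using assms L2_norm_product_integrable[OF assms] by (auto simp: L2_space_def)
  have nn: "a \<ge> 0" "b \<ge> 0" "c \<ge> 0" by (simp_all add: a_def b_def c_def)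
  have q: "2 * s * t * c \<le> s\<^sup>2 * a + t\<^sup>2 * b" for s t :: real
  proof -
    have "0 \<le> (LINT x|M. (s * norm (f x) - t * norm (g x))\<^sup>2)" by simp
    also have "\<dots> = (LINT x|M. s\<^sup>2 * (norm (f x))\<^sup>2 + t\<^sup>2 * (norm (g x))\<^sup>2
        - 2 * s * t * (norm (f x) * norm (g x)))"
      by (rule Bochner_Integration.integral_cong) (auto simp: power2_eq_square algebra_simps)
    also have "\<dots> = s\<^sup>2 * a + t\<^sup>2 * b - 2 * s * t * c"
      using i by (simp add: a_def b_def c_def)
    finally show ?thesis by simp
  qed
  have "c \<le> sqrt a * sqrt b"
  proof (cases "a = 0 \<or> b = 0")
    case True
    then show ?thesis
    proof
      assume "a = 0"
      have "c \<le> 0"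
      proof (rule ccontr)
        assume "\<not> c \<le> 0"
        \<comment> \<open>With a = 0 the right side of \<open>q\<close> is just b for t = 1, while
          this s makes the left side b + 1. The case b = 0 is symmetric.\<close>
        then show False using q[of "(b + 1) / (2 * c)" 1] nn \<open>a = 0\<close> by (simp add: field_simps)
      qed
      then show ?thesis using \<open>a = 0\<close> by simp
    next
      assume "b = 0"
      have "c \<le> 0"
      proof (rule ccontr)
        assume "\<not> c \<le> 0"
        then show False using q[of 1 "(a + 1) / (2 * c)"] nn \<open>b = 0\<close> by (simp add: field_simps)
      qed
      then show ?thesis using \<open>b = 0\<close> by simp
    qed
  next
    case False
    then have p: "0 < sqrt a" "0 < sqrt b" using nn by auto
    \<comment> \<open>The equality case s = sqrt b, t = sqrt a balances the two squares.\<close>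
    have "2 * sqrt b * sqrt a * c \<le> b * a + a * b"
      using q[of "sqrt b" "sqrt a"] nn by simp
    also have "\<dots> = 2 * sqrt b * sqrt a * (sqrt a * sqrt b)"
    proof -
      have "a = sqrt a * sqrt a" "b = sqrt b * sqrt b" using nn by simp_all
      then have "b * a + a * b = (sqrt b * sqrt b) * (sqrt a * sqrt a) + (sqrt a * sqrt a) * (sqrt b * sqrt b)"
        by presburger
      also have "\<dots> = 2 * sqrt b * sqrt a * (sqrt a * sqrt b)" by (simp only: mult_ac)
      finally show ?thesis .
    qed
    finally show ?thesis
      using p by simp
  qed
  then show ?thesis by (simp add: L2_norm_def a_def b_def c_def)
qed

lemma L2_add:
  assumes "f \<in> L2_space M" "g \<in> L2_space M"
  shows "(\<lambda>x. f x + g x) \<in> L2_space M"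
proof -
  have m[measurable]: "f \<in> borel_measurable M" "g \<in> borel_measurable M"
    using assms by (auto simp: L2_space_def)
  have "integrable M (\<lambda>x. (norm (f x + g x))\<^sup>2)"
  proof (rule Bochner_Integration.integrable_bound[where f = "\<lambda>x. 2 * (norm (f x))\<^sup>2 + 2 * (norm (g x))\<^sup>2"])
    show "integrable M (\<lambda>x. 2 * (norm (f x))\<^sup>2 + 2 * (norm (g x))\<^sup>2)"
      using assms by (simp add: L2_space_def)
    have "(norm (f x + g x))\<^sup>2 \<le> 2 * (norm (f x))\<^sup>2 + 2 * (norm (g x))\<^sup>2" for x
    proof -
      have "(norm (f x + g x))\<^sup>2 \<le> (norm (f x) + norm (g x))\<^sup>2"
        by (intro power_mono norm_triangle_ineq) auto
      also have "\<dots> \<le> 2 * (norm (f x))\<^sup>2 + 2 * (norm (g x))\<^sup>2"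
        using sum_squares_bound[of "norm (f x)" "norm (g x)"] by (simp add: power2_sum)
      finally show ?thesis .
    qed
    then show "AE x in M. norm ((norm (f x + g x))\<^sup>2) \<le> norm (2 * (norm (f x))\<^sup>2 + 2 * (norm (g x))\<^sup>2)"
      by simp
  qed simp
  then show ?thesis by (simp add: L2_space_def)
qed

lemma L2_diff:
  assumes "f \<in> L2_space M" "g \<in> L2_space M"
  shows "(\<lambda>x. f x - g x) \<in> L2_space M"
  using L2_add[OF assms(1) L2_minus[OF assms(2)]] by simp

lemma L2_triangle:
  assumes "f \<in> L2_space M" "g \<in> L2_space M"
  shows "L2_norm M (\<lambda>x. f x + g x) \<le> L2_norm M f + L2_norm M g"
proof -
  have i: "integrable M (\<lambda>x. (norm (f x))\<^sup>2)" "integrable M (\<lambda>x. (norm (g x))\<^sup>2)"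
    "integrable M (\<lambda>x. norm (f x) * norm (g x))" "integrable M (\<lambda>x. (norm (f x + g x))\<^sup>2)"
    using assms L2_norm_product_integrable[OF assms] L2_add[OF assms] by (auto simp: L2_space_def)
  have "(L2_norm M (\<lambda>x. f x + g x))\<^sup>2 = (LINT x|M. (norm (f x + g x))\<^sup>2)"
    by (rule L2_norm_power2)
  also have "\<dots> \<le> (LINT x|M. (norm (f x))\<^sup>2 + (norm (g x))\<^sup>2 + 2 * (norm (f x) * norm (g x)))"
  proof (rule integral_mono)
    show "(norm (f x + g x))\<^sup>2 \<le> (norm (f x))\<^sup>2 + (norm (g x))\<^sup>2 + 2 * (norm (f x) * norm (g x))" for x
      using power_mono[OF norm_triangle_ineq[of "f x" "g x"], of 2] by (simp add: power2_sum)
  qed (use i in auto)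
  also have "\<dots> = (L2_norm M f)\<^sup>2 + (L2_norm M g)\<^sup>2 + 2 * (LINT x|M. norm (f x) * norm (g x))"
    using i by (simp add: L2_norm_power2)
  also have "\<dots> \<le> (L2_norm M f)\<^sup>2 + (L2_norm M g)\<^sup>2 + 2 * (L2_norm M f * L2_norm M g)"
    using L2_Cauchy_Schwarz[OF assms] by simp
  also have "\<dots> = (L2_norm M f + L2_norm M g)\<^sup>2"
    by (simp add: power2_sum)
  finally show ?thesis
    by (rule power2_le_imp_le) (simp add: L2_norm_nonneg)
qed

lemma L2_triangle_diff:
  assumes "f \<in> L2_space M" "g \<in> L2_space M"
  shows "L2_norm M f \<le> L2_norm M g + L2_norm M (\<lambda>x. f x - g x)"
  using L2_triangle[OF assms(2) L2_diff[OF assms]] by simp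

lemma L2_triangle3:
  assumes "f \<in> L2_space M" "g \<in> L2_space M" "k \<in> L2_space M"
  shows "L2_norm M (\<lambda>x. f x - k x) \<le> L2_norm M (\<lambda>x. f x - g x) + L2_norm M (\<lambda>x. g x - k x)"
  using L2_triangle[OF L2_diff[OF assms(1,2)] L2_diff[OF assms(2,3)]] by simp

lemma L2_mult_integrable:
  fixes f g :: "'a \<Rightarrow> 'b::{banach, second_countable_topology, real_normed_field}"
  assumes "f \<in> L2_space M" "g \<in> L2_space M"
  shows "integrable M (\<lambda>x. f x * g x)"
  by (rule Bochner_Integration.integrable_bound[OF L2_norm_product_integrable[OF assms]])
     (use assms in \<open>auto simp: L2_space_def norm_mult\<close>)

text \<open>Telescoping f g - f' g' = (f - f') g + f' (g - g'). The norm of g is traded for that of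
  g' plus an error, so the bound contains only the limits and the distances to them.\<close>

lemma L2_product_diff:
  fixes f g :: "'a \<Rightarrow> 'b::{banach, second_countable_topology, real_normed_field}"
  assumes "f \<in> L2_space M" "g \<in> L2_space M" "f' \<in> L2_space M" "g' \<in> L2_space M"
  shows "(LINT x|M. norm (f x * g x - f' x * g' x))
    \<le> L2_norm M (\<lambda>x. f x - f' x) * (L2_norm M g' + L2_norm M (\<lambda>x. g x - g' x))
      + L2_norm M f' * L2_norm M (\<lambda>x. g x - g' x)"
proof -
  note d = L2_diff[OF assms(1,3)] L2_diff[OF assms(2,4)]
  have "(LINT x|M. norm (f x * g x - f' x * g' x))
     \<le> (LINT x|M. norm (f x - f' x) * norm (g x) + norm (f' x) * norm (g x - g' x))"
  proof (rule integral_mono)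
    show "integrable M (\<lambda>x. norm (f x * g x - f' x * g' x))"
      using L2_mult_integrable[OF assms(1,2)] L2_mult_integrable[OF assms(3,4)] by simp
    show "integrable M (\<lambda>x. norm (f x - f' x) * norm (g x) + norm (f' x) * norm (g x - g' x))"
      using L2_norm_product_integrable[OF d(1) assms(2)] L2_norm_product_integrable[OF assms(3) d(2)]
      by simp
    show "norm (f x * g x - f' x * g' x)
        \<le> norm (f x - f' x) * norm (g x) + norm (f' x) * norm (g x - g' x)" for x
    proof -
      have "f x * g x - f' x * g' x = (f x - f' x) * g x + f' x * (g x - g' x)"
        by (simp add: algebra_simps)
      then show ?thesis
        using norm_triangle_ineq[of "(f x - f' x) * g x" "f' x * (g x - g' x)"]
        by (simp add: norm_mult)
    qed
  qed
  also have "\<dots> = (LINT x|M. norm (f x - f' x) * norm (g x))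
      + (LINT x|M. norm (f' x) * norm (g x - g' x))"
    using L2_norm_product_integrable[OF d(1) assms(2)] L2_norm_product_integrable[OF assms(3) d(2)]
    by simp
  also have "\<dots> \<le> L2_norm M (\<lambda>x. f x - f' x) * L2_norm M g + L2_norm M f' * L2_norm M (\<lambda>x. g x - g' x)"
    by (intro add_mono L2_Cauchy_Schwarz d assms)
  also have "L2_norm M (\<lambda>x. f x - f' x) * L2_norm M g
     \<le> L2_norm M (\<lambda>x. f x - f' x) * (L2_norm M g' + L2_norm M (\<lambda>x. g x - g' x))"
    by (intro mult_left_mono L2_triangle_diff assms L2_norm_nonneg)
  finally show ?thesis by simp
qed

text \<open>The first conclusion, convergence in L1, controls random products; the second,
  convergence of inner products, yields the isometry and the limits of covariances.\<close>

lemma L2_product_tendsto: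
  fixes f g :: "nat \<Rightarrow> 'a \<Rightarrow> 'b::{banach, second_countable_topology, real_normed_field}"
  assumes L: "\<And>n. f n \<in> L2_space M" "\<And>n. g n \<in> L2_space M" "f' \<in> L2_space M" "g' \<in> L2_space M"
    and f: "(\<lambda>n. L2_norm M (\<lambda>x. f n x - f' x)) \<longlonglongrightarrow> 0"
    and g: "(\<lambda>n. L2_norm M (\<lambda>x. g n x - g' x)) \<longlonglongrightarrow> 0"
  shows "(\<lambda>n. LINT x|M. norm (f n x * g n x - f' x * g' x)) \<longlonglongrightarrow> 0"
    and "(\<lambda>n. LINT x|M. f n x * g n x) \<longlonglongrightarrow> (LINT x|M. f' x * g' x)"
proof -
  have lim: "(\<lambda>n. L2_norm M (\<lambda>x. f n x - f' x) * (L2_norm M g' + L2_norm M (\<lambda>x. g n x - g' x))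
      + L2_norm M f' * L2_norm M (\<lambda>x. g n x - g' x)) \<longlonglongrightarrow> 0"
    using tendsto_add[OF tendsto_mult[OF f tendsto_add[OF tendsto_const g]] tendsto_mult[OF tendsto_const g],
        of "L2_norm M g'" "L2_norm M f'"] by simp
  show 1: "(\<lambda>n. LINT x|M. norm (f n x * g n x - f' x * g' x)) \<longlonglongrightarrow> 0"
  proof (rule Lim_null_comparison[OF always_eventually lim], intro allI)
    fix n
    show "norm (LINT x|M. norm (f n x * g n x - f' x * g' x))
      \<le> L2_norm M (\<lambda>x. f n x - f' x) * (L2_norm M g' + L2_norm M (\<lambda>x. g n x - g' x))
      + L2_norm M f' * L2_norm M (\<lambda>x. g n x - g' x)"
      using L2_product_diff[OF L(1)[of n] L(2)[of n] L(3,4)] by simp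
  qed
  have "(\<lambda>n. (LINT x|M. f n x * g n x) - (LINT x|M. f' x * g' x)) \<longlonglongrightarrow> 0"
  proof (rule Lim_null_comparison[OF always_eventually 1], intro allI)
    fix n
    have "(LINT x|M. f n x * g n x) - (LINT x|M. f' x * g' x) = (LINT x|M. f n x * g n x - f' x * g' x)"
      using L2_mult_integrable[OF L(1)[of n] L(2)[of n]] L2_mult_integrable[OF L(3,4)] by simp
    then show "norm ((LINT x|M. f n x * g n x) - (LINT x|M. f' x * g' x))
        \<le> (LINT x|M. norm (f n x * g n x - f' x * g' x))"
      by (simp add: integral_norm_bound)
  qed
  then show "(\<lambda>n. LINT x|M. f n x * g n x) \<longlonglongrightarrow> (LINT x|M. f' x * g' x)"
    by (rule Lim_null[THEN iffD2])
qed

lemma L2_cnj: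
  assumes "f \<in> L2_space M"
  shows "(\<lambda>x. cnj (f x)) \<in> L2_space M" 
  using assms borel_measurable_continuous_onI[OF continuous_on_cnj[OF continuous_on_id]]
  by (auto simp: L2_space_def intro: measurable_compose)

lemma L2_norm_cnj_diff: "L2_norm M (\<lambda>x. cnj (f x) - cnj (g x)) = L2_norm M (\<lambda>x. f x - g x)"
  by (simp add: L2_norm_def flip: complex_cnj_diff)

lemma (in prob_space) expectation_abs_le_L2_norm:
  fixes X :: "'a \<Rightarrow> real"
  assumes "X \<in> L2_space M"
  shows "expectation (\<lambda>x. \<bar>X x\<bar>) \<le> L2_norm M X"
proof -
  have "(\<lambda>x. 1 :: real) \<in> L2_space M" by (simp add: L2_space_def)
  from L2_Cauchy_Schwarz[OF assms this] show ?thesis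
    by (simp add: L2_norm_def prob_space)
qed

text \<open>Normality enters the later moment computations through these facts: finite moments and E
  X^4 = 3 (E X^2)^2, from which the mixed fourth moments follow by polarisation. Both sides vanish
  in the degenerate case.\<close>

lemma (in prob_space) centred_gaussian_moments:
  assumes "centred_gaussian M X"
  shows "X \<in> borel_measurable M" "integrable M (\<lambda>x. X x ^ k)"
    "expectation (\<lambda>x. X x ^ 4) = 3 * (expectation (\<lambda>x. (X x)\<^sup>2))\<^sup>2"
proof -
  show m: "X \<in> borel_measurable M" using assms by (simp add: centred_gaussian_def)
  consider (z) "AE x in M. X x = 0" | (n) \<sigma> where "\<sigma> > 0" "distributed M lborel X (normal_density 0 \<sigma>)"
    using assms by (auto simp: centred_gaussian_def)
  then have "integrable M (\<lambda>x. X x ^ k) \<and>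
    expectation (\<lambda>x. X x ^ 4) = 3 * (expectation (\<lambda>x. (X x)\<^sup>2))\<^sup>2"
  proof cases
    case z
    have e: "expectation (\<lambda>x. X x ^ j) = (if j = 0 then 1 else 0)" for j
    proof -
      have "expectation (\<lambda>x. X x ^ j) = expectation (\<lambda>x. if j = 0 then 1 else 0)"
        by (rule integral_cong_AE) (use z m in auto)
      then show ?thesis by (simp add: prob_space)
    qed
    have "integrable M (\<lambda>x. if k = 0 then 1 else 0 :: real)" by simp
    then have "integrable M (\<lambda>x. X x ^ k)"
      by (rule integrable_cong_AE_imp) (use z m in auto)
    with e show ?thesis by simp
  next
    case (n \<sigma>)
    have i: "integrable M (\<lambda>x. X x ^ j)" for j
    proof -
      have "integrable lborel (\<lambda>x. normal_density 0 \<sigma> x * x ^ j)"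
        using integrable_normal_moment[OF n(1), of 0 j] by simp
      then show ?thesis
        using distributed_integrable[OF n(2), of "\<lambda>x. x ^ j"] by simp
    qed
    have e: "expectation (\<lambda>x. X x ^ (2 * j)) = fact (2 * j) / ((2 / \<sigma>\<^sup>2)^j * fact j)" for j
    proof -
      have "expectation (\<lambda>x. X x ^ (2 * j)) = (\<integral>x. normal_density 0 \<sigma> x * x ^ (2 * j) \<partial>lborel)"
        using distributed_integral[OF n(2), of "\<lambda>x. x ^ (2 * j)"] by simp
      then show ?thesis using integral_normal_moment_even[OF n(1), of 0 j] by simp
    qed
    \<comment> \<open>The even-moment formula gives \<sigma>^2 for j = 1 and 24 \<sigma>^4 / 8 = 3
      \<sigma>^4 for j = 2.\<close>
    have "fact 4 = (24::real)" by (simp add: eval_nat_numeral)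
    then have "expectation (\<lambda>x. X x ^ 4) = 3 * (expectation (\<lambda>x. (X x)\<^sup>2))\<^sup>2"
      using e[of 1] e[of 2] n(1) by (simp add: power2_eq_square field_simps)
    with i show ?thesis by simp
  qed
  then show "integrable M (\<lambda>x. X x ^ k)"
    "expectation (\<lambda>x. X x ^ 4) = 3 * (expectation (\<lambda>x. (X x)\<^sup>2))\<^sup>2" by auto
qed

section \<open>Quadratic forms in Gaussian variables\<close>

text \<open>Joint Gaussianity is encoded by closure: sums and differences of members are again
  centred Gaussian, which is exactly what polarisation asks for.\<close>

locale gaussian_space = prob_space +
  fixes G :: "('a \<Rightarrow> real) set"
  assumes gaussian: "X \<in> G \<Longrightarrow> centred_gaussian M X"
    and add_closed: "X \<in> G \<Longrightarrow> Y \<in> G \<Longrightarrow> (\<lambda>\<omega>. X \<omega> + Y \<omega>) \<in> G"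
    and diff_closed: "X \<in> G \<Longrightarrow> Y \<in> G \<Longrightarrow> (\<lambda>\<omega>. X \<omega> - Y \<omega>) \<in> G"
begin

lemmas moments = centred_gaussian_moments[OF gaussian]

lemma in_L2: "X \<in> G \<Longrightarrow> X \<in> L2_space M"
  using moments(1)[of X] moments(2)[of X 2] by (simp add: L2_space_def)

lemma product_integrable: "X \<in> G \<Longrightarrow> Y \<in> G \<Longrightarrow> integrable M (\<lambda>\<omega>. X \<omega> * Y \<omega>)"
  by (intro L2_mult_integrable in_L2)

text \<open>Isserlis' formula follows from the fourth moment of a single variable by
  \<open>12 U\<^sup>2 V\<^sup>2 = (U + V)\<^sup>4 + (U - V)\<^sup>4 - 2 U\<^sup>4 - 2 V\<^sup>4\<close>.\<close>

lemma squares_product: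
  assumes "U \<in> G" "V \<in> G"
  shows "integrable M (\<lambda>\<omega>. (U \<omega>)\<^sup>2 * (V \<omega>)\<^sup>2)"
    and "expectation (\<lambda>\<omega>. (U \<omega>)\<^sup>2 * (V \<omega>)\<^sup>2) =
      expectation (\<lambda>\<omega>. (U \<omega>)\<^sup>2) * expectation (\<lambda>\<omega>. (V \<omega>)\<^sup>2)
      + 2 * (expectation (\<lambda>\<omega>. U \<omega> * V \<omega>))\<^sup>2"
proof -
  note ad = add_closed[OF assms] diff_closed[OF assms]
  define u v c where "u = expectation (\<lambda>\<omega>. (U \<omega>)\<^sup>2)" and "v = expectation (\<lambda>\<omega>. (V \<omega>)\<^sup>2)"
    and "c = expectation (\<lambda>\<omega>. U \<omega> * V \<omega>)"
  have pol: "(U \<omega>)\<^sup>2 * (V \<omega>)\<^sup>2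
    = ((U \<omega> + V \<omega>) ^ 4 + (U \<omega> - V \<omega>) ^ 4 - 2 * U \<omega> ^ 4 - 2 * V \<omega> ^ 4) / 12" for \<omega>
    by (simp add: power4_eq_xxxx power2_eq_square algebra_simps)
  note i4 = moments(2)[OF ad(1), of 4] moments(2)[OF ad(2), of 4]
    moments(2)[OF assms(1), of 4] moments(2)[OF assms(2), of 4]
  note i2 = moments(2)[OF assms(1), of 2] moments(2)[OF assms(2), of 2] product_integrable[OF assms]
  show "integrable M (\<lambda>\<omega>. (U \<omega>)\<^sup>2 * (V \<omega>)\<^sup>2)"
    unfolding pol using i4 by simp
  have "expectation (\<lambda>\<omega>. (U \<omega> + V \<omega>)\<^sup>2) = expectation (\<lambda>\<omega>. (U \<omega>)\<^sup>2 + (V \<omega>)\<^sup>2 + 2 * (U \<omega> * V \<omega>))"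
    by (simp add: power2_sum mult.assoc)
  then have p: "expectation (\<lambda>\<omega>. (U \<omega> + V \<omega>)\<^sup>2) = u + v + 2 * c"
    using i2 by (simp add: u_def v_def c_def)
  have "expectation (\<lambda>\<omega>. (U \<omega> - V \<omega>)\<^sup>2) = expectation (\<lambda>\<omega>. (U \<omega>)\<^sup>2 + (V \<omega>)\<^sup>2 - 2 * (U \<omega> * V \<omega>))"
    by (simp add: power2_diff mult.assoc)
  then have m: "expectation (\<lambda>\<omega>. (U \<omega> - V \<omega>)\<^sup>2) = u + v - 2 * c"
    using i2 by (simp add: u_def v_def c_def)
  have "expectation (\<lambda>\<omega>. (U \<omega>)\<^sup>2 * (V \<omega>)\<^sup>2)
    = (3 * (u + v + 2 * c)\<^sup>2 + 3 * (u + v - 2 * c)\<^sup>2 - 2 * (3 * u\<^sup>2) - 2 * (3 * v\<^sup>2)) / 12"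
    unfolding pol using i4 moments(3)[OF ad(1)] moments(3)[OF ad(2)] moments(3)[OF assms(1)]
      moments(3)[OF assms(2)]
    by (simp add: p m flip: u_def v_def)
  also have "\<dots> = u * v + 2 * c\<^sup>2"
    by (simp add: power2_eq_square algebra_simps)
  finally show "expectation (\<lambda>\<omega>. (U \<omega>)\<^sup>2 * (V \<omega>)\<^sup>2) =
      expectation (\<lambda>\<omega>. (U \<omega>)\<^sup>2) * expectation (\<lambda>\<omega>. (V \<omega>)\<^sup>2)
      + 2 * (expectation (\<lambda>\<omega>. U \<omega> * V \<omega>))\<^sup>2"
    by (simp add: u_def v_def c_def)
qed

text \<open>Centring removes the product of variances from Isserlis' formula. What remains is
  quadratic in the covariance, so quadratic forms concentrate as soon as covariances are small on
  average.\<close>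

lemma centred_squares_product:
  assumes "U \<in> G" "V \<in> G"
  defines "u \<equiv> expectation (\<lambda>\<omega>. (U \<omega>)\<^sup>2)" and "v \<equiv> expectation (\<lambda>\<omega>. (V \<omega>)\<^sup>2)"
  shows "integrable M (\<lambda>\<omega>. ((U \<omega>)\<^sup>2 - u) * ((V \<omega>)\<^sup>2 - v))"
    and "expectation (\<lambda>\<omega>. ((U \<omega>)\<^sup>2 - u) * ((V \<omega>)\<^sup>2 - v)) = 2 * (expectation (\<lambda>\<omega>. U \<omega> * V \<omega>))\<^sup>2"
proof -
  have e: "((U \<omega>)\<^sup>2 - u) * ((V \<omega>)\<^sup>2 - v) = (U \<omega>)\<^sup>2 * (V \<omega>)\<^sup>2 - v * (U \<omega>)\<^sup>2 - u * (V \<omega>)\<^sup>2 + u * v" for \<omega>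
    by (simp add: algebra_simps)
  note i = squares_product(1)[OF assms(1,2)] moments(2)[OF assms(1), of 2] moments(2)[OF assms(2), of 2]
  show "integrable M (\<lambda>\<omega>. ((U \<omega>)\<^sup>2 - u) * ((V \<omega>)\<^sup>2 - v))"
    unfolding e using i by simp
  show "expectation (\<lambda>\<omega>. ((U \<omega>)\<^sup>2 - u) * ((V \<omega>)\<^sup>2 - v)) = 2 * (expectation (\<lambda>\<omega>. U \<omega> * V \<omega>))\<^sup>2"
    unfolding e using i squares_product(2)[OF assms(1,2)]
    by (simp add: prob_space u_def v_def)
qed

text \<open>The L1 norm is at most the L2 norm, and the second moment expands into the covariances
  of the centred squares.\<close>

lemma expectation_abs_square_sum_le:
  fixes U :: "'i \<Rightarrow> 'a \<Rightarrow> real" and w :: "'i \<Rightarrow> real"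
  assumes "finite I" "\<And>i. i \<in> I \<Longrightarrow> U i \<in> G" "\<And>i. i \<in> I \<Longrightarrow> \<bar>w i\<bar> \<le> C" "C \<ge> 0"
  shows "integrable M (\<lambda>\<omega>. \<Sum>i\<in>I. w i * ((U i \<omega>)\<^sup>2 - expectation (\<lambda>\<omega>. (U i \<omega>)\<^sup>2)))"
    and "expectation (\<lambda>\<omega>. \<bar>\<Sum>i\<in>I. w i * ((U i \<omega>)\<^sup>2 - expectation (\<lambda>\<omega>. (U i \<omega>)\<^sup>2))\<bar>)
      \<le> C * sqrt (2 * (\<Sum>i\<in>I. \<Sum>j\<in>I. (expectation (\<lambda>\<omega>. U i \<omega> * U j \<omega>))\<^sup>2))"
proof -
  define D where "D i \<omega> = (U i \<omega>)\<^sup>2 - expectation (\<lambda>\<omega>. (U i \<omega>)\<^sup>2)" for i \<omega>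
  define c where "c i j = expectation (\<lambda>\<omega>. U i \<omega> * U j \<omega>)" for i j
  have iD: "integrable M (D i)" if "i \<in> I" for i
    using moments(2)[OF assms(2)[OF that], of 2] by (simp add: D_def[abs_def])
  have iDD: "integrable M (\<lambda>\<omega>. D i \<omega> * D j \<omega>)" and eDD: "expectation (\<lambda>\<omega>. D i \<omega> * D j \<omega>) = 2 * (c i j)\<^sup>2"
    if "i \<in> I" "j \<in> I" for i j
    using centred_squares_product[OF assms(2)[OF that(1)] assms(2)[OF that(2)]]
    by (simp_all add: D_def c_def)
  show "integrable M (\<lambda>\<omega>. \<Sum>i\<in>I. w i * ((U i \<omega>)\<^sup>2 - expectation (\<lambda>\<omega>. (U i \<omega>)\<^sup>2)))"
    using iD by (auto intro!: Bochner_Integration.integrable_sum simp: D_def[abs_def])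
  have sq: "(\<Sum>i\<in>I. w i * D i \<omega>)\<^sup>2 = (\<Sum>i\<in>I. \<Sum>j\<in>I. (w i * w j) * (D i \<omega> * D j \<omega>))" for \<omega>
    by (simp add: power2_eq_square sum_product mult_ac)
  have isq: "integrable M (\<lambda>\<omega>. (\<Sum>i\<in>I. w i * D i \<omega>)\<^sup>2)"
    unfolding sq by (intro Bochner_Integration.integrable_sum integrable_mult_right iDD)
  have "expectation (\<lambda>\<omega>. (\<Sum>i\<in>I. w i * D i \<omega>)\<^sup>2) = (\<Sum>i\<in>I. \<Sum>j\<in>I. (w i * w j) * (2 * (c i j)\<^sup>2))"
    unfolding sq
    by (subst Bochner_Integration.integral_sum, intro Bochner_Integration.integrable_sum integrable_mult_right iDD, assumption+,
        intro sum.cong refl, subst Bochner_Integration.integral_sum, intro integrable_mult_right iDD, assumption+,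
        intro sum.cong refl) (simp add: eDD)
  \<comment> \<open>Each term carries a square of a covariance, so the weights may be bounded one by
    one whatever their signs.\<close>
  also have "\<dots> \<le> (\<Sum>i\<in>I. \<Sum>j\<in>I. C\<^sup>2 * (2 * (c i j)\<^sup>2))"
  proof (intro sum_mono mult_right_mono)
    fix i j assume ij: "i \<in> I" "j \<in> I"
    have "w i * w j \<le> \<bar>w i\<bar> * \<bar>w j\<bar>" by (metis abs_ge_self abs_mult)
    also have "\<dots> \<le> C * C" using assms(3)[OF ij(1)] assms(3)[OF ij(2)] assms(4) by (intro mult_mono) auto
    finally show "w i * w j \<le> C\<^sup>2" by (simp add: power2_eq_square)
  qed auto
  also have "\<dots> = C\<^sup>2 * (2 * (\<Sum>i\<in>I. \<Sum>j\<in>I. (c i j)\<^sup>2))"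
    by (simp add: sum_distrib_left)
  finally have le: "L2_norm M (\<lambda>\<omega>. \<Sum>i\<in>I. w i * D i \<omega>) \<le> sqrt (C\<^sup>2 * (2 * (\<Sum>i\<in>I. \<Sum>j\<in>I. (c i j)\<^sup>2)))"
    unfolding L2_norm_def by simp
  have "(\<lambda>\<omega>. \<Sum>i\<in>I. w i * D i \<omega>) \<in> L2_space M"
    using isq iD by (auto simp: L2_space_def intro!: borel_measurable_sum borel_measurable_times)
  from expectation_abs_le_L2_norm[OF this] le
  have "expectation (\<lambda>\<omega>. \<bar>\<Sum>i\<in>I. w i * D i \<omega>\<bar>) \<le> C * sqrt (2 * (\<Sum>i\<in>I. \<Sum>j\<in>I. (c i j)\<^sup>2))"
    using assms(4) by (simp only: real_sqrt_mult real_sqrt_abs abs_of_nonneg)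
  then show "expectation (\<lambda>\<omega>. \<bar>\<Sum>i\<in>I. w i * ((U i \<omega>)\<^sup>2 - expectation (\<lambda>\<omega>. (U i \<omega>)\<^sup>2))\<bar>)
      \<le> C * sqrt (2 * (\<Sum>i\<in>I. \<Sum>j\<in>I. (expectation (\<lambda>\<omega>. U i \<omega> * U j \<omega>))\<^sup>2))"
    by (simp add: D_def c_def)
qed

text \<open>Lagged products become squares by 4 a b = (a + b)^2 - (a - b)^2. The bound is expressed
  by the covariances of the original variables alone, which is the form that survives the passage to
  limits.\<close>

lemma expectation_abs_autocovariance_le:
  fixes Z :: "nat \<Rightarrow> 'a \<Rightarrow> real" and w :: "nat \<Rightarrow> real"
  assumes Z: "\<And>i. i < n + k \<Longrightarrow> Z i \<in> G" and w: "\<And>i. i < n \<Longrightarrow> \<bar>w i\<bar> \<le> C" and C: "C \<ge> 0"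
  defines "r \<equiv> \<lambda>i j. expectation (\<lambda>\<omega>. Z i \<omega> * Z j \<omega>)"
  shows "expectation (\<lambda>\<omega>. \<bar>\<Sum>i<n. w i * (Z i \<omega> * Z (i + k) \<omega> - r i (i + k))\<bar>)
      \<le> 3 * C * sqrt (\<Sum>i<n+k. \<Sum>j<n+k. (r i j)\<^sup>2)"
proof -
  define R where "R = (\<Sum>i<n+k. \<Sum>j<n+k. (r i j)\<^sup>2)"
  define U where "U \<sigma> i \<omega> = Z i \<omega> + \<sigma> * Z (i + k) \<omega>" for \<sigma> :: real and i \<omega>
  have UG: "U \<sigma> i \<in> G" if "\<sigma> \<in> {1, -1}" "i < n" for \<sigma> i
    using that add_closed[of "Z i" "Z (i + k)"] diff_closed[of "Z i" "Z (i + k)"] Z[of i] Z[of "i + k"]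
    by (auto simp: U_def[abs_def])
  have iZ: "integrable M (\<lambda>\<omega>. Z i \<omega> * Z j \<omega>)" if "i < n + k" "j < n + k" for i j
    using product_integrable Z that by simp
  \<comment> \<open>\<open>shift\<close> and \<open>noshift\<close> embed each of the four index
    patterns produced by expanding the products of \<open>U\<close> into the full square of n + k
    indices.\<close>
  have shift: "(\<Sum>i<n. f (i + k)) \<le> (\<Sum>i<n+k. f i)" if "\<And>i. f i \<ge> 0" for f :: "nat \<Rightarrow> real"
  proof -
    have "(\<Sum>i<n. f (i + k)) = sum f ((\<lambda>i. i + k) ` {..<n})"
      by (subst sum.reindex) (auto simp: inj_on_def)
    also have "\<dots> \<le> sum f {..<n+k}" by (intro sum_mono2) (auto simp: that)
    finally show ?thesis .
  qed
  have noshift: "(\<Sum>i<n. f i) \<le> (\<Sum>i<n+k. f i)" if "\<And>i. f i \<ge> 0" for f :: "nat \<Rightarrow> real"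
    by (intro sum_mono2) (auto simp: that)
  have R1: "(\<Sum>i<n. \<Sum>j<n. (r i j)\<^sup>2) \<le> R" unfolding R_def
    by (rule order_trans[OF sum_mono noshift]) (auto intro!: noshift sum_nonneg)
  have R2: "(\<Sum>i<n. \<Sum>j<n. (r i (j + k))\<^sup>2) \<le> R" unfolding R_def
    by (rule order_trans[OF sum_mono[OF shift] noshift]) (auto intro!: sum_nonneg)
  have R3: "(\<Sum>i<n. \<Sum>j<n. (r (i + k) j)\<^sup>2) \<le> R" unfolding R_def
    by (rule order_trans[OF sum_mono[OF noshift] shift]) (auto intro!: sum_nonneg)
  have R4: "(\<Sum>i<n. \<Sum>j<n. (r (i + k) (j + k))\<^sup>2) \<le> R" unfolding R_def
    by (rule order_trans[OF sum_mono[OF shift] shift]) (auto intro!: sum_nonneg)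
  have sq4: "(a + b + c + d)\<^sup>2 \<le> 4 * (a\<^sup>2 + b\<^sup>2 + c\<^sup>2 + d\<^sup>2)" for a b c d :: real
    using sum_squares_bound[of a b] sum_squares_bound[of a c] sum_squares_bound[of a d]
      sum_squares_bound[of b c] sum_squares_bound[of b d] sum_squares_bound[of c d]
    by (simp add: power2_eq_square algebra_simps)
  have eU: "(expectation (\<lambda>\<omega>. U \<sigma> i \<omega> * U \<sigma> j \<omega>))\<^sup>2
      \<le> 4 * ((r i j)\<^sup>2 + (r i (j + k))\<^sup>2 + (r (i + k) j)\<^sup>2 + (r (i + k) (j + k))\<^sup>2)"
    if \<sigma>: "\<sigma> \<in> {1, -1}" and ij: "i < n" "j < n" for \<sigma> i j
  proof -
    have "expectation (\<lambda>\<omega>. U \<sigma> i \<omega> * U \<sigma> j \<omega>) = expectation (\<lambda>\<omega>. Z i \<omega> * Z j \<omega> + \<sigma> * (Z i \<omega> * Z (j + k) \<omega>)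
        + \<sigma> * (Z (i + k) \<omega> * Z j \<omega>) + Z (i + k) \<omega> * Z (j + k) \<omega>)"
      using \<sigma> by (auto simp: U_def algebra_simps)
    also have "\<dots> = r i j + \<sigma> * r i (j + k) + \<sigma> * r (i + k) j + r (i + k) (j + k)"
      using ij by (simp add: iZ r_def)
    finally show ?thesis
      using sq4[of "r i j" "\<sigma> * r i (j + k)" "\<sigma> * r (i + k) j" "r (i + k) (j + k)"] \<sigma> by auto
  qed
  have sumR: "(\<Sum>i<n. \<Sum>j<n. 4 * ((r i j)\<^sup>2 + (r i (j + k))\<^sup>2 + (r (i + k) j)\<^sup>2 + (r (i + k) (j + k))\<^sup>2)) \<le> 16 * R"
    using R1 R2 R3 R4 by (simp add: sum.distrib flip: sum_distrib_left)
  define a where "a \<sigma> \<omega> = (\<Sum>i<n. w i * ((U \<sigma> i \<omega>)\<^sup>2 - expectation (\<lambda>\<omega>. (U \<sigma> i \<omega>)\<^sup>2)))" for \<sigma> \<omega>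
  have R0: "R \<ge> 0" by (simp add: R_def sum_nonneg)
  have a: "integrable M (a \<sigma>)" "expectation (\<lambda>\<omega>. \<bar>a \<sigma> \<omega>\<bar>) \<le> 6 * C * sqrt R" if \<sigma>: "\<sigma> \<in> {1, -1}" for \<sigma>
  proof -
    let ?s = "\<Sum>i<n. \<Sum>j<n. (expectation (\<lambda>\<omega>. U \<sigma> i \<omega> * U \<sigma> j \<omega>))\<^sup>2"
    note q = expectation_abs_square_sum_le[of "{..<n}" "U \<sigma>" w C, folded a_def]
    show "integrable M (a \<sigma>)" using q(1) UG[OF \<sigma>] w C by (auto simp: a_def[abs_def])
    have "?s \<le> 16 * R"
      by (rule order_trans[OF _ sumR], intro sum_mono eU \<sigma>) auto
    \<comment> \<open>2 * 16 = 32 is rounded up to the square 36. The two signs then contribute 6/4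
      each, which is the 3 of the claim.\<close>
    then have "sqrt (2 * ?s) \<le> sqrt (36 * R)" using R0 by simp
    also have "\<dots> = 6 * sqrt R" using real_sqrt_mult[of 36 R] by simp
    finally have "C * sqrt (2 * ?s) \<le> 6 * C * sqrt R"
      using C mult_left_mono[of "sqrt (2 * ?s)" "6 * sqrt R" C] by simp
    moreover have "expectation (\<lambda>\<omega>. \<bar>a \<sigma> \<omega>\<bar>) \<le> C * sqrt (2 * ?s)"
      using q(2) UG[OF \<sigma>] w C by (auto simp: a_def[abs_def])
    ultimately show "expectation (\<lambda>\<omega>. \<bar>a \<sigma> \<omega>\<bar>) \<le> 6 * C * sqrt R" by linarith
  qed
  have r: "r i (i + k) = (expectation (\<lambda>\<omega>. (U 1 i \<omega>)\<^sup>2) - expectation (\<lambda>\<omega>. (U (-1) i \<omega>)\<^sup>2)) / 4" if "i < n" for i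
  proof -
    have "expectation (\<lambda>\<omega>. (U 1 i \<omega>)\<^sup>2) - expectation (\<lambda>\<omega>. (U (-1) i \<omega>)\<^sup>2) = expectation (\<lambda>\<omega>. (U 1 i \<omega>)\<^sup>2 - (U (-1) i \<omega>)\<^sup>2)"
      using moments(2)[OF UG[OF _ that], of _ 2] by simp
    also have "\<dots> = expectation (\<lambda>\<omega>. 4 * (Z i \<omega> * Z (i + k) \<omega>))"
      by (rule Bochner_Integration.integral_cong) (auto simp: U_def power2_eq_square algebra_simps)
    finally show ?thesis by (simp add: r_def)
  qed
  have ab: "(\<Sum>i<n. w i * (Z i \<omega> * Z (i + k) \<omega> - r i (i + k))) = a 1 \<omega> / 4 - a (-1) \<omega> / 4" for \<omega>
    unfolding a_def sum_divide_distrib sum_subtractf[symmetric]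
    by (intro sum.cong refl) (auto simp: r U_def power2_eq_square field_simps)
  have "expectation (\<lambda>\<omega>. \<bar>\<Sum>i<n. w i * (Z i \<omega> * Z (i + k) \<omega> - r i (i + k))\<bar>)
      \<le> expectation (\<lambda>\<omega>. \<bar>a 1 \<omega>\<bar> / 4 + \<bar>a (-1) \<omega>\<bar> / 4)"
    unfolding ab using a(1) by (intro integral_mono) auto
  also have "\<dots> = expectation (\<lambda>\<omega>. \<bar>a 1 \<omega>\<bar>) / 4 + expectation (\<lambda>\<omega>. \<bar>a (-1) \<omega>\<bar>) / 4"
    using a(1) by simp
  also have "\<dots> \<le> 3 * C * sqrt R" using a(2)[of 1] a(2)[of "-1"] by simp
  finally show ?thesis by (simp add: R_def)
qed

end

section \<open>Stochastic integrals\<close>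

text \<open>Bridge from the extended nonnegative integrals in \<open>has_stochastic_integral\<close>
  to \<open>L2_norm\<close>. Membership of the limit is part of the conclusion.\<close>

lemma L2_limit:
  fixes f :: "nat \<Rightarrow> 'a \<Rightarrow> 'b::{banach, second_countable_topology}"
  assumes f: "\<And>n. f n \<in> L2_space M" and g: "g \<in> borel_measurable M"
    and lim: "(\<lambda>n. \<integral>\<^sup>+x. ennreal ((norm (f n x - g x))\<^sup>2) \<partial>M) \<longlonglongrightarrow> 0"
  shows "g \<in> L2_space M" and "(\<lambda>n. L2_norm M (\<lambda>x. f n x - g x)) \<longlonglongrightarrow> 0"
proof -
  have m: "(\<lambda>x. f n x - g x) \<in> borel_measurable M" for n
    using L2_measurable[OF f[of n]] g by simp
  \<comment> \<open>A single index with finite distance suffices: g is \<open>f n\<close> minus a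
    square-integrable difference.\<close>
  have "eventually (\<lambda>n. (\<integral>\<^sup>+x. ennreal ((norm (f n x - g x))\<^sup>2) \<partial>M) < 1) sequentially"
    by (rule order_tendstoD(2)[OF lim]) simp
  then obtain n where "(\<integral>\<^sup>+x. ennreal ((norm (f n x - g x))\<^sup>2) \<partial>M) < 1"
    by (meson eventually_happens trivial_limit_sequentially)
  then have "(\<integral>\<^sup>+x. ennreal ((norm (f n x - g x))\<^sup>2) \<partial>M) < \<infinity>"
    by (rule less_trans) simp
  then have "(\<lambda>x. f n x - g x) \<in> L2_space M"
    using m[of n] by (simp add: L2_space_def integrable_iff_bounded)
  from L2_diff[OF f[of n] this] show g2: "g \<in> L2_space M" by simp
  have "(\<integral>\<^sup>+x. ennreal ((norm (f n x - g x))\<^sup>2) \<partial>M) = ennreal ((L2_norm M (\<lambda>x. f n x - g x))\<^sup>2)" for n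
    unfolding L2_norm_power2 using L2_diff[OF f g2, of n]
    by (intro nn_integral_eq_integral) (auto simp: L2_space_def)
  then have "(\<lambda>n. ennreal ((L2_norm M (\<lambda>x. f n x - g x))\<^sup>2)) \<longlonglongrightarrow> ennreal 0"
    using lim by simp
  then have "(\<lambda>n. (L2_norm M (\<lambda>x. f n x - g x))\<^sup>2) \<longlonglongrightarrow> 0"
    by (subst (asm) tendsto_ennreal_iff) auto
  from tendsto_real_sqrt[OF this] show "(\<lambda>n. L2_norm M (\<lambda>x. f n x - g x)) \<longlonglongrightarrow> 0"
    by (simp add: L2_norm_nonneg)
qed

section \<open>Integrals of step functions\<close>

definition step_list :: "(complex \<times> real \<times> real) list \<Rightarrow> bool" where
  "step_list cs \<longleftrightarrow> (\<forall>(c, a, b)\<in>set cs. -pi \<le> a \<and> a \<le> b \<and> b \<le> pi)"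

text \<open>Used with -1 to form differences and with -\<i> to reach imaginary parts through real
  parts.\<close>

definition scale_step :: "complex \<Rightarrow> (complex \<times> real \<times> real) list \<Rightarrow> (complex \<times> real \<times> real) list" where
  "scale_step z cs = map (\<lambda>(c, a, b). (z * c, a, b)) cs"

lemma step_list_simps [simp]:
  "step_list []" "step_list (cs @ ds) \<longleftrightarrow> step_list cs \<and> step_list ds"
  "step_list cs \<Longrightarrow> step_list (scale_step z cs)"
  unfolding step_list_def scale_step_def by fastforce+

lemma step_integral_simps:
  "step_integral B [] = (\<lambda>\<omega>. 0)"
  "step_integral B (cs @ ds) = (\<lambda>\<omega>. step_integral B cs \<omega> + step_integral B ds \<omega>)"
  "step_integral B (e # cs) = (\<lambda>\<omega>. step_integral B [e] \<omega> + step_integral B cs \<omega>)"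
  "step_integral B (scale_step z cs) = (\<lambda>\<omega>. z * step_integral B cs \<omega>)"
proof -
  show "step_integral B [] = (\<lambda>\<omega>. 0)"
    "step_integral B (cs @ ds) = (\<lambda>\<omega>. step_integral B cs \<omega> + step_integral B ds \<omega>)"
    "step_integral B (e # cs) = (\<lambda>\<omega>. step_integral B [e] \<omega> + step_integral B cs \<omega>)"
    by (simp_all add: step_integral_def fun_eq_iff)
  show "step_integral B (scale_step z cs) = (\<lambda>\<omega>. z * step_integral B cs \<omega>)"
    by (induction cs) (auto simp: step_integral_def fun_eq_iff scale_step_def algebra_simps)
qed

lemma step_fun_simps:
  "step_fun [] = (\<lambda>\<omega>. 0)"
  "step_fun (e # cs) = (\<lambda>x. step_fun [e] x + step_fun cs x)"
  by (auto simp: step_fun_def fun_eq_iff)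

text \<open>The completed measure is kept, as in the definition of the stochastic integral:
  integrands are only known to be Lebesgue measurable.\<close>

abbreviation freq :: "real measure" where
  "freq \<equiv> lebesgue_on {-pi..pi}"

lemma finite_measure_freq: "finite_measure freq"
  by (intro finite_measureI) (simp add: emeasure_restrict_space)

lemma borel_measurable_freq: "f \<in> borel_measurable borel \<Longrightarrow> f \<in> borel_measurable freq"
  by (intro measurable_restrict_space1 measurable_completion) simp

lemma step_fun_L2: "step_fun cs \<in> L2_space freq"
proof (induction cs)
  case Nil
  show ?case by (simp add: step_fun_simps(1) L2_space_def)
next
  case (Cons e cs)
  obtain c a b where e: "e = (c, a, b)" by (cases e)
  have m: "step_fun [e] \<in> borel_measurable freq"
    unfolding e step_fun_def by (intro borel_measurable_freq) simp
  have "(cmod (step_fun [e] x))\<^sup>2 \<le> (cmod c)\<^sup>2" for x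
    by (simp add: e step_fun_def norm_mult indicator_def)
  then have "integrable freq (\<lambda>x. (cmod (step_fun [e] x))\<^sup>2)"
    using m by (intro finite_measure.integrable_const_bound[OF finite_measure_freq, where B = "(cmod c)\<^sup>2"]) auto
  with m have "step_fun [e] \<in> L2_space freq" by (simp add: L2_space_def)
  from L2_add[OF this Cons.IH] show ?case by (subst step_fun_simps)
qed

lemma step_fun_single_product:
  assumes "-pi \<le> a" "a \<le> b" "b \<le> pi" "-pi \<le> a'" "a' \<le> b'" "b' \<le> pi"
  shows "(LINT x|freq. step_fun [(c, a, b)] x * cnj (step_fun [(c', a', b')] x))
    = c * cnj c' * of_real (measure lborel ({a<..b} \<inter> {a'<..b'}))"
proof -
  let ?S = "{a<..b} \<inter> {a'<..b'}"
  have s: "?S \<in> sets freq" "?S \<subseteq> {-pi..pi}"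
    using assms by (auto simp: sets_restrict_space_iff)
  have "(LINT x|freq. step_fun [(c, a, b)] x * cnj (step_fun [(c', a', b')] x))
    = (LINT x|freq. c * cnj c' * of_real (indicator ?S x))"
    by (intro Bochner_Integration.integral_cong) (auto simp: step_fun_def indicator_def)
  also have "\<dots> = c * cnj c' * of_real (LINT x|freq. indicator ?S x)"
    by (subst integral_mult_right_zero, subst integral_complex_of_real) rule
  also have "(LINT x|freq. indicator ?S x) = measure freq ?S"
    using s by (simp add: Int_absorb2 space_restrict_space)
  also have "\<dots> = measure lborel ?S"
    using s by (simp add: measure_restrict_space)
  finally show ?thesis .
qed

locale brownian = prob_space P for P :: "'w measure" +
  fixes B :: "real \<Rightarrow> 'w \<Rightarrow> complex"
  assumes hbm: "hermitian_brownian_motion P B"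
begin

lemma step_integral_gaussian:
  assumes "step_list cs"
  shows "centred_gaussian P (\<lambda>\<omega>. Re (step_integral B cs \<omega>))"
proof -
  define c where "c i = fst (cs ! i)" for i
  define a where "a i = fst (snd (cs ! i))" for i
  define b where "b i = snd (snd (cs ! i))" for i
  have ab: "\<forall>i<length cs. a i \<in> {-pi..pi} \<and> b i \<in> {-pi..pi}"
  proof (intro allI impI)
    fix i assume "i < length cs"
    then have "(c i, a i, b i) \<in> set cs" by (simp add: c_def a_def b_def)
    then show "a i \<in> {-pi..pi} \<and> b i \<in> {-pi..pi}" using assms by (fastforce simp: step_list_def)
  qed
  have "step_integral B cs \<omega> = (\<Sum>i<length cs. c i * (B (b i) \<omega> - B (a i) \<omega>))" for \<omega>
    by (simp add: step_integral_def sum_list_sum_nth c_def a_def b_def case_prod_beta lessThan_atLeast0)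
  moreover have "centred_gaussian P (\<lambda>\<omega>. Re (\<Sum>i<length cs. c i * (B (b i) \<omega> - B (a i) \<omega>)))"
    using hbm ab unfolding hermitian_brownian_motion_def by blast
  ultimately show ?thesis by simp
qed

text \<open>Real parts suffice because the process is real. Concatenation of lists realises
  addition, which makes this family a \<open>gaussian_space\<close>.\<close>

definition step_variables :: "('w \<Rightarrow> real) set" where
  "step_variables = {\<lambda>\<omega>. Re (step_integral B cs \<omega>) |cs. step_list cs}"

sublocale gaussian_space P step_variables
proof
  fix X assume "X \<in> step_variables"
  then show "centred_gaussian P X" using step_integral_gaussian by (auto simp: step_variables_def)
next
  fix X Y assume "X \<in> step_variables"
    "Y \<in> step_variables"
  then obtain cs ds where X: "X = (\<lambda>\<omega>. Re (step_integral B cs \<omega>))" "step_list cs"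
    and Y: "Y = (\<lambda>\<omega>. Re (step_integral B ds \<omega>))" "step_list ds" by (auto simp: step_variables_def)
  have "(\<lambda>\<omega>. X \<omega> + Y \<omega>) = (\<lambda>\<omega>. Re (step_integral B (cs @ ds) \<omega>))"
    by (simp add: X Y step_integral_simps)
  with X Y show "(\<lambda>\<omega>. X \<omega> + Y \<omega>) \<in> step_variables"
    by (auto simp: step_variables_def intro!: exI[of _ "cs @ ds"])
  have "(\<lambda>\<omega>. X \<omega> - Y \<omega>) = (\<lambda>\<omega>. Re (step_integral B (cs @ scale_step (-1) ds) \<omega>))"
    by (simp add: X Y step_integral_simps)
  with X Y show "(\<lambda>\<omega>. X \<omega> - Y \<omega>) \<in> step_variables"
    by (auto simp: step_variables_def intro!: exI[of _ "cs @ scale_step (-1) ds"])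
qed

lemma step_integral_L2:
  assumes "step_list cs"
  shows "step_integral B cs \<in> L2_space P"
proof -
  \<comment> \<open>The imaginary part of z is the real part of -\<i> z, so it is again the real
    part of a step integral.\<close>
  have i: "-\<i> * z = Complex (Im z) (- Re z)" for z by (simp add: complex_eq_iff)
  have r: "(\<lambda>\<omega>. Re (step_integral B cs \<omega>)) \<in> L2_space P"
    using assms by (intro in_L2) (auto simp: step_variables_def)
  have "(\<lambda>\<omega>. Re (step_integral B (scale_step (-\<i>) cs) \<omega>)) \<in> L2_space P"
    using assms by (intro in_L2) (auto simp: step_variables_def)
  then have im: "(\<lambda>\<omega>. Im (step_integral B cs \<omega>)) \<in> L2_space P"
    by (simp add: step_integral_simps)
  have "step_integral B cs \<in> borel_measurable P"
    using L2_measurable[OF r] L2_measurable[OF im] by (subst borel_measurable_complex_iff) simp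
  with r im show ?thesis by (simp add: L2_space_def cmod_power2)
qed

lemma step_isometry_single:
  assumes "step_list [e]" "step_list [e']"
  shows "(LINT \<omega>|P. step_integral B [e] \<omega> * cnj (step_integral B [e'] \<omega>))
    = (LINT x|freq. step_fun [e] x * cnj (step_fun [e'] x))"
proof -
  obtain c a b c' a' b' where e: "e = (c, a, b)" "e' = (c', a', b')"
    by (cases e, cases e') auto
  have r: "-pi \<le> a" "a \<le> b" "b \<le> pi" "-pi \<le> a'" "a' \<le> b'" "b' \<le> pi"
    using assms by (auto simp: e step_list_def)
  have "(LINT \<omega>|P. step_integral B [e] \<omega> * cnj (step_integral B [e'] \<omega>))
    = (LINT \<omega>|P. c * cnj c' * ((B b \<omega> - B a \<omega>) * cnj (B b' \<omega> - B a' \<omega>)))"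
    by (simp add: step_integral_def e mult_ac)
  also have "\<dots> = c * cnj c' * (LINT \<omega>|P. (B b \<omega> - B a \<omega>) * cnj (B b' \<omega> - B a' \<omega>))"
    by (rule integral_mult_right_zero)
  also have "(LINT \<omega>|P. (B b \<omega> - B a \<omega>) * cnj (B b' \<omega> - B a' \<omega>))
    = of_real (measure lborel ({a<..b} \<inter> {a'<..b'}))"
    using hbm r unfolding hermitian_brownian_motion_def by blast
  finally show ?thesis
    using step_fun_single_product[OF r] by (simp add: e)
qed

lemma step_list_Cons: "step_list (e # cs) \<longleftrightarrow> step_list [e] \<and> step_list cs"
  by (auto simp: step_list_def)

text \<open>Both sides are additive in each list, so induction on \<open>ds\<close> with a singleton
  on the left, followed by induction on \<open>cs\<close>, reduces the claim to the covariance of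
  two increments.\<close>

lemma step_isometry:
  assumes "step_list cs" "step_list ds"
  shows "(LINT \<omega>|P. step_integral B cs \<omega> * cnj (step_integral B ds \<omega>))
    = (LINT x|freq. step_fun cs x * cnj (step_fun ds x))"
proof -
  note iI = L2_mult_integrable[OF step_integral_L2 L2_cnj[OF step_integral_L2]]
  note iF = L2_mult_integrable[OF step_fun_L2 L2_cnj[OF step_fun_L2]]
  have single: "(LINT \<omega>|P. step_integral B [e] \<omega> * cnj (step_integral B ds \<omega>))
    = (LINT x|freq. step_fun [e] x * cnj (step_fun ds x))" if "step_list [e]" for e
    using assms(2)
  proof (induction ds)
    case Nil
    show ?case by (simp add: step_integral_simps(1) step_fun_simps(1))
  next
    case (Cons d ds)
    then have sl: "step_list [d]" "step_list ds" by (auto simp: step_list_Cons[of d ds])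
    show ?case
      unfolding step_integral_simps(3)[of _ d ds] step_fun_simps(2)[of d ds] complex_cnj_add distrib_left
      by (simp only: Bochner_Integration.integral_add[OF iI[OF that sl(1)] iI[OF that sl(2)]]
        Bochner_Integration.integral_add[OF iF[of "[e]" "[d]"] iF[of "[e]" ds]]
        Cons.IH[OF sl(2)] step_isometry_single[OF that sl(1)])
  qed
  show ?thesis
    using assms(1)
  proof (induction cs)
    case Nil
    show ?case by (simp add: step_integral_simps(1) step_fun_simps(1))
  next
    case (Cons d cs)
    then have sl: "step_list [d]" "step_list cs" by (auto simp: step_list_Cons[of d cs])
    show ?case
      unfolding step_integral_simps(3)[of _ d cs] step_fun_simps(2)[of d cs] distrib_right
      by (simp only: Bochner_Integration.integral_add[OF iI[OF sl(1) assms(2)] iI[OF sl(2) assms(2)]]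
        Bochner_Integration.integral_add[OF iF[of "[d]" ds] iF[of cs ds]]
        Cons.IH[OF sl(2)] single[OF sl(1)])
  qed
qed

section \<open>Isometry and autocovariance bound for mean-square limits\<close>

lemma stochastic_integral_approximation:
  assumes "has_stochastic_integral P B \<phi> X"
  shows "\<phi> \<in> L2_space freq" "X \<in> L2_space P"
    and "\<exists>cs. (\<forall>n. step_list (cs n)) \<and>
      (\<lambda>n. L2_norm freq (\<lambda>x. step_fun (cs n) x - \<phi> x)) \<longlonglongrightarrow> 0 \<and>
      (\<lambda>n. L2_norm P (\<lambda>\<omega>. step_integral B (cs n) \<omega> - X \<omega>)) \<longlonglongrightarrow> 0"
proof -
  obtain cs where m: "\<phi> \<in> borel_measurable freq" "X \<in> borel_measurable P"
    and cs: "\<And>n. step_list (cs n)"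
    and l: "(\<lambda>n. \<integral>\<^sup>+x. ennreal ((cmod (step_fun (cs n) x - \<phi> x))\<^sup>2) \<partial>freq) \<longlonglongrightarrow> 0"
      "(\<lambda>n. \<integral>\<^sup>+\<omega>. ennreal ((cmod (step_integral B (cs n) \<omega> - X \<omega>))\<^sup>2) \<partial>P) \<longlonglongrightarrow> 0"
    using assms unfolding has_stochastic_integral_def step_list_def by blast
  note a = L2_limit[OF step_fun_L2 m(1) l(1)] L2_limit[OF step_integral_L2[OF cs] m(2) l(2)]
  from a cs show "\<phi> \<in> L2_space freq" "X \<in> L2_space P"
    "\<exists>cs. (\<forall>n. step_list (cs n)) \<and>
      (\<lambda>n. L2_norm freq (\<lambda>x. step_fun (cs n) x - \<phi> x)) \<longlonglongrightarrow> 0 \<and>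
      (\<lambda>n. L2_norm P (\<lambda>\<omega>. step_integral B (cs n) \<omega> - X \<omega>)) \<longlonglongrightarrow> 0"
    by blast+
qed

text \<open>Inner products are continuous in both L2 spaces, so the identity for step functions
  passes to the limit. It turns covariances of the process into integrals over frequencies.\<close>

lemma stochastic_integral_isometry:
  assumes "has_stochastic_integral P B \<phi> X" "has_stochastic_integral P B \<psi> Z"
  shows "(LINT \<omega>|P. X \<omega> * cnj (Z \<omega>)) = (LINT x|freq. \<phi> x * cnj (\<psi> x))"
proof -
  obtain cs where cs: "\<And>n. step_list (cs n)"
    "(\<lambda>n. L2_norm freq (\<lambda>x. step_fun (cs n) x - \<phi> x)) \<longlonglongrightarrow> 0"
    "(\<lambda>n. L2_norm P (\<lambda>\<omega>. step_integral B (cs n) \<omega> - X \<omega>)) \<longlonglongrightarrow> 0"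
    using stochastic_integral_approximation(3)[OF assms(1)] by blast
  obtain ds where ds: "\<And>n. step_list (ds n)"
    "(\<lambda>n. L2_norm freq (\<lambda>x. step_fun (ds n) x - \<psi> x)) \<longlonglongrightarrow> 0"
    "(\<lambda>n. L2_norm P (\<lambda>\<omega>. step_integral B (ds n) \<omega> - Z \<omega>)) \<longlonglongrightarrow> 0"
    using stochastic_integral_approximation(3)[OF assms(2)] by blast
  note X = stochastic_integral_approximation(1,2)[OF assms(1)]
    and Z = stochastic_integral_approximation(1,2)[OF assms(2)]
  have "(\<lambda>n. LINT x|freq. step_fun (cs n) x * cnj (step_fun (ds n) x))
      \<longlonglongrightarrow> (LINT x|freq. \<phi> x * cnj (\<psi> x))"
    by (rule L2_product_tendsto(2)[OF step_fun_L2 L2_cnj[OF step_fun_L2] X(1) L2_cnj[OF Z(1)]])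
       (simp_all add: L2_norm_cnj_diff cs ds)
  moreover have "(\<lambda>n. LINT \<omega>|P. step_integral B (cs n) \<omega> * cnj (step_integral B (ds n) \<omega>))
      \<longlonglongrightarrow> (LINT \<omega>|P. X \<omega> * cnj (Z \<omega>))"
    by (rule L2_product_tendsto(2)[OF step_integral_L2[OF cs(1)] L2_cnj[OF step_integral_L2[OF ds(1)]]
          X(2) L2_cnj[OF Z(2)]])
       (simp_all add: L2_norm_cnj_diff cs ds)
  ultimately show ?thesis
    unfolding step_isometry[OF cs(1) ds(1)] by (rule LIMSEQ_unique[rotated])
qed

text \<open>For a real limit X, |Re z - X| \<le> |z - X|, so the real parts of the approximating
  step integrals converge to X as well.\<close>

lemma real_stochastic_integral:
  assumes "has_stochastic_integral P B \<phi> (\<lambda>\<omega>. of_real (X \<omega>))"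
  shows "X \<in> L2_space P"
    and "\<exists>Z. (\<forall>n. Z n \<in> step_variables) \<and>
      (\<lambda>n. L2_norm P (\<lambda>\<omega>. Z n \<omega> - X \<omega>)) \<longlonglongrightarrow> 0"
proof -
  have XL: "(\<lambda>\<omega>. complex_of_real (X \<omega>)) \<in> L2_space P"
    by (rule stochastic_integral_approximation(2)[OF assms])
  then show L: "X \<in> L2_space P"
    using borel_measurable_complex_iff[of "\<lambda>\<omega>. complex_of_real (X \<omega>)" P] by (simp add: L2_space_def)
  obtain cs where cs: "\<And>n. step_list (cs n)"
    "(\<lambda>n. L2_norm P (\<lambda>\<omega>. step_integral B (cs n) \<omega> - of_real (X \<omega>))) \<longlonglongrightarrow> 0"
    using stochastic_integral_approximation(3)[OF assms] by blast
  define Z where "Z n \<omega> = Re (step_integral B (cs n) \<omega>)" for n \<omega>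
  have ZG: "Z n \<in> step_variables" for n
    using cs(1) by (auto simp: Z_def[abs_def] step_variables_def)
  have le: "L2_norm P (\<lambda>\<omega>. Z n \<omega> - X \<omega>) \<le> L2_norm P (\<lambda>\<omega>. step_integral B (cs n) \<omega> - of_real (X \<omega>))" for n
    unfolding L2_norm_def
  proof (intro real_sqrt_le_mono integral_mono)
    show "integrable P (\<lambda>\<omega>. (norm (Z n \<omega> - X \<omega>))\<^sup>2)"
      using L2_diff[OF in_L2[OF ZG] L] by (simp add: L2_space_def)
    show "integrable P (\<lambda>\<omega>. (norm (step_integral B (cs n) \<omega> - of_real (X \<omega>)))\<^sup>2)"
      using L2_diff[OF step_integral_L2[OF cs(1)] XL] by (simp add: L2_space_def)
    show "(norm (Z n \<omega> - X \<omega>))\<^sup>2 \<le> (norm (step_integral B (cs n) \<omega> - of_real (X \<omega>)))\<^sup>2" for \<omega>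
      using abs_Re_le_cmod[of "step_integral B (cs n) \<omega> - of_real (X \<omega>)"]
      by (intro power_mono) (auto simp: Z_def)
  qed
  have "(\<lambda>n. L2_norm P (\<lambda>\<omega>. Z n \<omega> - X \<omega>)) \<longlonglongrightarrow> 0"
    by (rule Lim_null_comparison[OF _ cs(2)]) (use le in \<open>simp add: L2_norm_nonneg\<close>)
  with ZG show "\<exists>Z. (\<forall>n. Z n \<in> step_variables) \<and>
      (\<lambda>n. L2_norm P (\<lambda>\<omega>. Z n \<omega> - X \<omega>)) \<longlonglongrightarrow> 0"
    by blast
qed

text \<open>The inequality holds for Gaussian approximants with the same constant. Products converge
  in L1 and covariances converge, hence both sides pass to the limit.\<close>

lemma real_stochastic_integral_autocovariance_le:
  fixes X :: "nat \<Rightarrow> 'w \<Rightarrow> real" and w :: "nat \<Rightarrow> real"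
  assumes X: "\<And>i. i < n + k \<Longrightarrow> has_stochastic_integral P B (\<phi> i) (\<lambda>\<omega>. of_real (X i \<omega>))"
    and w: "\<And>i. i < n \<Longrightarrow> \<bar>w i\<bar> \<le> C" and C: "C \<ge> 0"
  defines "r \<equiv> \<lambda>i j. expectation (\<lambda>\<omega>. X i \<omega> * X j \<omega>)"
  shows "expectation (\<lambda>\<omega>. \<bar>\<Sum>i<n. w i * (X i \<omega> * X (i + k) \<omega> - r i (i + k))\<bar>)
      \<le> 3 * C * sqrt (\<Sum>i<n+k. \<Sum>j<n+k. (r i j)\<^sup>2)"
proof -
  have "\<forall>i\<in>{..<n+k}. \<exists>Z. (\<forall>m. Z m \<in> step_variables) \<and>
      (\<lambda>m. L2_norm P (\<lambda>\<omega>. Z m \<omega> - X i \<omega>)) \<longlonglongrightarrow> 0"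
    using real_stochastic_integral(2)[OF X] by blast
  from bchoice[OF this] obtain Z where
    ZG: "\<And>i m. i < n + k \<Longrightarrow> Z i m \<in> step_variables"
    and Zl: "\<And>i. i < n + k \<Longrightarrow> (\<lambda>m. L2_norm P (\<lambda>\<omega>. Z i m \<omega> - X i \<omega>)) \<longlonglongrightarrow> 0"
    by auto
  note XL = real_stochastic_integral(1)[OF X]
  define s where "s m i j = expectation (\<lambda>\<omega>. Z i m \<omega> * Z j m \<omega>)" for m i j
  define d where "d m i j = expectation (\<lambda>\<omega>. norm (Z i m \<omega> * Z j m \<omega> - X i \<omega> * X j \<omega>))" for m i j
  have dl: "(\<lambda>m. d m i j) \<longlonglongrightarrow> 0" and sl: "(\<lambda>m. s m i j) \<longlonglongrightarrow> r i j" if "i < n + k" "j < n + k" for i j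
    using L2_product_tendsto[OF in_L2[OF ZG[OF that(1)]] in_L2[OF ZG[OF that(2)]] XL[OF that(1)]
        XL[OF that(2)] Zl[OF that(1)] Zl[OF that(2)]]
    by (simp_all add: s_def d_def r_def)
  have iZ: "integrable P (\<lambda>\<omega>. Z i m \<omega> * Z j m \<omega>)" if "i < n + k" "j < n + k" for i j m
    by (rule product_integrable[OF ZG[OF that(1)] ZG[OF that(2)]])
  have iX: "integrable P (\<lambda>\<omega>. X i \<omega> * X j \<omega>)" if "i < n + k" "j < n + k" for i j
    by (rule L2_mult_integrable[OF XL[OF that(1)] XL[OF that(2)]])
  define XS where "XS \<omega> = (\<Sum>i<n. w i * (X i \<omega> * X (i + k) \<omega> - r i (i + k)))" for \<omega>
  define ZS where "ZS m \<omega> = (\<Sum>i<n. w i * (Z i m \<omega> * Z (i + k) m \<omega> - s m i (i + k)))" for m \<omega>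
  \<comment> \<open>Cost of exchanging the i-th centred product for that of the approximants: one
    term for the products, one for their means. Both vanish as m grows.\<close>
  define q where "q m i \<omega> = norm (Z i m \<omega> * Z (i + k) m \<omega> - X i \<omega> * X (i + k) \<omega>) + \<bar>s m i (i + k) - r i (i + k)\<bar>"
    for m i \<omega>
  have iq: "integrable P (q m i)" and eq: "expectation (q m i) = d m i (i + k) + \<bar>s m i (i + k) - r i (i + k)\<bar>"
    if "i < n" for m i
  proof -
    have "integrable P (\<lambda>\<omega>. norm (Z i m \<omega> * Z (i + k) m \<omega> - X i \<omega> * X (i + k) \<omega>))"
      using iX iZ that by (intro integrable_norm Bochner_Integration.integrable_diff) auto
    then show "integrable P (q m i)" "expectation (q m i) = d m i (i + k) + \<bar>s m i (i + k) - r i (i + k)\<bar>"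
      unfolding q_def[abs_def] d_def by (simp_all add: prob_space)
  qed
  have iXS: "integrable P XS" and iZS: "integrable P (ZS m)" for m
    unfolding XS_def[abs_def] ZS_def[abs_def] using iX iZ by (auto intro!: Bochner_Integration.integrable_sum)
  have le: "expectation (\<lambda>\<omega>. \<bar>XS \<omega>\<bar>) \<le> 3 * C * sqrt (\<Sum>i<n+k. \<Sum>j<n+k. (s m i j)\<^sup>2)
      + (\<Sum>i<n. C * (d m i (i + k) + \<bar>s m i (i + k) - r i (i + k)\<bar>))" for m
  proof -
    have pointwise: "\<bar>XS \<omega>\<bar> \<le> \<bar>ZS m \<omega>\<bar> + (\<Sum>i<n. C * q m i \<omega>)" for \<omega>
    proof -
      have "XS \<omega> = ZS m \<omega> + (\<Sum>i<n. w i * ((s m i (i + k) - r i (i + k)) - (Z i m \<omega> * Z (i + k) m \<omega> - X i \<omega> * X (i + k) \<omega>)))"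
        unfolding XS_def ZS_def sum.distrib[symmetric] by (intro sum.cong refl) (simp add: algebra_simps)
      moreover have "\<bar>\<Sum>i<n. w i * ((s m i (i + k) - r i (i + k)) - (Z i m \<omega> * Z (i + k) m \<omega> - X i \<omega> * X (i + k) \<omega>))\<bar>
        \<le> (\<Sum>i<n. C * q m i \<omega>)"
        unfolding q_def
        by (rule order_trans[OF sum_abs sum_mono], unfold abs_mult, rule mult_mono) (use w C in auto)
      ultimately show ?thesis by linarith
    qed
    have iS: "integrable P (\<lambda>\<omega>. \<Sum>i<n. C * q m i \<omega>)"
      using iq by (auto intro!: Bochner_Integration.integrable_sum)
    have "expectation (\<lambda>\<omega>. \<bar>XS \<omega>\<bar>) \<le> expectation (\<lambda>\<omega>. \<bar>ZS m \<omega>\<bar> + (\<Sum>i<n. C * q m i \<omega>))"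
      using iXS iZS[of m] iS pointwise by (intro integral_mono) auto
    also have "\<dots> = expectation (\<lambda>\<omega>. \<bar>ZS m \<omega>\<bar>) + (\<Sum>i<n. C * (d m i (i + k) + \<bar>s m i (i + k) - r i (i + k)\<bar>))"
      using iZS[of m] iS iq by (simp add: Bochner_Integration.integral_sum eq)
    also have "expectation (\<lambda>\<omega>. \<bar>ZS m \<omega>\<bar>) \<le> 3 * C * sqrt (\<Sum>i<n+k. \<Sum>j<n+k. (s m i j)\<^sup>2)"
      unfolding s_def ZS_def by (rule expectation_abs_autocovariance_le[of n k "\<lambda>i. Z i m" w C]) (use ZG w C in auto)
    finally show ?thesis by simp
  qed
  have "(\<lambda>m. 3 * C * sqrt (\<Sum>i<n+k. \<Sum>j<n+k. (s m i j)\<^sup>2)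
      + (\<Sum>i<n. C * (d m i (i + k) + \<bar>s m i (i + k) - r i (i + k)\<bar>)))
    \<longlonglongrightarrow> 3 * C * sqrt (\<Sum>i<n+k. \<Sum>j<n+k. (r i j)\<^sup>2)
      + (\<Sum>i<n. C * (0 + \<bar>r i (i + k) - r i (i + k)\<bar>))"
    by (intro tendsto_intros sl dl) auto
  from LIMSEQ_le_const[OF this] le show ?thesis unfolding XS_def by auto
qed

end

section \<open>Regularity of the spectral densities\<close>

lemma integrable_abs_powr_freq:
  assumes "a > -1"
  shows "integrable freq (\<lambda>x. \<bar>x\<bar> powr a)"
proof -
  have "(\<lambda>x. x powr a) integrable_on {0..pi}"
    by (rule integrable_on_powr_from_0) (use assms in auto)
  then have "(\<lambda>x. x powr a) absolutely_integrable_on {0..pi}"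
    by (rule nonnegative_absolutely_integrable_1) simp
  then have "integrable (lebesgue_on {0..pi}) (\<lambda>x. x powr a)"
    by (simp add: set_integrable_def integrable_restrict_space)
  then have r: "integrable (lebesgue_on {0..pi}) (\<lambda>x. \<bar>x\<bar> powr a)"
    by (rule Bochner_Integration.integrable_cong[OF refl, THEN iffD1, rotated]) (auto simp: space_restrict_space)
  \<comment> \<open>The unsimplified endpoint \<open>-0\<close> is the shape in which the reflection
    rule applies.\<close>
  then have "integrable (lebesgue_on {-pi..-0}) (\<lambda>x. \<bar>- x\<bar> powr a)"
    by (subst integrable_reflect_real)
  then have "integrable (lebesgue_on {-pi..0}) (\<lambda>x. \<bar>x\<bar> powr a)" by simp
  then show ?thesis
    by (rule integrable_combine[OF _ r]) auto
qed

lemma AE_freq: "AE x in freq. x \<in> frequencies"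
proof -
  have "{0} \<in> null_sets lebesgue" by simp
  then have "AE x in lebesgue. x \<notin> {0}" by (rule AE_not_in)
  then show ?thesis
    by (auto simp: AE_restrict_space_iff frequencies_def elim: eventually_mono)
qed

lemma twice_differentiable_imp_continuous_on:
  assumes "twice_differentiable_on F S"
  shows "continuous_on S F"
  using assms unfolding twice_differentiable_on_def
  by (auto simp: continuous_on_eq_continuous_within intro: has_derivative_continuous)

locale spectral_model =
  fixes \<Theta> :: "'p::euclidean_space set" and A :: "'p \<Rightarrow> real \<Rightarrow> real \<Rightarrow> complex"
  assumes compact_\<Theta>: "compact \<Theta>"
    and transfer: "\<And>\<theta>. \<theta> \<in> \<Theta> \<Longrightarrow> transfer_function (A \<theta>)"
    and A1: "assumption_A1 \<Theta> A"
begin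

abbreviation f :: "'p \<Rightarrow> real \<Rightarrow> real \<Rightarrow> real" where
  "f \<theta> \<equiv> tv_spectral_density (A \<theta>)"

text \<open>The convention \<open>inverse 0 = 0\<close> does not give this value at \<open>0\<close>, because \<open>f\<close> is
  unconstrained there.\<close>

definition inv_density :: "'p \<Rightarrow> real \<Rightarrow> real \<Rightarrow> real" where
  "inv_density \<theta> u x = (if x = 0 then 0 else inverse (f \<theta> u x))"

lemma f_pos: "\<theta> \<in> \<Theta> \<Longrightarrow> u \<in> {0..1} \<Longrightarrow> x \<in> frequencies \<Longrightarrow> f \<theta> u x > 0"
  using A1 by (simp add: assumption_A1_def Let_def)

lemma A_continuous: "\<theta> \<in> \<Theta> \<Longrightarrow> x \<in> frequencies \<Longrightarrow> continuous_on {0..1} (\<lambda>u. A \<theta> u x)"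
  using A1 by (intro twice_differentiable_imp_continuous_on) (simp add: assumption_A1_def Let_def)

lemma inverse_f_continuous:
  "continuous_on (\<Theta> \<times> {0..1} \<times> frequencies) (\<lambda>(\<theta>, u, x). inverse (f \<theta> u x))"
  using A1 by (intro twice_differentiable_imp_continuous_on) (simp add: assumption_A1_def Let_def)

text \<open>Joint regularity is assumed for 1 / f; positivity allows it to be inverted back.\<close>

lemma f_continuous:
  "continuous_on (\<Theta> \<times> {0..1} \<times> frequencies) (\<lambda>(\<theta>, u, x). f \<theta> u x)"
proof -
  have "continuous_on (\<Theta> \<times> {0..1} \<times> frequencies) (\<lambda>p. inverse ((\<lambda>(\<theta>, u, x). inverse (f \<theta> u x)) p))"
    by (rule continuous_on_inverse[OF inverse_f_continuous]) (auto dest: f_pos)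
  then show ?thesis by (simp add: case_prod_beta)
qed

text \<open>Symmetry is part of \<open>transfer_function\<close>, which speaks of u > 0. For this
  reason block midpoints are later placed in {0<..1}.\<close>

lemma hermitian:
  assumes "\<theta> \<in> \<Theta>" "u \<in> {0<..1}"
  shows "A \<theta> u (- x) = cnj (A \<theta> u x)" "f \<theta> u (- x) = f \<theta> u x"
  using transfer[OF assms(1)] assms(2) by (auto simp: transfer_function_def tv_spectral_density_def)

text \<open>The product with a principal filter makes the ratio of f to its power law tend to 1
  uniformly in (\<theta>, u), so one radius serves all indices and the ratio lies between 1/2 and 2
  there.\<close>

lemma exponents:
  obtains d :: "'p \<Rightarrow> real \<Rightarrow> real" and Cf d1 d2 x1
  where "0 < d1" "d2 < 1 / 2" "0 < x1" "x1 \<le> pi" "x1 \<le> 1"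
    "\<And>\<theta> u. \<theta> \<in> \<Theta> \<Longrightarrow> u \<in> {0..1} \<Longrightarrow> d1 \<le> d \<theta> u \<and> d \<theta> u \<le> d2 \<and> Cf \<theta> u > 0"
    "\<And>\<theta> u x. \<theta> \<in> \<Theta> \<Longrightarrow> u \<in> {0..1} \<Longrightarrow> 0 < \<bar>x\<bar> \<Longrightarrow> \<bar>x\<bar> \<le> x1 \<Longrightarrow>
      Cf \<theta> u * \<bar>x\<bar> powr (- 2 * d \<theta> u) / 2 \<le> f \<theta> u x \<and> f \<theta> u x \<le> 2 * (Cf \<theta> u * \<bar>x\<bar> powr (- 2 * d \<theta> u))"
proof -
  obtain d Cf d1 d2 where
    Cf: "\<forall>\<theta>\<in>\<Theta>. \<forall>u\<in>{0..1}. Cf \<theta> u > 0"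
    and d: "0 < d1" "d2 < 1 / 2" "\<forall>\<theta>\<in>\<Theta>. \<forall>u\<in>{0..1}. d1 \<le> d \<theta> u \<and> d \<theta> u \<le> d2"
    and as: "(\<lambda>((\<theta>, u), x). f \<theta> u x) \<sim>[principal (\<Theta> \<times> {0..1}) \<times>\<^sub>F at 0]
          (\<lambda>((\<theta>, u), x). Cf \<theta> u * \<bar>x\<bar> powr (- 2 * d \<theta> u))"
    using A1 unfolding assumption_A1_def Let_def by (elim conjE exE) (rule that, assumption+)
  define q where "q = (\<lambda>((\<theta>, u), x). Cf \<theta> u * \<bar>x\<bar> powr (- 2 * d \<theta> u))"
  \<comment> \<open>The quotient with the convention 0 / 0 = 1 that is built into asymptotic
    equivalence.\<close>
  define R where "R p = (if (\<lambda>((\<theta>, u), x). f \<theta> u x) p = 0 \<and> q p = 0 then 1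
    else (\<lambda>((\<theta>, u), x). f \<theta> u x) p / q p)" for p
  have "(R \<longlongrightarrow> 1) (principal (\<Theta> \<times> {0..1}) \<times>\<^sub>F at 0)"
    using asymp_equivD[OF as] unfolding R_def[abs_def] q_def .
  from order_tendstoD(1)[OF this, of "1/2"] order_tendstoD(2)[OF this, of 2]
  have "eventually (\<lambda>p. 1/2 < R p \<and> R p < 2) (principal (\<Theta> \<times> {0..1}) \<times>\<^sub>F at 0)"
    by (intro eventually_conj) auto
  then obtain Pf Pg where P: "eventually Pf (principal (\<Theta> \<times> {0..1}))" "eventually Pg (at (0::real))"
    "\<And>p x. Pf p \<Longrightarrow> Pg x \<Longrightarrow> 1/2 < R (p, x) \<and> R (p, x) < 2"
    unfolding eventually_prod_filter by blast
  from P(2) obtain e where e: "e > 0" "\<And>x. x \<noteq> 0 \<Longrightarrow> \<bar>x\<bar> < e \<Longrightarrow> Pg x"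
    by (auto simp: eventually_at)
  show thesis
  \<comment> \<open>Halving e turns the strict neighbourhood into one with closed boundary; the cap
    1 keeps the radius below pi.\<close>
  proof (rule that[of d1 d2 "min (e / 2) 1" d Cf])
    show "min (e / 2) 1 \<le> pi" using pi_gt3 by linarith
    fix \<theta> u assume tu: "\<theta> \<in> \<Theta>" "u \<in> {0..1::real}"
    show "d1 \<le> d \<theta> u \<and> d \<theta> u \<le> d2 \<and> Cf \<theta> u > 0" using tu d Cf by auto
    fix x :: real assume x: "0 < \<bar>x\<bar>" "\<bar>x\<bar> \<le> min (e / 2) 1"
    have "Pf (\<theta>, u)" using P(1) tu by (simp add: eventually_principal)
    moreover have "Pg x" using x e by auto
    ultimately have R: "1/2 < R ((\<theta>, u), x) \<and> R ((\<theta>, u), x) < 2" by (rule P(3))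
    have q: "q ((\<theta>, u), x) > 0" using x tu Cf by (simp add: q_def)
    have "R ((\<theta>, u), x) = f \<theta> u x / q ((\<theta>, u), x)" using q by (simp add: R_def)
    with R q have "q ((\<theta>, u), x) / 2 \<le> f \<theta> u x \<and> f \<theta> u x \<le> 2 * q ((\<theta>, u), x)"
      by (simp add: field_simps)
    then show "Cf \<theta> u * \<bar>x\<bar> powr (- 2 * d \<theta> u) / 2 \<le> f \<theta> u x \<and> f \<theta> u x \<le> 2 * (Cf \<theta> u * \<bar>x\<bar> powr (- 2 * d \<theta> u))"
      by (simp add: q_def)
  qed (use e d in auto)
qed

text \<open>The uniform asymptotic relation compares the values at \<open>x\<close> and at a fixed \<open>x1\<close>, so the
  constants \<open>Cf\<close> cancel.\<close>

lemma comparison_at_zero: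
  obtains d1 d2 x1 where "0 < d1" "d2 < 1 / 2" "0 < x1" "x1 \<le> pi" 
    "\<And>\<theta> u x. \<theta> \<in> \<Theta> \<Longrightarrow> u \<in> {0..1} \<Longrightarrow> 0 < \<bar>x\<bar> \<Longrightarrow> \<bar>x\<bar> \<le> x1 \<Longrightarrow>
      inverse (f \<theta> u x) \<le> 4 * inverse (f \<theta> u x1) * (\<bar>x\<bar> / x1) powr (2 * d1) \<and>
      f \<theta> u x \<le> 4 * f \<theta> u x1 * (\<bar>x\<bar> / x1) powr (- 2 * d2)"
proof -
  obtain d Cf d1 d2 x1 where c: "0 < d1" "d2 < 1 / 2" "0 < x1" "x1 \<le> pi" "x1 \<le> 1"
    and d: "\<And>\<theta> u. \<theta> \<in> \<Theta> \<Longrightarrow> u \<in> {0..1} \<Longrightarrow> d1 \<le> d \<theta> u \<and> d \<theta> u \<le> d2 \<and> Cf \<theta> u > 0"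
    and b: "\<And>\<theta> u x. \<theta> \<in> \<Theta> \<Longrightarrow> u \<in> {0..1} \<Longrightarrow> 0 < \<bar>x\<bar> \<Longrightarrow> \<bar>x\<bar> \<le> x1 \<Longrightarrow>
      Cf \<theta> u * \<bar>x\<bar> powr (- 2 * d \<theta> u) / 2 \<le> f \<theta> u x \<and> f \<theta> u x \<le> 2 * (Cf \<theta> u * \<bar>x\<bar> powr (- 2 * d \<theta> u))"
    by (rule exponents) blast
  show thesis
  proof (rule that[of d1 d2 x1])
    fix \<theta> u x assume tu: "\<theta> \<in> \<Theta>" "u \<in> {0..1::real}" and x: "0 < \<bar>x\<bar>" "\<bar>x\<bar> \<le> x1"
    define D where "D = d \<theta> u"
    have D: "d1 \<le> D" "D \<le> d2" "Cf \<theta> u > 0" using d[OF tu] by (auto simp: D_def)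
    define y where "y = \<bar>x\<bar> / x1"
    have y: "0 < y" "y \<le> 1" using x c by (auto simp: y_def)
    have xy: "\<bar>x\<bar> powr (- 2 * D) = x1 powr (- 2 * D) * y powr (- 2 * D)"
      using x c y by (subst powr_mult[symmetric]) (auto simp: y_def)
    define a where "a = Cf \<theta> u * x1 powr (- 2 * D)"
    have a: "a > 0" using D c by (simp add: a_def)
    have bx: "a * y powr (- 2 * D) / 2 \<le> f \<theta> u x" "f \<theta> u x \<le> 2 * (a * y powr (- 2 * D))"
      using b[OF tu x, folded D_def, unfolded xy] by (simp_all add: a_def mult.assoc)
    have b1: "a / 2 \<le> f \<theta> u x1" "f \<theta> u x1 \<le> 2 * a"
      using b[OF tu, of x1] c by (simp_all add: a_def flip: D_def)
    have f1: "f \<theta> u x1 > 0" using b1 a by linarith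
    define Y where "Y = y powr (- 2 * D)"
    have yp: "Y > 0" using y by (simp add: Y_def)
    note bx = bx[folded Y_def]
    have "a * Y \<le> 2 * f \<theta> u x1 * Y" using b1 yp by (intro mult_right_mono) auto
    then have "f \<theta> u x \<le> 4 * f \<theta> u x1 * Y" using bx(2) by linarith
    also have "Y \<le> y powr (- 2 * d2)"
      unfolding Y_def using y D by (intro powr_mono') auto
    finally have 1: "f \<theta> u x \<le> 4 * f \<theta> u x1 * y powr (- 2 * d2)" using f1 by simp
    have "f \<theta> u x1 * Y \<le> 2 * a * Y" using b1 yp by (intro mult_right_mono) auto
    then have "f \<theta> u x1 * Y / 4 \<le> f \<theta> u x" using bx(1) by linarith
    then have "inverse (f \<theta> u x) \<le> inverse (f \<theta> u x1 * Y / 4)"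
      using f1 yp by (intro le_imp_inverse_le) auto
    also have "\<dots> = 4 * inverse (f \<theta> u x1) * y powr (2 * D)"
      using f1 y by (simp add: Y_def powr_minus field_simps)
    also have "y powr (2 * D) \<le> y powr (2 * d1)"
      using y D by (intro powr_mono') auto
    finally have 2: "inverse (f \<theta> u x) \<le> 4 * inverse (f \<theta> u x1) * y powr (2 * d1)" using f1 by simp
    show "inverse (f \<theta> u x) \<le> 4 * inverse (f \<theta> u x1) * (\<bar>x\<bar> / x1) powr (2 * d1) \<and>
      f \<theta> u x \<le> 4 * f \<theta> u x1 * (\<bar>x\<bar> / x1) powr (- 2 * d2)"
      using 1 2 by (simp add: y_def)
  qed (use c in auto)
qed

text \<open>Away from 0 this is the assumed regularity. At 0 the bound |x|^(2 d1), with d1 > 0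
  common to all (\<theta>, u), forces the value 0 jointly in all variables; its coefficient is
  bounded because \<Theta> and [0,1] are compact.\<close>

lemma inv_density_continuous:
  "continuous_on (\<Theta> \<times> {0..1} \<times> {-pi..pi}) (\<lambda>(\<theta>, u, x). inv_density \<theta> u x)"
proof -
  obtain d1 d2 x1 where c: "0 < d1" "0 < x1" "x1 \<le> pi" 
    and b: "\<And>\<theta> u x. \<theta> \<in> \<Theta> \<Longrightarrow> u \<in> {0..1} \<Longrightarrow> 0 < \<bar>x\<bar> \<Longrightarrow> \<bar>x\<bar> \<le> x1 \<Longrightarrow>
      inverse (f \<theta> u x) \<le> 4 * inverse (f \<theta> u x1) * (\<bar>x\<bar> / x1) powr (2 * d1) \<and>
      f \<theta> u x \<le> 4 * f \<theta> u x1 * (\<bar>x\<bar> / x1) powr (- 2 * d2)"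
    by (rule comparison_at_zero) blast
  have x1f: "x1 \<in> frequencies" using c by (simp add: frequencies_def)
  have "continuous_on (\<Theta> \<times> {0..1}) (\<lambda>p. (\<lambda>(\<theta>, u, x). inverse (f \<theta> u x)) (fst p, snd p, x1))"
    by (rule continuous_on_compose2[OF inverse_f_continuous]) (use x1f in \<open>auto intro!: continuous_intros\<close>)
  then have "continuous_on (\<Theta> \<times> {0..1}) (\<lambda>(\<theta>, u). inverse (f \<theta> u x1))"
    by (simp add: case_prod_beta)
  then have "compact ((\<lambda>(\<theta>, u). inverse (f \<theta> u x1)) ` (\<Theta> \<times> {0..1}))"
    by (rule compact_continuous_image) (intro compact_Times compact_\<Theta> compact_Icc)
  then obtain G where G: "\<And>\<theta> u. \<theta> \<in> \<Theta> \<Longrightarrow> u \<in> {0..1} \<Longrightarrow> \<bar>inverse (f \<theta> u x1)\<bar> \<le> G"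
    unfolding compact_eq_bounded_closed bounded_iff by fastforce
  let ?S = "\<Theta> \<times> {0..1::real} \<times> {-pi..pi}" and ?W = "\<Theta> \<times> {0..1::real} \<times> frequencies"
  show ?thesis
    unfolding continuous_on_eq_continuous_within
  proof
    fix p assume p: "p \<in> ?S"
    obtain \<theta> u x where px: "p = (\<theta>, u, x)" by (cases p)
    show "continuous (at p within ?S) (\<lambda>(\<theta>, u, x). inv_density \<theta> u x)"
    proof (cases "x = 0")
      case False
      \<comment> \<open>Near a point with x different from 0 the hyperplane x = 0 is invisible, so
        the two punctured neighbourhood filters coincide.\<close>
      let ?U = "(UNIV :: 'p set) \<times> (UNIV :: real set) \<times> (- {0::real})"
      have "continuous_on ?W (\<lambda>(\<theta>, u, x). inv_density \<theta> u x)"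
        by (rule continuous_on_eq[OF inverse_f_continuous]) (auto simp: inv_density_def frequencies_def split: if_split_asm)
      then have "continuous (at p within ?W) (\<lambda>(\<theta>, u, x). inv_density \<theta> u x)"
        using p px False by (auto simp: continuous_on_eq_continuous_within frequencies_def)
      moreover have "at p within ?S = at p within ?W"
        by (rule at_within_nhd[of p ?U]) (use px False in \<open>auto intro!: open_Times simp: frequencies_def\<close>)
      ultimately show ?thesis by simp
    next
      case True
      have lim: "((\<lambda>p. 4 * G * (\<bar>snd (snd p)\<bar> / x1) powr (2 * d1)) \<longlongrightarrow> 0) (at p within ?S)"
      proof -
        have "((\<lambda>p. \<bar>snd (snd p)\<bar> / x1) \<longlongrightarrow> 0) (at p within ?S)"
          by (rule tendsto_eq_intros refl)+ (use True px c in auto)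
        then have "((\<lambda>p. (\<bar>snd (snd p)\<bar> / x1) powr (2 * d1)) \<longlongrightarrow> 0 powr (2 * d1)) (at p within ?S)"
          using c by (intro tendsto_powr2[where b="2*d1"] tendsto_const) (auto intro!: always_eventually)
        from tendsto_mult[OF tendsto_const this, of "4 * G"] show ?thesis by simp
      qed
      have "((\<lambda>(\<theta>, u, x). inv_density \<theta> u x) \<longlongrightarrow> 0) (at p within ?S)"
      proof (rule Lim_null_comparison[OF _ lim])
        have "eventually (\<lambda>q. dist q p < x1) (at p within ?S)"
          using c by (auto simp: eventually_at)
        moreover have "eventually (\<lambda>q. q \<in> ?S) (at p within ?S)"
          by (simp add: eventually_at_filter)
        ultimately show "eventually (\<lambda>q. norm ((\<lambda>(\<theta>, u, x). inv_density \<theta> u x) q)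
          \<le> 4 * G * (\<bar>snd (snd q)\<bar> / x1) powr (2 * d1)) (at p within ?S)"
        proof eventually_elim
          case (elim q)
          obtain \<theta>' u' x' where q: "q = (\<theta>', u', x')" by (cases q)
          have "dist x' 0 \<le> dist q p"
            using dist_snd_le[of "snd q" "snd p"] dist_snd_le[of q p] by (simp add: q px True)
          then have x': "\<bar>x'\<bar> \<le> x1" using elim(1) by simp
          have tu: "\<theta>' \<in> \<Theta>" "u' \<in> {0..1}" using elim(2) q by auto
          have G0: "0 \<le> G" using G[OF tu] by linarith
          show ?case
          proof (cases "x' = 0")
            case True
            then show ?thesis using G0 by (simp add: q inv_density_def)
          next
            case False
            have xf: "x' \<in> frequencies" using elim(2) q False by (simp add: frequencies_def)
            have "inverse (f \<theta>' u' x') \<le> 4 * inverse (f \<theta>' u' x1) * (\<bar>x'\<bar> / x1) powr (2 * d1)"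
              using b[OF tu _ x'] False by simp
            also have "\<dots> \<le> 4 * G * (\<bar>x'\<bar> / x1) powr (2 * d1)"
              using order_trans[OF abs_ge_self G[OF tu]] by (intro mult_right_mono) auto
            finally show ?thesis
              using False f_pos[OF tu xf] by (simp add: q inv_density_def)
          qed
        qed
      qed
      then show ?thesis using px True by (simp add: continuous_within inv_density_def)
    qed
  qed
qed

text \<open>A majorant common to all u, as needed for dominated convergence along sequences of
  rescaled times.\<close>

lemma f_dominated:
  assumes "\<theta> \<in> \<Theta>"
  obtains D where "integrable freq D" "\<And>x. D x \<ge> 0"
    "\<And>u x. u \<in> {0..1} \<Longrightarrow> x \<in> frequencies \<Longrightarrow> f \<theta> u x \<le> D x"
proof -
  obtain d1 d2 x1 where c: "d2 < 1/2" "0 < x1" "x1 \<le> pi" 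
    and b: "\<And>\<theta> u x. \<theta> \<in> \<Theta> \<Longrightarrow> u \<in> {0..1} \<Longrightarrow> 0 < \<bar>x\<bar> \<Longrightarrow> \<bar>x\<bar> \<le> x1 \<Longrightarrow>
      inverse (f \<theta> u x) \<le> 4 * inverse (f \<theta> u x1) * (\<bar>x\<bar> / x1) powr (2 * d1) \<and>
      f \<theta> u x \<le> 4 * f \<theta> u x1 * (\<bar>x\<bar> / x1) powr (- 2 * d2)"
    by (rule comparison_at_zero) blast
  let ?K = "{0..1} \<times> ({-pi..-x1} \<union> {x1..pi})"
  have Kf: "{-pi..-x1} \<union> {x1..pi} \<subseteq> frequencies" using c by (auto simp: frequencies_def)
  have "continuous_on ?K (\<lambda>p. (\<lambda>(\<theta>, u, x). f \<theta> u x) (\<theta>, fst p, snd p))"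
    by (rule continuous_on_compose2[OF f_continuous]) (use assms Kf in \<open>auto intro!: continuous_intros\<close>)
  then have "compact ((\<lambda>(u, x). f \<theta> u x) ` ?K)"
    by (intro compact_continuous_image compact_Times compact_Un compact_Icc) (simp add: case_prod_beta)
  then obtain F where F: "\<And>u x. u \<in> {0..1} \<Longrightarrow> x \<in> {-pi..-x1} \<union> {x1..pi} \<Longrightarrow> \<bar>f \<theta> u x\<bar> \<le> F"
    unfolding compact_eq_bounded_closed bounded_iff by fastforce
  have F0: "F \<ge> 0" using F[of 0 x1] c by fastforce
  \<comment> \<open>The first summand covers |x| \<le> x1 and is integrable since -2 d2 > -1; the
    constant F covers the compact remainder.\<close>
  define D where "D x = 4 * F * (\<bar>x\<bar> powr (- 2 * d2) / x1 powr (- 2 * d2)) + F" for x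
  show thesis
  proof (rule that[of D])
    have "integrable freq (\<lambda>x. \<bar>x\<bar> powr (- 2 * d2))"
      by (rule integrable_abs_powr_freq) (use c in simp)
    moreover have "integrable freq (\<lambda>x. F)"
      using finite_measure_freq by (simp add: finite_measure.integrable_const)
    ultimately show "integrable freq D" unfolding D_def by simp
    show "D x \<ge> 0" for x using F0 by (simp add: D_def)
    fix u x assume u: "u \<in> {0..1::real}" and x: "x \<in> frequencies"
    show "f \<theta> u x \<le> D x"
    proof (cases "\<bar>x\<bar> \<le> x1")
      case True
      have "f \<theta> u x \<le> 4 * f \<theta> u x1 * (\<bar>x\<bar> / x1) powr (- 2 * d2)"
        using b[OF assms u _ True] x by (simp add: frequencies_def)
      also have "\<dots> \<le> 4 * F * (\<bar>x\<bar> / x1) powr (- 2 * d2)"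
        using F[OF u, of x1] c by (intro mult_right_mono) auto
      also have "(\<bar>x\<bar> / x1) powr (- 2 * d2) = \<bar>x\<bar> powr (- 2 * d2) / x1 powr (- 2 * d2)"
        by (rule powr_divide)
      finally show ?thesis using F0 by (simp add: D_def)
    next
      case False
      then have "\<bar>f \<theta> u x\<bar> \<le> F" using x by (intro F u) (auto simp: frequencies_def)
      then show ?thesis using F0 by (simp add: D_def add_increasing)
    qed
  qed
qed

text \<open>Symmetry turns A(u, x) A(u, -x) into |A(u, x)|^2, whose integrability is the diagonal
  case v = u of the covariance assumption.\<close>

lemma f_integrable:
  assumes "\<theta> \<in> \<Theta>" "u \<in> {0<..1}"
  shows "integrable freq (f \<theta> u)"
proof -
  have "integrable freq (\<lambda>x. A \<theta> u x * A \<theta> u (- x))"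
  proof -
    obtain d :: "'p \<Rightarrow> real \<Rightarrow> real" and C :: "'p \<Rightarrow> real \<Rightarrow> real \<Rightarrow> complex" where
      "\<forall>\<theta>\<in>\<Theta>. \<forall>u\<in>{0..1}. \<forall>v\<in>{0..1}. integrable freq (\<lambda>x. A \<theta> u x * A \<theta> v (-x)) \<and>
        (\<lambda>k::nat. LINT x|freq. A \<theta> u x * A \<theta> v (-x) * exp (\<i> * of_real (real k * x)))
             \<sim>[at_top] (\<lambda>k. C \<theta> u v * of_real (real k powr (d \<theta> u + d \<theta> v - 1)))"
      using A1 unfolding assumption_A1_def Let_def by (elim conjE exE) (rule that, assumption)
    then show ?thesis using assms by auto
  qed
  then have "integrable freq (\<lambda>x. complex_of_real (f \<theta> u x))"
    by (simp add: hermitian[OF assms] tv_spectral_density_def flip: complex_norm_square)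
  then show ?thesis by (simp only: complex_of_real_integrable_eq)
qed

text \<open>The covariance at lag k of the stationary process with transfer function A(u, .). There
  is no factor 1 / (2 pi) because E|dB|^2 = d\<lambda>. The lag is real so that differences of times
  can be inserted without casts.\<close>

definition autocov :: "'p \<Rightarrow> real \<Rightarrow> real \<Rightarrow> real" where
  "autocov \<theta> u k = (LINT x|freq. f \<theta> u x * cos (k * x))"

lemma integrable_mult_bounded:
  fixes g h :: "'a \<Rightarrow> real"
  assumes "integrable M g" "h \<in> borel_measurable M" "\<And>x. \<bar>h x\<bar> \<le> C"
  shows "integrable M (\<lambda>x. g x * h x)"
proof (rule Bochner_Integration.integrable_bound[where f = "\<lambda>x. C * g x"])
  show "AE x in M. norm (g x * h x) \<le> norm (C * g x)"
  proof (rule AE_I2)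
    fix x
    have "\<bar>h x\<bar> \<le> \<bar>C\<bar>" using assms(3)[of x] by linarith
    from mult_left_mono[OF this, of "\<bar>g x\<bar>"] show "norm (g x * h x) \<le> norm (C * g x)"
      by (simp add: abs_mult mult.commute)
  qed
qed (use assms in auto)

lemma f_cos_integrable:
  assumes "\<theta> \<in> \<Theta>" "u \<in> {0<..1}"
  shows "integrable freq (\<lambda>x. f \<theta> u x * cos (k * x))"
  by (rule integrable_mult_bounded[OF f_integrable[OF assms], where C = 1])
     (auto intro!: borel_measurable_freq borel_measurable_continuous_onI continuous_intros)

text \<open>For v = u the assumed rate is k^(2 d - 1), and d < 1/2 makes the exponent
  negative.\<close>

lemma autocov_decay:
  assumes "\<theta> \<in> \<Theta>" "u \<in> {0<..1}"
  shows "(\<lambda>k::nat. autocov \<theta> u (real k)) \<longlonglongrightarrow> 0"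
proof -
  obtain d :: "'p \<Rightarrow> real \<Rightarrow> real" and C :: "'p \<Rightarrow> real \<Rightarrow> real \<Rightarrow> complex" and d1 d2 where
    d: "d2 < 1 / 2" "\<forall>\<theta>\<in>\<Theta>. \<forall>u\<in>{0..1}. d1 \<le> d \<theta> u \<and> d \<theta> u \<le> d2"
    and "\<forall>\<theta>\<in>\<Theta>. \<forall>u\<in>{0..1}. \<forall>v\<in>{0..1}. integrable freq (\<lambda>x. A \<theta> u x * A \<theta> v (-x)) \<and>
        (\<lambda>k::nat. LINT x|freq. A \<theta> u x * A \<theta> v (-x) * exp (\<i> * of_real (real k * x)))
             \<sim>[at_top] (\<lambda>k. C \<theta> u v * of_real (real k powr (d \<theta> u + d \<theta> v - 1)))"
    using A1 unfolding assumption_A1_def Let_def by (elim conjE exE) (rule that, assumption+)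
  then have as: "\<forall>\<theta>\<in>\<Theta>. \<forall>u\<in>{0..1}. \<forall>v\<in>{0..1}.
        (\<lambda>k::nat. LINT x|freq. A \<theta> u x * A \<theta> v (-x) * exp (\<i> * of_real (real k * x)))
             \<sim>[at_top] (\<lambda>k. C \<theta> u v * of_real (real k powr (d \<theta> u + d \<theta> v - 1)))"
    by blast
  have u: "u \<in> {0..1}" using assms by auto
  have e: "A \<theta> u x * A \<theta> u (-x) * exp (\<i> * of_real (real k * x))
      = of_real (f \<theta> u x) * cis (real k * x)" for k x
    by (simp add: hermitian[OF assms] tv_spectral_density_def cis_conv_exp flip: complex_norm_square)
  have "d \<theta> u + d \<theta> u - 1 < 0" using d assms(1) u by fastforce
  then have "(\<lambda>k::nat. real k powr (d \<theta> u + d \<theta> u - 1)) \<longlonglongrightarrow> 0"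
    by (intro tendsto_neg_powr filterlim_real_sequentially)
  then have "(\<lambda>k. C \<theta> u u * of_real (real k powr (d \<theta> u + d \<theta> u - 1))) \<longlonglongrightarrow> C \<theta> u u * of_real 0"
    by (intro tendsto_intros)
  then have "(\<lambda>k::nat. LINT x|freq. of_real (f \<theta> u x) * cis (real k * x)) \<longlonglongrightarrow> 0"
    using tendsto_asymp_equiv_cong[OF as[rule_format, OF assms(1) u u], of 0, THEN iffD2]
    unfolding e by simp
  from tendsto_Re[OF this]
  have "(\<lambda>k::nat. Re (LINT x|freq. of_real (f \<theta> u x) * cis (real k * x))) \<longlonglongrightarrow> 0" by simp
  moreover have "Re (LINT x|freq. of_real (f \<theta> u x) * cis (real k * x)) = autocov \<theta> u (real k)" for k
  proof -
    have "integrable freq (\<lambda>x. of_real (f \<theta> u x) * cis (real k * x))"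
    proof (rule Bochner_Integration.integrable_bound[OF f_integrable[OF assms]])
      show "(\<lambda>x. of_real (f \<theta> u x) * cis (real k * x)) \<in> borel_measurable freq"
      proof (rule borel_measurable_times)
        show "(\<lambda>x. complex_of_real (f \<theta> u x)) \<in> borel_measurable freq"
          using borel_measurable_integrable[OF f_integrable[OF assms]] by simp
        show "(\<lambda>x. cis (real k * x)) \<in> borel_measurable freq"
          by (intro borel_measurable_freq borel_measurable_continuous_onI continuous_intros)
      qed
      show "AE x in freq. norm (of_real (f \<theta> u x) * cis (real k * x)) \<le> norm (f \<theta> u x)"
        by (simp add: norm_mult)
    qed
    then show ?thesis by (simp add: autocov_def flip: integral_Re)
  qed
  ultimately show ?thesis by simp
qed

end

section \<open>Covariances of the process\<close>

text \<open>\<eta> (2 F + \<eta>) is the error of an inner product of vectors of norm at most F when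
  each is moved by \<eta>.\<close>

lemma exists_small_perturbation:
  fixes F \<epsilon> :: real
  assumes "F \<ge> 0" "\<epsilon> > 0"
  obtains \<eta> where "\<eta> > 0" "\<eta> * (2 * F + \<eta>) < \<epsilon>"
proof -
  define Q where "Q = 2 * F + 1"
  have Q: "Q > 0" using assms(1) by (simp add: Q_def)
  \<comment> \<open>\<eta> \<le> 1 bounds 2 F + \<eta> by Q, and the second entry then leaves at
    most half of \<epsilon>.\<close>
  define \<eta> where "\<eta> = min 1 (\<epsilon> / (2 * Q))"
  have "\<eta> * (2 * F + \<eta>) \<le> \<epsilon> / (2 * Q) * Q"
    using assms Q by (intro mult_mono) (auto simp: \<eta>_def Q_def)
  also have "\<dots> < \<epsilon>" using assms Q by simp
  finally show thesis using that[of \<eta>] assms Q by (simp add: \<eta>_def)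
qed

text \<open>The witnesses \<open>B\<close>, \<open>A0\<close>, \<open>K\<close> of
  \<open>gaussian_locally_stationary\<close> become parameters. The sign of \<open>K\<close> is not
  recorded, so |K| appears in the estimates.\<close>

locale locally_stationary = spectral_model \<Theta> A + brownian P B
  for \<Theta> :: "'p::euclidean_space set" and A :: "'p \<Rightarrow> real \<Rightarrow> real \<Rightarrow> complex"
    and P :: "'w measure" and B :: "real \<Rightarrow> 'w \<Rightarrow> complex" +
  fixes Y :: "nat \<Rightarrow> nat \<Rightarrow> 'w \<Rightarrow> real" and A0 :: "nat \<Rightarrow> nat \<Rightarrow> real \<Rightarrow> complex"
    and K :: real and \<theta>0 :: 'p
  assumes \<theta>0: "\<theta>0 \<in> \<Theta>"
    and Y_integral: "\<And>T t. T \<ge> 1 \<Longrightarrow> t \<in> {1..T} \<Longrightarrow> has_stochastic_integral P B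
             (\<lambda>x. A0 T t x * exp (\<i> * of_real (x * real t))) (\<lambda>\<omega>. of_real (Y T t \<omega>))"
    and A0_approx: "\<And>T t x. T \<ge> 1 \<Longrightarrow> t \<in> {1..T} \<Longrightarrow> x \<in> frequencies \<Longrightarrow>
           cmod (A0 T t x - A \<theta>0 (real t / real T) x) \<le> K / real T"
begin

abbreviation c :: "real \<Rightarrow> real \<Rightarrow> real" where
  "c \<equiv> autocov \<theta>0"

lemma Y_L2: "T \<ge> 1 \<Longrightarrow> t \<in> {1..T} \<Longrightarrow> Y T t \<in> L2_space P"
  by (rule real_stochastic_integral(1)[OF Y_integral])

lemma L2_mult_unimodular:
  assumes "p \<in> L2_space freq" "continuous_on UNIV g" "\<And>x. cmod (g x) = 1"
  shows "(\<lambda>x. p x * g x) \<in> L2_space freq"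
proof -
  have "g \<in> borel_measurable freq"
    by (intro borel_measurable_freq borel_measurable_continuous_onI assms)
  then have "(\<lambda>x. p x * g x) \<in> borel_measurable freq"
    by (rule borel_measurable_times[OF L2_measurable[OF assms(1)]])
  then show ?thesis using assms by (simp add: L2_space_def norm_mult)
qed

text \<open>The stochastic integral provides this for the modulated integrand; multiplying by the
  conjugate exponential removes the modulation.\<close>

lemma A0_L2:
  assumes "T \<ge> 1" "t \<in> {1..T}"
  shows "A0 T t \<in> L2_space freq"
proof -
  have "(\<lambda>x. A0 T t x * exp (\<i> * of_real (x * real t))) \<in> L2_space freq"
    by (rule stochastic_integral_approximation(1)[OF Y_integral[OF assms]])
  from L2_mult_unimodular[OF this, of "\<lambda>x. cis (- x * real t)"]
  have "(\<lambda>x. A0 T t x * exp (\<i> * of_real (x * real t)) * cis (- x * real t)) \<in> L2_space freq"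
    by (simp add: continuous_intros)
  moreover have "exp (\<i> * of_real (x * real t)) * cis (- x * real t) = 1" for x
    by (simp only: cis_conv_exp[symmetric] cis_mult) simp
  ultimately show ?thesis by (simp add: mult.assoc)
qed

text \<open>A(u, .) is a pointwise limit of measurable functions taken from different rows of the
  array: \<open>A0\<close> is close to A(t/T, .), and t/T can be steered to u, where A(., x) is
  continuous.\<close>

lemma A_measurable:
  assumes u: "u \<in> {0<..1}"
  shows "A \<theta>0 u \<in> borel_measurable freq"
proof -
  \<comment> \<open>In row T = n + 1, rounding T u up gives a time that is at least 1, as u > 0, and
    at most T.\<close>
  define \<tau> where "\<tau> n = nat \<lceil>real (Suc n) * u\<rceil>" for n
  have \<tau>: "\<tau> n \<in> {1..Suc n}" for n
  proof -
    have "0 < real (Suc n) * u" "real (Suc n) * u \<le> real (Suc n)"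
      using u by (auto intro: mult_left_le)
    then show ?thesis by (auto simp: \<tau>_def nat_le_iff le_nat_iff ceiling_le_iff intro: less_imp_le)
  qed
  have \<tau>u: "real (\<tau> n) / real (Suc n) - u \<in> {0..1 / real (Suc n)}" for n
  proof -
    have "0 \<le> real (Suc n) * u" using u by simp
    then have "real (\<tau> n) = of_int \<lceil>real (Suc n) * u\<rceil>" by (simp add: \<tau>_def)
    then have "real (\<tau> n) - real (Suc n) * u \<in> {0..1}"
      using ceiling_correct[of "real (Suc n) * u"] by auto
    moreover have "real (\<tau> n) / real (Suc n) - u = (real (\<tau> n) - real (Suc n) * u) / real (Suc n)"
      by (simp add: diff_divide_distrib del: of_nat_Suc)
    ultimately show ?thesis by (auto intro!: divide_right_mono simp del: of_nat_Suc)
  qed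
  have lim: "(\<lambda>n. real (\<tau> n) / real (Suc n)) \<longlonglongrightarrow> u"
  proof -
    have "(\<lambda>n. real (\<tau> n) / real (Suc n) - u) \<longlonglongrightarrow> 0"
      by (rule Lim_null_comparison[OF always_eventually LIMSEQ_Suc[OF lim_1_over_n]]) (use \<tau>u in auto)
    then show ?thesis by (rule Lim_null[THEN iffD2])
  qed
  have conv: "(\<lambda>n. A0 (Suc n) (\<tau> n) x) \<longlonglongrightarrow> A \<theta>0 u x" if x: "x \<in> frequencies" for x
  proof -
    have 1: "(\<lambda>n. A \<theta>0 (real (\<tau> n) / real (Suc n)) x) \<longlonglongrightarrow> A \<theta>0 u x"
    proof (rule continuous_on_tendsto_compose[OF A_continuous[OF \<theta>0 x] lim])
      show "\<forall>\<^sub>F n in sequentially. real (\<tau> n) / real (Suc n) \<in> {0..1}"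
      proof (intro always_eventually allI)
        fix n
        show "real (\<tau> n) / real (Suc n) \<in> {0..1}"
          using \<tau>[of n] by (simp add: divide_le_eq)
      qed
    qed (use u in auto)
    have "(\<lambda>n. K / real (Suc n)) \<longlonglongrightarrow> 0"
      using tendsto_mult[OF tendsto_const LIMSEQ_Suc[OF lim_1_over_n], of K] by simp
    then have "(\<lambda>n. A0 (Suc n) (\<tau> n) x - A \<theta>0 (real (\<tau> n) / real (Suc n)) x) \<longlonglongrightarrow> 0"
      by (rule Lim_null_comparison[rotated]) (intro always_eventually allI A0_approx \<tau> x, simp)
    from tendsto_add[OF this 1] show ?thesis by simp
  qed
  have s0: "{0} \<in> sets freq" by (auto simp: sets_restrict_space_iff)
  \<comment> \<open>No convergence is available at frequency 0, so the limit value is inserted there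
    by hand; a single point does not affect measurability.\<close>
  have "(\<lambda>x. if x \<in> {0} then A \<theta>0 u 0 else A \<theta>0 u x) \<in> borel_measurable freq"
  proof (rule borel_measurable_LIMSEQ_metric)
    show "(\<lambda>x. if x \<in> {0} then A \<theta>0 u 0 else A0 (Suc n) (\<tau> n) x) \<in> borel_measurable freq" for n
    proof (rule measurable_If_set)
      show "A0 (Suc n) (\<tau> n) \<in> borel_measurable freq"
        using \<tau>[of n] by (intro L2_measurable A0_L2) auto
      show "{0} \<inter> space freq \<in> sets freq" using s0 by auto
    qed simp
    show "(\<lambda>n. if x \<in> {0} then A \<theta>0 u 0 else A0 (Suc n) (\<tau> n) x)
        \<longlonglongrightarrow> (if x \<in> {0} then A \<theta>0 u 0 else A \<theta>0 u x)" if "x \<in> space freq" for x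
      using that conv[of x] by (auto simp: space_restrict_space frequencies_def)
  qed
  then show ?thesis by (rule measurable_cong[THEN iffD1, rotated]) auto
qed

lemma A_L2:
  assumes u: "u \<in> {0<..1}"
  shows "A \<theta>0 u \<in> L2_space freq"
  using A_measurable[OF u] f_integrable[OF \<theta>0 u] by (simp add: L2_space_def tv_spectral_density_def[abs_def])

text \<open>I + sqrt I dominates I, which bounds the mass of f and every autocovariance, and also
  sqrt I, which bounds the norm of A.\<close>

lemma A_bound:
  obtains F where "F \<ge> 0" "\<And>u. u \<in> {0<..1} \<Longrightarrow> L2_norm freq (A \<theta>0 u) \<le> F"
    "\<And>u k. u \<in> {0<..1} \<Longrightarrow> \<bar>c u k\<bar> \<le> F"
    "\<And>u. u \<in> {0<..1} \<Longrightarrow> (LINT x|freq. f \<theta>0 u x) \<le> F"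
proof -
  obtain D where D: "integrable freq D" "\<And>x. D x \<ge> 0"
    "\<And>u x. u \<in> {0..1} \<Longrightarrow> x \<in> frequencies \<Longrightarrow> f \<theta>0 u x \<le> D x"
    using f_dominated[OF \<theta>0] by blast
  define I where "I = (LINT x|freq. D x)"
  have I0: "I \<ge> 0" using D by (simp add: I_def)
  have fI: "(LINT x|freq. f \<theta>0 u x) \<le> I" if "u \<in> {0<..1}" for u
    unfolding I_def
    by (rule integral_mono_AE[OF f_integrable[OF \<theta>0 that] D(1)])
       (rule eventually_mono[OF AE_freq], use that in \<open>auto intro!: D(3)\<close>)
  show thesis
  proof (rule that[of "I + sqrt I"])
    show "I + sqrt I \<ge> 0" using I0 by simp
    fix u :: real assume u: "u \<in> {0<..1}"
    have "L2_norm freq (A \<theta>0 u) \<le> sqrt I"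
      by (rule L2_norm_le_sqrt) (use fI[OF u] in \<open>simp add: tv_spectral_density_def\<close>)
    then show "L2_norm freq (A \<theta>0 u) \<le> I + sqrt I" using I0 by linarith
    show "(LINT x|freq. f \<theta>0 u x) \<le> I + sqrt I" using fI[OF u] I0 real_sqrt_ge_zero[OF I0] by linarith
    fix k
    have "\<bar>c u k\<bar> \<le> (LINT x|freq. \<bar>f \<theta>0 u x * cos (k * x)\<bar>)"
      unfolding autocov_def using integral_norm_bound[of freq "\<lambda>x. f \<theta>0 u x * cos (k * x)"] by simp
    also have "\<dots> \<le> (LINT x|freq. f \<theta>0 u x)"
    proof (rule integral_mono[OF integrable_abs[OF f_cos_integrable[OF \<theta>0 u]] f_integrable[OF \<theta>0 u]])
      show "\<bar>f \<theta>0 u x * cos (k * x)\<bar> \<le> f \<theta>0 u x" for x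
        using mult_left_mono[OF abs_cos_le_one[of "k * x"], of "f \<theta>0 u x"]
        by (simp add: abs_mult tv_spectral_density_def)
    qed
    finally show "\<bar>c u k\<bar> \<le> I + sqrt I" using fI[OF u] I0 real_sqrt_ge_zero[OF I0] by linarith
  qed
qed

text \<open>A violating pair of sequences would have subsequences with a common limit; A(., x) is
  continuous at every frequency of the punctured domain, and dominated convergence makes the L2
  distance vanish.\<close>

lemma A_uniformly_L2_continuous:
  assumes "\<epsilon> > 0"
  obtains \<delta> where "\<delta> > 0" "\<And>u v. u \<in> {0<..1} \<Longrightarrow> v \<in> {0<..1} \<Longrightarrow> \<bar>u - v\<bar> < \<delta> \<Longrightarrow>
    L2_norm freq (\<lambda>x. A \<theta>0 u x - A \<theta>0 v x) < \<epsilon>"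
proof (rule ccontr)
  assume "\<not> thesis"
  then have "\<forall>\<delta>>0. \<exists>u v. u \<in> {0<..1} \<and> v \<in> {0<..1} \<and> \<bar>u - v\<bar> < \<delta> \<and>
    \<epsilon> \<le> L2_norm freq (\<lambda>x. A \<theta>0 u x - A \<theta>0 v x)"
    using that by (meson not_le)
  then have "\<forall>n. \<exists>u v. u \<in> {0<..1} \<and> v \<in> {0<..1} \<and> \<bar>u - v\<bar> < 1 / real (Suc n) \<and>
    \<epsilon> \<le> L2_norm freq (\<lambda>x. A \<theta>0 u x - A \<theta>0 v x)"
    by (metis of_nat_0_less_iff zero_less_Suc zero_less_divide_1_iff)
  then obtain u v where u: "\<And>n. u n \<in> {0<..1}" and v: "\<And>n. v n \<in> {0<..1}"
    and uv: "\<And>n. \<bar>u n - v n\<bar> < 1 / real (Suc n)"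
    and e: "\<And>n. \<epsilon> \<le> L2_norm freq (\<lambda>x. A \<theta>0 (u n) x - A \<theta>0 (v n) x)"
    by metis
  obtain D where D: "integrable freq D" "\<And>x. D x \<ge> 0"
    "\<And>u x. u \<in> {0..1} \<Longrightarrow> x \<in> frequencies \<Longrightarrow> f \<theta>0 u x \<le> D x"
    using f_dominated[OF \<theta>0] by blast
  have u01: "0 \<le> u n \<and> u n \<le> 1" "0 \<le> v n \<and> v n \<le> 1" for n
    using u[of n] v[of n] by auto
  then have "\<forall>n. u n \<in> {0..1}" by auto
  \<comment> \<open>The limit l may be 0. This is harmless: A(0, x) is used only as a pointwise
    limit that cancels against itself.\<close>
  then obtain l r where l: "l \<in> {0..1}" and r: "strict_mono (r::nat \<Rightarrow> nat)" and ul: "(u \<circ> r) \<longlonglongrightarrow> l"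
    using compact_Icc[of "0::real" 1] unfolding compact_def by metis
  have "(\<lambda>n. u n - v n) \<longlonglongrightarrow> 0"
    by (rule Lim_null_comparison[OF always_eventually LIMSEQ_Suc[OF lim_1_over_n]])
       (use uv in \<open>auto intro: less_imp_le\<close>)
  from LIMSEQ_subseq_LIMSEQ[OF this r] have "(\<lambda>n. u (r n) - v (r n)) \<longlonglongrightarrow> 0" by (simp add: o_def)
  from tendsto_diff[OF ul this] have vl: "(\<lambda>n. v (r n)) \<longlonglongrightarrow> l" by (simp add: o_def)
  have bound: "(cmod (A \<theta>0 (u n) x - A \<theta>0 (v n) x))\<^sup>2 \<le> 4 * D x" if x: "x \<in> frequencies" for n x
  proof -
    have "(cmod (A \<theta>0 (u n) x - A \<theta>0 (v n) x))\<^sup>2 \<le> (cmod (A \<theta>0 (u n) x) + cmod (A \<theta>0 (v n) x))\<^sup>2"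
      by (intro power_mono norm_triangle_ineq4) auto
    also have "\<dots> \<le> 2 * f \<theta>0 (u n) x + 2 * f \<theta>0 (v n) x"
      using sum_squares_bound[of "cmod (A \<theta>0 (u n) x)" "cmod (A \<theta>0 (v n) x)"]
      by (simp add: tv_spectral_density_def power2_sum)
    also have "\<dots> \<le> 4 * D x"
    proof -
      have "f \<theta>0 (u n) x \<le> D x" "f \<theta>0 (v n) x \<le> D x"
        using u[of n] v[of n] by (auto intro!: D(3) x)
      then show ?thesis by linarith
    qed
    finally show ?thesis .
  qed
  have "(\<lambda>n. LINT x|freq. (cmod (A \<theta>0 (u (r n)) x - A \<theta>0 (v (r n)) x))\<^sup>2)
      \<longlonglongrightarrow> (LINT x|freq. 0)"
  proof (rule integral_dominated_convergence[where w = "\<lambda>x. 4 * D x"])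
    show "integrable freq (\<lambda>x. 4 * D x)" using D(1) by simp
    show "AE x in freq. (\<lambda>n. (cmod (A \<theta>0 (u (r n)) x - A \<theta>0 (v (r n)) x))\<^sup>2) \<longlonglongrightarrow> 0"
    proof (rule eventually_mono[OF AE_freq])
      fix x assume x: "x \<in> frequencies"
      have "(\<lambda>n. A \<theta>0 (u (r n)) x) \<longlonglongrightarrow> A \<theta>0 l x" "(\<lambda>n. A \<theta>0 (v (r n)) x) \<longlonglongrightarrow> A \<theta>0 l x"
        using ul u01
        by (auto intro!: continuous_on_tendsto_compose[OF A_continuous[OF \<theta>0 x] _ l] vl always_eventually simp: o_def)
      then have "(\<lambda>n. (cmod (A \<theta>0 (u (r n)) x - A \<theta>0 (v (r n)) x))\<^sup>2) \<longlonglongrightarrow> (cmod (A \<theta>0 l x - A \<theta>0 l x))\<^sup>2"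
        by (intro tendsto_intros)
      then show "(\<lambda>n. (cmod (A \<theta>0 (u (r n)) x - A \<theta>0 (v (r n)) x))\<^sup>2) \<longlonglongrightarrow> 0" by simp
    qed
    show "AE x in freq. norm ((cmod (A \<theta>0 (u (r n)) x - A \<theta>0 (v (r n)) x))\<^sup>2) \<le> 4 * D x" for n
      by (rule eventually_mono[OF AE_freq]) (use bound in auto)
  qed (use A_measurable u v in auto)
  from tendsto_real_sqrt[OF this]
  have "(\<lambda>n. L2_norm freq (\<lambda>x. A \<theta>0 (u (r n)) x - A \<theta>0 (v (r n)) x)) \<longlonglongrightarrow> 0"
    by (simp add: L2_norm_def)
  then have "\<epsilon> \<le> 0" by (rule LIMSEQ_le_const) (use e in auto)
  with assms show False by simp
qed

lemma L2_norm_freq_le: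
  assumes "p \<in> L2_space freq" "\<And>x. x \<in> frequencies \<Longrightarrow> cmod (p x) \<le> b" "b \<ge> 0"
  shows "L2_norm freq p \<le> sqrt (2 * pi) * b"
proof -
  interpret fm: finite_measure freq by (rule finite_measure_freq)
  have "(LINT x|freq. (cmod (p x))\<^sup>2) \<le> (LINT x|freq. b\<^sup>2)"
    by (rule integral_mono_AE)
       (use assms in \<open>auto simp: L2_space_def intro!: eventually_mono[OF AE_freq] power_mono\<close>)
  also have "\<dots> = 2 * pi * b\<^sup>2"
    by (simp add: measure_restrict_space)
  finally have "L2_norm freq p \<le> sqrt (2 * pi * b\<^sup>2)" by (rule L2_norm_le_sqrt)
  also have "\<dots> = sqrt (2 * pi) * b" using assms(3) by (simp add: real_sqrt_mult)
  finally show ?thesis .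
qed

text \<open>The product estimate for p and cnj q gives \<eta> (F + \<eta>) + F \<eta>. The two norm
  bounds are needed only for the reference pair p', q'.\<close>

lemma covariance_integral_diff:
  fixes p q p' q' :: "real \<Rightarrow> complex"
  assumes L: "p \<in> L2_space freq" "q \<in> L2_space freq"
    "p' \<in> L2_space freq" "q' \<in> L2_space freq"
    and d: "L2_norm freq (\<lambda>x. p x - p' x) \<le> \<eta>" "L2_norm freq (\<lambda>x. q x - q' x) \<le> \<eta>"
    and F: "L2_norm freq p' \<le> F" "L2_norm freq q' \<le> F"
  shows "cmod ((LINT x|freq. p x * cnj (q x)) - (LINT x|freq. p' x * cnj (q' x))) \<le> \<eta> * (2 * F + \<eta>)"
proof -
  have \<eta>0: "0 \<le> \<eta>" by (rule order_trans[OF L2_norm_nonneg d(1)])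
  have F0: "0 \<le> F" by (rule order_trans[OF L2_norm_nonneg F(1)])
  have cn: "L2_norm freq (\<lambda>x. cnj (q' x)) = L2_norm freq q'" by (simp add: L2_norm_def)
  have "(LINT x|freq. p x * cnj (q x)) - (LINT x|freq. p' x * cnj (q' x))
      = (LINT x|freq. p x * cnj (q x) - p' x * cnj (q' x))"
    by (rule Bochner_Integration.integral_diff[symmetric, OF L2_mult_integrable[OF L(1) L2_cnj[OF L(2)]]
          L2_mult_integrable[OF L(3) L2_cnj[OF L(4)]]])
  also have "cmod \<dots> \<le> (LINT x|freq. cmod (p x * cnj (q x) - p' x * cnj (q' x)))"
    by (rule integral_norm_bound)
  also have "\<dots> \<le> L2_norm freq (\<lambda>x. p x - p' x) * (L2_norm freq q' + L2_norm freq (\<lambda>x. q x - q' x))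
      + L2_norm freq p' * L2_norm freq (\<lambda>x. q x - q' x)"
    using L2_product_diff[OF L(1) L2_cnj[OF L(2)] L(3) L2_cnj[OF L(4)]] by (simp only: L2_norm_cnj_diff cn)
  also have "\<dots> \<le> \<eta> * (F + \<eta>) + F * \<eta>"
    by (intro add_mono mult_mono d F L2_norm_nonneg \<eta>0 F0 add_nonneg_nonneg)
  finally show ?thesis by (simp add: algebra_simps)
qed

text \<open>Writes the stationary autocovariance in the same form as the isometry gives for the
  process, so that both are compared as inner products of modulated transfer functions.\<close>

lemma autocov_as_L2_product:
  assumes u: "u \<in> {0<..1}"
  shows "c u (s - t) = Re (LINT x|freq. (A \<theta>0 u x * cis (x * s)) * cnj (A \<theta>0 u x * cis (x * t)))"
proof -
  have L: "(\<lambda>x. A \<theta>0 u x * cis (x * a)) \<in> L2_space freq" for a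
    by (rule L2_mult_unimodular[OF A_L2[OF u]]) (auto intro!: continuous_intros)
  have "(A \<theta>0 u x * cis (x * s)) * cnj (A \<theta>0 u x * cis (x * t)) = of_real (f \<theta>0 u x) * cis ((s - t) * x)" for x
  proof -
    have "(A \<theta>0 u x * cis (x * s)) * cnj (A \<theta>0 u x * cis (x * t))
       = (A \<theta>0 u x * cnj (A \<theta>0 u x)) * (cis (x * s) * cis (- (x * t)))"
      by (simp add: cis_cnj mult_ac)
    then show ?thesis
      by (simp add: cis_mult tv_spectral_density_def algebra_simps flip: complex_norm_square)
  qed
  then have "Re ((A \<theta>0 u x * cis (x * s)) * cnj (A \<theta>0 u x * cis (x * t))) = f \<theta>0 u x * cos ((s - t) * x)" for x
    by simp
  then show ?thesis
    unfolding autocov_def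
    using integral_Re[OF L2_mult_integrable[OF L L2_cnj[OF L]], of s t] by simp
qed

text \<open>Two replacements are made: \<open>A0\<close> by A(t/T, .), at cost of order 1/T in sup
  norm, and A(t/T, .) by A(u, .), by L2 continuity. Modulations have modulus one, so the error does
  not depend on the times beyond their closeness to u.\<close>

lemma covariance_approximation:
  assumes "\<epsilon> > 0"
  obtains \<delta> T0 where "\<delta> > 0" "T0 \<ge> 1"
    "\<And>T s t u. T \<ge> T0 \<Longrightarrow> s \<in> {1..T} \<Longrightarrow> t \<in> {1..T} \<Longrightarrow> u \<in> {0<..1} \<Longrightarrow>
      \<bar>real s / real T - u\<bar> < \<delta> \<Longrightarrow> \<bar>real t / real T - u\<bar> < \<delta> \<Longrightarrow>
      \<bar>expectation (\<lambda>\<omega>. Y T s \<omega> * Y T t \<omega>) - c u (real s - real t)\<bar> < \<epsilon>"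
proof -
  obtain F where F: "F \<ge> 0" "\<And>u. u \<in> {0<..1} \<Longrightarrow> L2_norm freq (A \<theta>0 u) \<le> F"
    using A_bound by metis
  obtain \<eta> where \<eta>: "0 < \<eta>" and \<eta>\<epsilon>: "\<eta> * (2 * F + \<eta>) < \<epsilon>"
    using exists_small_perturbation[OF F(1) assms] by blast
  obtain \<delta> where \<delta>: "\<delta> > 0" "\<And>u v. u \<in> {0<..1} \<Longrightarrow> v \<in> {0<..1} \<Longrightarrow> \<bar>u - v\<bar> < \<delta> \<Longrightarrow>
    L2_norm freq (\<lambda>x. A \<theta>0 u x - A \<theta>0 v x) < \<eta> / 2"
    using A_uniformly_L2_continuous[of "\<eta> / 2"] \<eta> by auto
  \<comment> \<open>From T0 on the first replacement costs at most \<eta> / 2; \<delta> pays for the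
    other half.\<close>
  obtain T0 :: nat where T0: "real T0 > 2 * sqrt (2 * pi) * \<bar>K\<bar> / \<eta>" using reals_Archimedean2 by blast
  show thesis
  proof (rule that[of \<delta> "max 1 T0"])
    fix T s t u
    assume T: "T \<ge> max 1 T0" and st: "s \<in> {1..T}" "t \<in> {1..T}" and u: "u \<in> {0<..1::real}"
      and close: "\<bar>real s / real T - u\<bar> < \<delta>" "\<bar>real t / real T - u\<bar> < \<delta>"
    have T1: "T \<ge> 1" using T by simp
    have KT: "sqrt (2 * pi) * (\<bar>K\<bar> / real T) \<le> \<eta> / 2"
    proof -
      have "2 * sqrt (2 * pi) * \<bar>K\<bar> / \<eta> \<le> real T" using T0 T by linarith
      then show ?thesis using \<eta> T1 by (simp add: field_simps)
    qed
    define \<phi> where "\<phi> a x = A0 T a x * exp (\<i> * of_real (x * real a))" for a x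
    define \<psi> where "\<psi> a x = A \<theta>0 u x * cis (x * real a)" for a :: nat and x
    have \<phi>L: "\<phi> a \<in> L2_space freq" if "a \<in> {1..T}" for a
      unfolding \<phi>_def by (rule stochastic_integral_approximation(1)[OF Y_integral[OF T1 that]])
    have \<psi>L: "\<psi> a \<in> L2_space freq" for a
      unfolding \<psi>_def[abs_def] by (rule L2_mult_unimodular[OF A_L2[OF u]]) (auto intro!: continuous_intros)
    have d: "L2_norm freq (\<lambda>x. \<phi> a x - \<psi> a x) \<le> \<eta>"
      if a: "a \<in> {1..T}" and ac: "\<bar>real a / real T - u\<bar> < \<delta>" for a
    proof -
      have ua: "real a / real T \<in> {0<..1}" using a by (auto simp: field_simps)
      have "\<phi> a x - \<psi> a x = (A0 T a x - A \<theta>0 u x) * cis (x * real a)" for x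
        by (simp add: \<phi>_def \<psi>_def cis_conv_exp algebra_simps)
      then have "L2_norm freq (\<lambda>x. \<phi> a x - \<psi> a x) = L2_norm freq (\<lambda>x. A0 T a x - A \<theta>0 u x)"
        by (simp add: L2_norm_def norm_mult)
      also have "\<dots> \<le> L2_norm freq (\<lambda>x. A0 T a x - A \<theta>0 (real a / real T) x)
          + L2_norm freq (\<lambda>x. A \<theta>0 (real a / real T) x - A \<theta>0 u x)"
        by (rule L2_triangle3[OF A0_L2[OF T1 a] A_L2[OF ua] A_L2[OF u]])
      also have "L2_norm freq (\<lambda>x. A0 T a x - A \<theta>0 (real a / real T) x) \<le> sqrt (2 * pi) * (\<bar>K\<bar> / real T)"
      proof (rule L2_norm_freq_le[OF L2_diff[OF A0_L2[OF T1 a] A_L2[OF ua]]])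
        fix x assume "x \<in> frequencies"
        from A0_approx[OF T1 a this] show "cmod (A0 T a x - A \<theta>0 (real a / real T) x) \<le> \<bar>K\<bar> / real T"
          by (rule order_trans) (simp add: divide_right_mono)
      qed simp
      finally show ?thesis using KT \<delta>(2)[OF ua u ac] by linarith
    qed
    have n: "L2_norm freq (\<psi> a) \<le> F" for a
      using F(2)[OF u] by (simp add: \<psi>_def L2_norm_def norm_mult)
    have e: "of_real (expectation (\<lambda>\<omega>. Y T s \<omega> * Y T t \<omega>)) = (LINT x|freq. \<phi> s x * cnj (\<phi> t x))"
      using stochastic_integral_isometry[OF Y_integral[OF T1 st(1)] Y_integral[OF T1 st(2)]]
      by (simp add: \<phi>_def flip: of_real_mult)
    then have "expectation (\<lambda>\<omega>. Y T s \<omega> * Y T t \<omega>) = Re (LINT x|freq. \<phi> s x * cnj (\<phi> t x))"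
      by (metis Re_complex_of_real)
    then have "\<bar>expectation (\<lambda>\<omega>. Y T s \<omega> * Y T t \<omega>) - c u (real s - real t)\<bar>
      = \<bar>Re ((LINT x|freq. \<phi> s x * cnj (\<phi> t x)) - (LINT x|freq. \<psi> s x * cnj (\<psi> t x)))\<bar>"
      by (simp add: autocov_as_L2_product[OF u] \<psi>_def)
    also have "\<dots> \<le> \<eta> * (2 * F + \<eta>)"
      by (rule order_trans[OF abs_Re_le_cmod covariance_integral_diff[OF \<phi>L[OF st(1)] \<phi>L[OF st(2)] \<psi>L \<psi>L
            d[OF st(1) close(1)] d[OF st(2) close(2)] n n]])
    finally show "\<bar>expectation (\<lambda>\<omega>. Y T s \<omega> * Y T t \<omega>) - c u (real s - real t)\<bar> < \<epsilon>"
      using \<eta>\<epsilon> by linarith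
  qed (use \<delta> in auto)
qed

text \<open>The lag enters through a factor of modulus one, hence one \<delta> serves all
  lags.\<close>

lemma autocov_equicontinuous:
  assumes "\<epsilon> > 0"
  obtains \<delta> where "\<delta> > 0" "\<And>u v k. u \<in> {0<..1} \<Longrightarrow> v \<in> {0<..1} \<Longrightarrow> \<bar>u - v\<bar> < \<delta> \<Longrightarrow> \<bar>c u k - c v k\<bar> < \<epsilon>"
proof -
  obtain F where F: "F \<ge> 0" "\<And>u. u \<in> {0<..1} \<Longrightarrow> L2_norm freq (A \<theta>0 u) \<le> F"
    using A_bound by metis
  obtain \<eta> where \<eta>: "0 < \<eta>" and \<eta>\<epsilon>: "\<eta> * (2 * F + \<eta>) < \<epsilon>"
    using exists_small_perturbation[OF F(1) assms] by blast
  obtain \<delta> where \<delta>: "\<delta> > 0" "\<And>u v. u \<in> {0<..1} \<Longrightarrow> v \<in> {0<..1} \<Longrightarrow> \<bar>u - v\<bar> < \<delta> \<Longrightarrow>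
    L2_norm freq (\<lambda>x. A \<theta>0 u x - A \<theta>0 v x) < \<eta>"
    using A_uniformly_L2_continuous[OF \<eta>(1)] by metis
  show thesis
  proof (rule that[OF \<delta>(1)])
    fix u v k assume u: "u \<in> {0<..1::real}" and v: "v \<in> {0<..1::real}" and uv: "\<bar>u - v\<bar> < \<delta>"
    define \<psi> where "\<psi> w a x = A \<theta>0 w x * cis (x * a)" for w a x
    have \<psi>L: "\<psi> w a \<in> L2_space freq" if "w \<in> {0<..1}" for w a
      unfolding \<psi>_def[abs_def] by (rule L2_mult_unimodular[OF A_L2[OF that]]) (auto intro!: continuous_intros)
    have d: "L2_norm freq (\<lambda>x. \<psi> u a x - \<psi> v a x) \<le> \<eta>" for a
    proof -
      have "\<psi> u a x - \<psi> v a x = (A \<theta>0 u x - A \<theta>0 v x) * cis (x * a)" for x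
        by (simp add: \<psi>_def algebra_simps)
      then have "L2_norm freq (\<lambda>x. \<psi> u a x - \<psi> v a x) = L2_norm freq (\<lambda>x. A \<theta>0 u x - A \<theta>0 v x)"
        by (simp add: L2_norm_def norm_mult)
      then show ?thesis using \<delta>(2)[OF u v uv] by simp
    qed
    have n: "L2_norm freq (\<psi> v a) \<le> F" for a
      using F(2)[OF v] by (simp add: \<psi>_def L2_norm_def norm_mult)
    have cw: "c w k = Re (LINT x|freq. \<psi> w k x * cnj (\<psi> w 0 x))" if "w \<in> {0<..1}" for w
      using autocov_as_L2_product[OF that, of k 0] by (simp add: \<psi>_def)
    have "\<bar>c u k - c v k\<bar> = \<bar>Re ((LINT x|freq. \<psi> u k x * cnj (\<psi> u 0 x)) - (LINT x|freq. \<psi> v k x * cnj (\<psi> v 0 x)))\<bar>"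
      by (simp add: cw[OF u] cw[OF v])
    also have "\<dots> \<le> \<eta> * (2 * F + \<eta>)"
      by (rule order_trans[OF abs_Re_le_cmod covariance_integral_diff[OF \<psi>L[OF u] \<psi>L[OF u] \<psi>L[OF v] \<psi>L[OF v] d d n n]])
    finally show "\<bar>c u k - c v k\<bar> < \<epsilon>" using \<eta>\<epsilon> by linarith
  qed
qed

text \<open>Decay at the finitely many grid points i/m holds from a common lag on, and
  equicontinuity carries it to every u.\<close>

lemma autocov_uniform_decay:
  assumes "\<epsilon> > 0"
  obtains L :: nat where "\<And>u k. u \<in> {0<..1} \<Longrightarrow> k \<ge> L \<Longrightarrow> \<bar>c u (real k)\<bar> < \<epsilon>"
proof -
  obtain \<delta> where \<delta>: "\<delta> > 0"
    "\<And>u v k. u \<in> {0<..1} \<Longrightarrow> v \<in> {0<..1} \<Longrightarrow> \<bar>u - v\<bar> < \<delta> \<Longrightarrow> \<bar>c u k - c v k\<bar> < \<epsilon> / 2"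
    using autocov_equicontinuous[of "\<epsilon> / 2"] assms by auto
  obtain m :: nat where m: "real m > 1 / \<delta>" using reals_Archimedean2 by blast
  have m0: "real m > 0" using m \<delta>(1) by (meson less_trans zero_less_divide_1_iff)
  have "\<forall>i\<in>{1..m}. \<forall>\<^sub>F k in sequentially. \<bar>c (real i / real m) (real k)\<bar> < \<epsilon> / 2"
  proof
    fix i assume "i \<in> {1..m}"
    then have "real i / real m \<in> {0<..1}" by (auto simp: field_simps)
    from autocov_decay[OF \<theta>0 this] have "(\<lambda>k. \<bar>c (real i / real m) (real k)\<bar>) \<longlonglongrightarrow> 0"
      by (simp add: tendsto_rabs_zero)
    then show "\<forall>\<^sub>F k in sequentially. \<bar>c (real i / real m) (real k)\<bar> < \<epsilon> / 2"
      by (rule order_tendstoD) (use assms in simp)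
  qed
  then have "\<forall>\<^sub>F k in sequentially. \<forall>i\<in>{1..m}. \<bar>c (real i / real m) (real k)\<bar> < \<epsilon> / 2"
    by (intro eventually_ball_finite) auto
  then obtain L where L: "\<And>k i. k \<ge> L \<Longrightarrow> i \<in> {1..m} \<Longrightarrow> \<bar>c (real i / real m) (real k)\<bar> < \<epsilon> / 2"
    unfolding eventually_sequentially by blast
  show thesis
  proof (rule that[of L])
    fix u k assume u: "u \<in> {0<..1::real}" and k: "k \<ge> L"
    \<comment> \<open>Rounding up keeps the index at least 1, so the grid point is positive, as the
      decay lemma demands.\<close>
    define i where "i = nat \<lceil>real m * u\<rceil>"
    have mu: "0 < real m * u" "real m * u \<le> real m" using m0 u by (auto intro: mult_left_le)
    have i: "i \<in> {1..m}" using mu by (auto simp: i_def nat_le_iff le_nat_iff ceiling_le_iff)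
    have "real i = of_int \<lceil>real m * u\<rceil>" using mu by (simp add: i_def)
    then have "\<bar>real m * u - real i\<bar> \<le> 1" using ceiling_correct[of "real m * u"] by linarith
    then have "\<bar>u - real i / real m\<bar> \<le> 1 / real m" using m0 by (simp add: field_simps abs_le_iff)
    also have "\<dots> < \<delta>" using m m0 \<delta>(1) by (simp add: field_simps)
    finally have d: "\<bar>u - real i / real m\<bar> < \<delta>" .
    have "real i / real m \<in> {0<..1}" using i by (auto simp: field_simps)
    from \<delta>(2)[OF u this d, of "real k"] L[OF k i] show "\<bar>c u (real k)\<bar> < \<epsilon>" by linarith
  qed
qed

end

section \<open>Periodograms and sample autocovariances\<close>

text \<open>A continuous positive function on [0,1] attains a positive minimum, and a bounded
  derivative gives the Lipschitz constant.\<close>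

lemma taper_bounds:
  assumes "assumption_A2 h"
  obtains l b L where "0 < l" "\<And>x. x \<in> {0..1} \<Longrightarrow> l \<le> h x \<and> h x \<le> b" "0 \<le> L"
    "\<And>x y. x \<in> {0..1} \<Longrightarrow> y \<in> {0..1} \<Longrightarrow> \<bar>h x - h y\<bar> \<le> L * \<bar>x - y\<bar>"
proof -
  obtain b K where pos: "\<And>x. x \<in> {0..1} \<Longrightarrow> h x > 0" and b: "\<And>x. x \<in> {0..1} \<Longrightarrow> h x \<le> b"
    and K: "\<forall>x\<in>{0..1}. \<exists>D. (h has_real_derivative D) (at x within {0..1}) \<and> \<bar>D\<bar> \<le> K"
    using assms unfolding assumption_A2_def by blast
  from bchoice[OF K] obtain h' where h': "\<And>x. x \<in> {0..1} \<Longrightarrow>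
    (h has_real_derivative h' x) (at x within {0..1}) \<and> \<bar>h' x\<bar> \<le> K" by blast
  have "continuous_on {0..1} h"
    using h' by (meson DERIV_continuous continuous_on_eq_continuous_within)
  then obtain x0 where x0: "x0 \<in> {0..1}" "\<And>x. x \<in> {0..1} \<Longrightarrow> h x0 \<le> h x"
    using continuous_attains_inf[of "{0..1::real}" h] by auto
  have lip: "\<bar>h x - h y\<bar> \<le> K * \<bar>x - y\<bar>" if "x \<in> {0..1}" "y \<in> {0..1}" for x y
    using field_differentiable_bound[of "{0..1}" h h' K x y] h' that by auto
  show thesis
  proof (rule that[of "h x0" b K])
    show "0 \<le> K" using h'[of 0] by fastforce
  qed (use x0 pos b lip in auto)
qed

section \<open>Cosine coefficients of the periodogram\<close>

lemma integral_cos_freq: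
  fixes m :: int
  shows "integrable freq (\<lambda>x. cos (of_int m * x))"
    "(LINT x|freq. cos (of_int m * x)) = (if m = 0 then 2 * pi else 0)"
proof -
  have c: "continuous_on {-pi..pi} (\<lambda>x. cos (of_int m * x))"
    by (intro continuous_intros)
  show i: "integrable freq (\<lambda>x. cos (of_int m * x))"
    by (rule continuous_imp_integrable_real[OF c])
  have "(LINT x|freq. cos (of_int m * x)) = integral {-pi..pi} (\<lambda>x. cos (of_int m * x))"
    by (rule lebesgue_integral_eq_integral[OF i]) simp
  also have "\<dots> = (if m = 0 then 2 * pi else 0)"
  proof (cases "m = 0")
    case False
    have "((\<lambda>x. cos (of_int m * x)) has_integral
        (sin (of_int m * pi) / of_int m - sin (of_int m * (-pi)) / of_int m)) {-pi..pi}"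
    proof (rule fundamental_theorem_of_calculus)
      show "((\<lambda>x. sin (of_int m * x) / of_int m) has_vector_derivative cos (of_int m * x)) (at x within {-pi..pi})" for x
        using False by (auto intro!: derivative_eq_intros simp flip: has_real_derivative_iff_has_vector_derivative)
    qed simp
    moreover have "sin (of_int m * pi) = 0" by (simp add: mult.commute sin_integer_2pi sin_zero_iff_int2)
    ultimately show ?thesis using False by (simp add: integral_unique)
  qed simp
  finally show "(LINT x|freq. cos (of_int m * x)) = (if m = 0 then 2 * pi else 0)" .
qed

text \<open>Expanding the squared modulus gives cosines of the differences s - t; orthogonality
  keeps the pairs at distance k, and the two orders of such a pair contribute equally. For k \<ge> n
  the truncated n - k makes the sum empty.\<close>

lemma integral_periodogram_cos:
  fixes a :: "nat \<Rightarrow> real"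
  shows "(LINT x|freq. (cmod (\<Sum>s<n. of_real (a s) * exp (- \<i> * of_real (x * real s))))\<^sup>2 * cos (real k * x))
    = 2 * pi * (\<Sum>s<n-k. a s * a (s + k))"
proof -
  \<comment> \<open>The integral of the product of the two cosines divided by pi. For k = 0 both
    summands count, giving the doubled value on the diagonal.\<close>
  define J where "J s t = (if int s - int t = int k then 1 else 0) + (if int t - int s = int k then 1 else (0::real))"
    for s t :: nat
  have e: "(cmod (\<Sum>s<n. of_real (a s) * exp (- \<i> * of_real (x * real s))))\<^sup>2
      = (\<Sum>s<n. \<Sum>t<n. a s * a t * cos (of_int (int s - int t) * x))" for x
  proof -
    have "(\<Sum>s<n. of_real (a s) * exp (- \<i> * of_real (x * real s)))
      = Complex (\<Sum>s<n. a s * cos (x * real s)) (- (\<Sum>s<n. a s * sin (x * real s)))"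
    proof -
      have "exp (- \<i> * of_real (x * real s)) = cis (- (x * real s))" for s
        by (simp add: cis_conv_exp)
      then show ?thesis by (simp add: complex_eq_iff sum_negf)
    qed
    then have "(cmod (\<Sum>s<n. of_real (a s) * exp (- \<i> * of_real (x * real s))))\<^sup>2
      = (\<Sum>s<n. a s * cos (x * real s))\<^sup>2 + (\<Sum>s<n. a s * sin (x * real s))\<^sup>2"
      by (simp add: cmod_power2)
    also have "\<dots> = (\<Sum>s<n. \<Sum>t<n. a s * a t * cos (of_int (int s - int t) * x))"
      unfolding power2_eq_square sum_product sum.distrib[symmetric]
      by (intro sum.cong refl) (simp add: left_diff_distrib cos_diff algebra_simps)
    finally show ?thesis .
  qed
  have cc: "cos (of_int (int s - int t) * x) * cos (real k * x)
      = (cos (of_int (int s - int t - int k) * x) + cos (of_int (int s - int t + int k) * x)) / 2" for s t x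
    unfolding cos_times_cos by (simp add: algebra_simps)
  have i: "integrable freq (\<lambda>x. cos (of_int (int s - int t) * x) * cos (real k * x))"
    and v: "(LINT x|freq. cos (of_int (int s - int t) * x) * cos (real k * x)) = pi * J s t" for s t
    unfolding cc using integral_cos_freq[of "int s - int t - int k"] integral_cos_freq[of "int s - int t + int k"]
    by (auto simp: J_def)
  have "(LINT x|freq. (cmod (\<Sum>s<n. of_real (a s) * exp (- \<i> * of_real (x * real s))))\<^sup>2 * cos (real k * x))
    = (LINT x|freq. (\<Sum>s<n. \<Sum>t<n. (a s * a t) * (cos (of_int (int s - int t) * x) * cos (real k * x))))"
    unfolding e by (simp add: sum_distrib_right mult.assoc)
  also have "\<dots> = (\<Sum>s<n. \<Sum>t<n. (a s * a t) * (pi * J s t))"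
    using i v by (simp add: Bochner_Integration.integral_sum Bochner_Integration.integrable_sum)
  also have "\<dots> = pi * ((\<Sum>s<n. \<Sum>t<n. if s = t + k then a s * a t else 0)
      + (\<Sum>s<n. \<Sum>t<n. if t = s + k then a s * a t else 0))"
    unfolding sum_distrib_left sum.distrib[symmetric] distrib_left
    by (intro sum.cong refl) (auto simp: J_def)
  also have "(\<Sum>s<n. \<Sum>t<n. if s = t + k then a s * a t else 0) = (\<Sum>t<n. \<Sum>s<n. if s = t + k then a s * a t else 0)"
    by (rule sum.swap)
  also have "\<dots> = (\<Sum>s<n. \<Sum>t<n. if t = s + k then a s * a t else 0)"
    by simp (intro sum.cong refl, simp add: mult.commute)
  also have "(\<Sum>s<n. \<Sum>t<n. if t = s + k then a s * a t else 0) = (\<Sum>s<n-k. a s * a (s + k))"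
  proof -
    have "(\<Sum>s<n. \<Sum>t<n. if t = s + k then a s * a t else 0) = (\<Sum>s<n. if s + k < n then a s * a (s + k) else 0)"
      by (simp add: sum.delta)
    also have "\<dots> = (\<Sum>s\<in>{s\<in>{..<n}. s + k < n}. a s * a (s + k))"
      by (rule sum.inter_filter[symmetric]) simp
    also have "{s\<in>{..<n}. s + k < n} = {..<n-k}" by auto
    finally show ?thesis .
  qed
  finally show ?thesis by simp
qed

text \<open>The block consists of \<open>y (b + 1), \<dots>, y (b + n)\<close>.\<close>

definition block_autocov :: "(real \<Rightarrow> real) \<Rightarrow> (nat \<Rightarrow> real) \<Rightarrow> nat \<Rightarrow> nat \<Rightarrow> nat \<Rightarrow> real" where
  "block_autocov h y b n k =
    (\<Sum>s<n-k. h (real s / real n) * h (real (s + k) / real n) * (y (b + s + 1) * y (b + s + 1 + k)))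
      / (\<Sum>s<n. (h (real s / real n))\<^sup>2)"

text \<open>The floor of u_j T is S (j - 1) + N div 2, the half unit of an odd N being lost there;
  subtracting N div 2 lands exactly on the start of the block.\<close>

lemma tapered_dft_block:
  assumes "T \<ge> 1" "j \<ge> 1"
  shows "tapered_dft h y T n (block_midpoint T n S j) x
    = (\<Sum>s<n. of_real (h (real s / real n) * y (S * (j - 1) + s + 1)) * exp (- \<i> * of_real (x * real s)))"
proof -
  have "block_midpoint T n S j * real T = real S * (real j - 1) + real n / 2"
    using assms by (simp add: block_midpoint_def)
  also have "\<dots> = of_int (int (S * (j - 1))) + real n / 2"
    using assms(2) by (simp add: of_nat_diff)
  finally have "\<lfloor>block_midpoint T n S j * real T\<rfloor> = int (S * (j - 1)) + \<lfloor>real n / 2\<rfloor>"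
    by (simp only: int_add_floor[symmetric])
  moreover have "\<lfloor>real n / 2\<rfloor> = int (n div 2)"
    using floor_divide_of_nat_eq[of n 2, where 'a = real] by simp
  ultimately have "\<lfloor>block_midpoint T n S j * real T\<rfloor> = int (S * (j - 1)) + int (n div 2)"
    by simp
  then have "\<lfloor>block_midpoint T n S j * real T\<rfloor> - int (n div 2) + int s + 1 = int (S * (j - 1) + s + 1)" for s
    by simp
  then have "nat (\<lfloor>block_midpoint T n S j * real T\<rfloor> - int (n div 2) + int s + 1) = S * (j - 1) + s + 1" for s
    by (simp only: nat_int)
  then show ?thesis by (simp add: tapered_dft_def)
qed

lemma taper_sum_2: "Re (taper_sum h 2 n 0) = (\<Sum>s<n. (h (real s / real n))\<^sup>2)"
  by (simp add: taper_sum_def)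

lemma periodogram_continuous: "continuous_on X (\<lambda>x. tapered_periodogram h y T n u x)"
  unfolding tapered_periodogram_def tapered_dft_def divide_inverse
  by (intro continuous_intros)

lemma periodogram_nonneg: "0 \<le> tapered_periodogram h y T n u x"
  by (simp add: tapered_periodogram_def taper_sum_2 sum_nonneg)

text \<open>The 2 pi in the periodogram cancels that of the orthogonality relations, which matches
  the normalisation of \<open>autocov\<close>.\<close>

lemma integral_tapered_periodogram_cos:
  assumes "T \<ge> 1" "j \<ge> 1"
  shows "(LINT x|freq. tapered_periodogram h y T n (block_midpoint T n S j) x * cos (real k * x))
    = block_autocov h y (S * (j - 1)) n k"
proof -
  define a where "a s = h (real s / real n) * y (S * (j - 1) + s + 1)" for s
  define H where "H = (\<Sum>s<n. (h (real s / real n))\<^sup>2)"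
  have "(LINT x|freq. tapered_periodogram h y T n (block_midpoint T n S j) x * cos (real k * x))
    = (LINT x|freq. ((cmod (\<Sum>s<n. of_real (a s) * exp (- \<i> * of_real (x * real s))))\<^sup>2 * cos (real k * x)) / (2 * pi * H))"
    by (simp only: tapered_periodogram_def tapered_dft_block[OF assms] taper_sum_2 a_def H_def times_divide_eq_left)
  also have "\<dots> = (2 * pi * (\<Sum>s<n-k. a s * a (s + k))) / (2 * pi * H)"
    by (simp only: integral_divide_zero integral_periodogram_cos)
  also have "\<dots> = (\<Sum>s<n-k. a s * a (s + k)) / H" by simp
  also have "\<dots> = block_autocov h y (S * (j - 1)) n k"
    by (simp add: block_autocov_def a_def H_def mult_ac add_ac)
  finally show ?thesis .
qed


section \<open>Taper weights and the error within one block\<close>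

text \<open>Against the normalising sum of squares two things are off: h is evaluated at a shift by
  k/n, which costs the Lipschitz constant, and the last k squares are missing. Both are of order
  k/n, while each weight is of order 1/n.\<close>

lemma weighted_autocov_bound:
  assumes h: "0 < l" "\<And>x. x \<in> {0..1} \<Longrightarrow> l \<le> h x \<and> h x \<le> b" "0 \<le> L"
    "\<And>x y. x \<in> {0..1} \<Longrightarrow> y \<in> {0..1} \<Longrightarrow> \<bar>h x - h y\<bar> \<le> L * \<bar>x - y\<bar>"
    and n: "n \<ge> 1" "k \<le> n"
  defines "w \<equiv> \<lambda>s. h (real s / real n) * h (real (s + k) / real n) / (\<Sum>s<n. (h (real s / real n))\<^sup>2)"
  shows "\<And>s. s < n - k \<Longrightarrow> 0 \<le> w s \<and> w s \<le> b\<^sup>2 / l\<^sup>2 / real n"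
    and "\<bar>(\<Sum>s<n-k. w s) - 1\<bar> \<le> (b * L * real k + b\<^sup>2 * real k) / l\<^sup>2 / real n"
proof -
  define H where "H = (\<Sum>s<n. (h (real s / real n))\<^sup>2)"
  have u: "real s / real n \<in> {0..1}" if "s \<le> n" for s using that n by (simp add: divide_le_eq)
  have hb: "l \<le> h (real s / real n)" "h (real s / real n) \<le> b" "0 < h (real s / real n)" if "s \<le> n" for s
    using h(2)[OF u[OF that]] h(1) by auto
  have b0: "0 < b" using hb[of 0] h(1) by simp
  have "real n * l\<^sup>2 = (\<Sum>s<n. l\<^sup>2)" by simp
  also have "\<dots> \<le> H" unfolding H_def by (intro sum_mono power_mono hb) (use h(1) in auto)
  finally have H: "real n * l\<^sup>2 \<le> H" .
  have nl: "0 < real n * l\<^sup>2" using n h(1) by simp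
  then have H0: "H > 0" using H by linarith
  show "0 \<le> w s \<and> w s \<le> b\<^sup>2 / l\<^sup>2 / real n" if s: "s < n - k" for s
  proof
    have le: "s \<le> n" "s + k \<le> n" using s by auto
    show "0 \<le> w s" unfolding w_def H_def[symmetric]
      using H0 hb[OF le(1)] hb[OF le(2)] by (intro divide_nonneg_pos mult_nonneg_nonneg) auto
    have "w s \<le> b\<^sup>2 / (real n * l\<^sup>2)" unfolding w_def H_def[symmetric] power2_eq_square[of b]
      using H nl hb[OF le(1)] hb[OF le(2)] b0 by (intro frac_le mult_mono) auto
    then show "w s \<le> b\<^sup>2 / l\<^sup>2 / real n" by (simp add: mult.commute)
  qed
  have split: "H = (\<Sum>s<n-k. (h (real s / real n))\<^sup>2) + (\<Sum>s\<in>{n-k..<n}. (h (real s / real n))\<^sup>2)"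
    unfolding H_def using n by (subst sum.union_disjoint[symmetric]) (auto intro!: sum.cong)
  have "(\<Sum>s<n-k. w s) = (\<Sum>s<n-k. h (real s / real n) * h (real (s + k) / real n)) / H"
    by (simp add: w_def sum_divide_distrib H_def)
  then have "(\<Sum>s<n-k. w s) - 1 = ((\<Sum>s<n-k. h (real s / real n) * h (real (s + k) / real n)) - H) / H"
    using H0 by (simp add: diff_divide_distrib)
  also have "\<bar>\<dots>\<bar> = \<bar>(\<Sum>s<n-k. h (real s / real n) * h (real (s + k) / real n)) - H\<bar> / H"
    using H0 by simp
  also have "\<bar>(\<Sum>s<n-k. h (real s / real n) * h (real (s + k) / real n)) - H\<bar>
     \<le> b * L * real k + b\<^sup>2 * real k"
  proof -
    have "(\<Sum>s<n-k. h (real s / real n) * h (real (s + k) / real n)) - H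
      = (\<Sum>s<n-k. h (real s / real n) * (h (real (s + k) / real n) - h (real s / real n)))
        - (\<Sum>s\<in>{n-k..<n}. (h (real s / real n))\<^sup>2)"
      unfolding split by (simp add: right_diff_distrib sum_subtractf power2_eq_square)
    moreover have "\<bar>\<Sum>s<n-k. h (real s / real n) * (h (real (s + k) / real n) - h (real s / real n))\<bar>
        \<le> (\<Sum>s<n-k. b * (L * (real k / real n)))"
    proof (rule order_trans[OF sum_abs sum_mono])
      fix s assume "s \<in> {..<n-k}"
      then have le: "s \<le> n" "s + k \<le> n" by auto
      have "\<bar>h (real (s + k) / real n) - h (real s / real n)\<bar> \<le> L * (real k / real n)"
        using h(4)[OF u[OF le(2)] u[OF le(1)]] by (simp add: add_divide_distrib)
      then show "\<bar>h (real s / real n) * (h (real (s + k) / real n) - h (real s / real n))\<bar> \<le> b * (L * (real k / real n))"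
        unfolding abs_mult using hb[OF le(1)] b0 by (intro mult_mono) auto
    qed
    moreover have "(\<Sum>s<n-k. b * (L * (real k / real n))) \<le> b * L * real k"
    proof -
      have "(\<Sum>s<n-k. b * (L * (real k / real n))) \<le> (\<Sum>s<n. b * (L * (real k / real n)))"
        using b0 h(3) by (intro sum_mono2) auto
      also have "\<dots> = b * L * real k" using n by simp
      finally show ?thesis .
    qed
    moreover have "(\<Sum>s\<in>{n-k..<n}. (h (real s / real n))\<^sup>2) \<le> (\<Sum>s\<in>{n-k..<n}. b\<^sup>2)"
      by (intro sum_mono power_mono hb) (use hb(3) in \<open>auto intro: less_imp_le\<close>)
    moreover have "(\<Sum>s\<in>{n-k..<n}. b\<^sup>2) = b\<^sup>2 * real k" using n by simp
    moreover have "0 \<le> (\<Sum>s\<in>{n-k..<n}. (h (real s / real n))\<^sup>2)" by (simp add: sum_nonneg)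
    ultimately show ?thesis by linarith
  qed
  also have "(b * L * real k + b\<^sup>2 * real k) / H \<le> (b * L * real k + b\<^sup>2 * real k) / (real n * l\<^sup>2)"
    using H nl b0 h(3) by (intro divide_left_mono) auto
  finally show "\<bar>(\<Sum>s<n-k. w s) - 1\<bar> \<le> (b * L * real k + b\<^sup>2 * real k) / l\<^sup>2 / real n"
    using H0 by (simp add: divide_right_mono mult.commute)
qed

text \<open>In each row fewer than 2 m entries lie near the diagonal and take the crude bound; all
  others are small. After division by n^2 only e^2 survives as n grows.\<close>

lemma sum_squares_banded_le:
  fixes r :: "nat \<Rightarrow> nat \<Rightarrow> real"
  assumes "\<And>i j. i < n \<Longrightarrow> j < n \<Longrightarrow> \<bar>r i j\<bar> \<le> a"
    and "\<And>i j. i < n \<Longrightarrow> j < n \<Longrightarrow> i + m \<le> j \<or> j + m \<le> i \<Longrightarrow> \<bar>r i j\<bar> \<le> e"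
  shows "(\<Sum>i<n. \<Sum>j<n. (r i j)\<^sup>2) \<le> (real n)\<^sup>2 * e\<^sup>2 + real n * (2 * real m * a\<^sup>2)"
proof -
  have "(\<Sum>j<n. (r i j)\<^sup>2) \<le> real n * e\<^sup>2 + 2 * real m * a\<^sup>2" if i: "i < n" for i
  proof -
    let ?N = "{j\<in>{..<n}. \<not> (i + m \<le> j \<or> j + m \<le> i)}"
    have "(\<Sum>j<n. (r i j)\<^sup>2) \<le> (\<Sum>j<n. e\<^sup>2 + (if j \<in> ?N then a\<^sup>2 else 0))"
    proof (rule sum_mono)
      fix j assume j: "j \<in> {..<n}"
      have sq: "(r i j)\<^sup>2 \<le> z\<^sup>2" if "\<bar>r i j\<bar> \<le> z" for z
        using power_mono[OF that, of 2] by simp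
      show "(r i j)\<^sup>2 \<le> e\<^sup>2 + (if j \<in> ?N then a\<^sup>2 else 0)"
        using sq[OF assms(1)[of i j]] sq[OF assms(2)[of i j]] i j by (auto simp: add_increasing)
    qed
    also have "\<dots> = real n * e\<^sup>2 + real (card ?N) * a\<^sup>2"
      by (simp add: sum.distrib flip: sum.inter_filter)
    \<comment> \<open>Truncation of i - m at 0 only shortens the interval.\<close>
    also have "card ?N \<le> card {i - m..<i + m}"
      by (intro card_mono) auto
    also have "\<dots> \<le> 2 * m" by simp
    finally show ?thesis
      by (simp add: mult_right_mono)
  qed
  then have "(\<Sum>i<n. \<Sum>j<n. (r i j)\<^sup>2) \<le> (\<Sum>i<n. real n * e\<^sup>2 + 2 * real m * a\<^sup>2)"
    by (intro sum_mono) auto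
  also have "\<dots> = (real n)\<^sup>2 * e\<^sup>2 + real n * (2 * real m * a\<^sup>2)"
    by (simp add: power2_eq_square algebra_simps)
  finally show ?thesis .
qed

context locally_stationary
begin

lemma autocov_even: "c u (- k) = c u k"
  by (simp add: autocov_def)

lemma block_autocov_integrable:
  assumes T: "T \<ge> 1" "b + n \<le> T"
  shows "integrable P (\<lambda>\<omega>. block_autocov h (\<lambda>t. Y T t \<omega>) b n k)"
  unfolding block_autocov_def
proof (intro integrable_divide Bochner_Integration.integrable_sum integrable_mult_right)
  fix s assume "s \<in> {..<n-k}"
  then show "integrable P (\<lambda>\<omega>. Y T (b + s + 1) \<omega> * Y T (b + s + 1 + k) \<omega>)"
    using T by (intro L2_mult_integrable Y_L2) auto
qed

text \<open>Fluctuation plus bias. The fluctuation is bounded by the root mean square of the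
  covariances in the block; the bias comes from non-stationarity (e) and from the weights not
  summing to 1 (the term with k / n).\<close>

lemma block_autocov_error:
  assumes h: "0 < l" "\<And>x. x \<in> {0..1} \<Longrightarrow> l \<le> h x \<and> h x \<le> q" "0 \<le> L"
    "\<And>x y. x \<in> {0..1} \<Longrightarrow> y \<in> {0..1} \<Longrightarrow> \<bar>h x - h y\<bar> \<le> L * \<bar>x - y\<bar>"
    and T: "T \<ge> 1" "b + n \<le> T" and n: "n \<ge> 1" "k \<le> n"
    and e: "e \<ge> 0" and F: "\<And>k. \<bar>c u k\<bar> \<le> F"
    and cov: "\<And>i j. i < n \<Longrightarrow> j < n \<Longrightarrow>
      \<bar>expectation (\<lambda>\<omega>. Y T (b + i + 1) \<omega> * Y T (b + j + 1) \<omega>) - c u (real i - real j)\<bar> \<le> e"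
    and m: "\<And>k. k \<ge> m \<Longrightarrow> \<bar>c u (real k)\<bar> \<le> e"
  shows "expectation (\<lambda>\<omega>. \<bar>block_autocov h (\<lambda>t. Y T t \<omega>) b n k - c u (real k)\<bar>)
    \<le> q\<^sup>2 / l\<^sup>2 * (3 * sqrt ((2 * e)\<^sup>2 + 2 * real m * (F + e)\<^sup>2 / real n) + e)
      + F * ((q * L * real k + q\<^sup>2 * real k) / l\<^sup>2 / real n)"
proof -
  define R where "R = q\<^sup>2 / l\<^sup>2"
  define w where "w s = h (real s / real n) * h (real (s + k) / real n) / (\<Sum>s<n. (h (real s / real n))\<^sup>2)" for s
  have w: "0 \<le> w s" "w s \<le> R / real n" if "s < n - k" for s
    using weighted_autocov_bound(1)[OF h n that] by (auto simp: w_def R_def)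
  have w1: "\<bar>(\<Sum>s<n-k. w s) - 1\<bar> \<le> (q * L * real k + q\<^sup>2 * real k) / l\<^sup>2 / real n"
    using weighted_autocov_bound(2)[OF h n] by (simp add: w_def)
  have F0: "F \<ge> 0" using F[of 0] by linarith
  have R0: "R \<ge> 0" by (simp add: R_def)
  define X where "X i = Y T (b + i + 1)" for i
  define r where "r i j = expectation (\<lambda>\<omega>. X i \<omega> * X j \<omega>)" for i j
  have rc: "\<bar>r i j - c u (real i - real j)\<bar> \<le> e" if "i < n" "j < n" for i j
    using cov[OF that] by (simp add: r_def X_def)
  have r1: "\<bar>r i j\<bar> \<le> F + e" if "i < n" "j < n" for i j
    using rc[OF that] F[of "real i - real j"] by linarith
  \<comment> \<open>One e for replacing the true covariance by the stationary one, one for the decay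
    of the latter.\<close>
  have r2: "\<bar>r i j\<bar> \<le> 2 * e" if "i < n" "j < n" and far: "i + m \<le> j \<or> j + m \<le> i" for i j
  proof -
    have "\<bar>c u (real i - real j)\<bar> \<le> e"
    proof (cases "i + m \<le> j")
      case True
      then show ?thesis using m[of "j - i"] autocov_even[of u "real j - real i"] by (simp add: of_nat_diff)
    next
      case False
      then show ?thesis using far m[of "i - j"] by (simp add: of_nat_diff)
    qed
    then show ?thesis using rc[OF that(1,2)] by linarith
  qed
  have S: "(\<Sum>i<n. \<Sum>j<n. (r i j)\<^sup>2) \<le> (real n)\<^sup>2 * (2 * e)\<^sup>2 + real n * (2 * real m * (F + e)\<^sup>2)"
    by (rule sum_squares_banded_le[OF r1 r2])
  have Xi: "has_stochastic_integral P B (\<lambda>x. A0 T (b + i + 1) x * exp (\<i> * of_real (x * real (b + i + 1)))) (\<lambda>\<omega>. of_real (X i \<omega>))"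
    if "i < n - k + k" for i
    unfolding X_def using that n T by (intro Y_integral) auto
  have "expectation (\<lambda>\<omega>. \<bar>\<Sum>i<n-k. w i * (X i \<omega> * X (i + k) \<omega> - r i (i + k))\<bar>)
    \<le> 3 * (R / real n) * sqrt (\<Sum>i<n-k+k. \<Sum>j<n-k+k. (r i j)\<^sup>2)"
    unfolding r_def
    by (rule real_stochastic_integral_autocovariance_le[OF Xi]) (use w R0 in auto)
  also have "\<dots> = 3 * R * (sqrt (\<Sum>i<n. \<Sum>j<n. (r i j)\<^sup>2) / real n)"
    using n by simp
  also have "sqrt (\<Sum>i<n. \<Sum>j<n. (r i j)\<^sup>2) / real n = sqrt ((\<Sum>i<n. \<Sum>j<n. (r i j)\<^sup>2) / (real n)\<^sup>2)"
    by (simp add: real_sqrt_divide)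
  also have "\<dots> \<le> sqrt ((2 * e)\<^sup>2 + 2 * real m * (F + e)\<^sup>2 / real n)"
  proof (rule real_sqrt_le_mono)
    have "(\<Sum>i<n. \<Sum>j<n. (r i j)\<^sup>2) / (real n)\<^sup>2
        \<le> ((real n)\<^sup>2 * (2 * e)\<^sup>2 + real n * (2 * real m * (F + e)\<^sup>2)) / (real n)\<^sup>2"
      by (rule divide_right_mono[OF S]) simp
    also have "\<dots> = (2 * e)\<^sup>2 + 2 * real m * (F + e)\<^sup>2 / real n"
      using n by (simp add: add_divide_distrib power2_eq_square)
    finally show "(\<Sum>i<n. \<Sum>j<n. (r i j)\<^sup>2) / (real n)\<^sup>2 \<le> (2 * e)\<^sup>2 + 2 * real m * (F + e)\<^sup>2 / real n" .
  qed
  finally have fluct: "expectation (\<lambda>\<omega>. \<bar>\<Sum>i<n-k. w i * (X i \<omega> * X (i + k) \<omega> - r i (i + k))\<bar>)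
    \<le> 3 * R * sqrt ((2 * e)\<^sup>2 + 2 * real m * (F + e)\<^sup>2 / real n)"
    using R0 by (simp add: mult_left_mono)
  \<comment> \<open>The deterministic bias, split below into covariance error and weight
    defect.\<close>
  define \<mu> where "\<mu> = (\<Sum>i<n-k. w i * r i (i + k)) - c u (real k)"
  have "\<mu> = (\<Sum>i<n-k. w i * (r i (i + k) - c u (real k))) + ((\<Sum>i<n-k. w i) - 1) * c u (real k)"
    by (simp add: \<mu>_def right_diff_distrib left_diff_distrib sum_subtractf sum_distrib_right)
  moreover have "\<bar>\<Sum>i<n-k. w i * (r i (i + k) - c u (real k))\<bar> \<le> (\<Sum>i<n-k. R / real n * e)"
  proof (rule order_trans[OF sum_abs sum_mono])
    fix i assume i: "i \<in> {..<n-k}"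
    have "\<bar>r i (i + k) - c u (real k)\<bar> \<le> e"
      using rc[of i "i + k"] i autocov_even[of u "real k"] by simp
    then show "\<bar>w i * (r i (i + k) - c u (real k))\<bar> \<le> R / real n * e"
      unfolding abs_mult using w[of i] i e R0 by (intro mult_mono) auto
  qed
  moreover have "(\<Sum>i<n-k. R / real n * e) \<le> R * e"
  proof -
    have "(\<Sum>i<n-k. R / real n * e) = real (n - k) / real n * (R * e)" by simp
    also have "\<dots> \<le> 1 * (R * e)"
      using n R0 e by (intro mult_right_mono) auto
    finally show ?thesis by simp
  qed
  moreover have "\<bar>((\<Sum>i<n-k. w i) - 1) * c u (real k)\<bar> \<le> (q * L * real k + q\<^sup>2 * real k) / l\<^sup>2 / real n * F"
    unfolding abs_mult by (rule mult_mono[OF w1 F]) (use w1 in auto)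
  ultimately have mean: "\<bar>\<mu>\<bar> \<le> R * e + F * ((q * L * real k + q\<^sup>2 * real k) / l\<^sup>2 / real n)"
    by (simp only: mult.commute[of F]) linarith
  have XX: "integrable P (\<lambda>\<omega>. X i \<omega> * X (i + k) \<omega>)" if "i < n - k" for i
    unfolding X_def using that T by (intro L2_mult_integrable Y_L2) auto
  have iS: "integrable P (\<lambda>\<omega>. \<bar>\<Sum>i<n-k. w i * (X i \<omega> * X (i + k) \<omega> - r i (i + k))\<bar>)"
    using XX by (intro integrable_abs Bochner_Integration.integrable_sum integrable_mult_right Bochner_Integration.integrable_diff) auto
  have dec: "block_autocov h (\<lambda>t. Y T t \<omega>) b n k - c u (real k)
      = (\<Sum>i<n-k. w i * (X i \<omega> * X (i + k) \<omega> - r i (i + k))) + \<mu>" for \<omega>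
    by (simp add: block_autocov_def \<mu>_def w_def X_def right_diff_distrib sum_subtractf sum_divide_distrib add_ac)
  have "expectation (\<lambda>\<omega>. \<bar>block_autocov h (\<lambda>t. Y T t \<omega>) b n k - c u (real k)\<bar>)
    \<le> expectation (\<lambda>\<omega>. \<bar>\<Sum>i<n-k. w i * (X i \<omega> * X (i + k) \<omega> - r i (i + k))\<bar> + \<bar>\<mu>\<bar>)"
  proof (rule integral_mono)
    show "integrable P (\<lambda>\<omega>. \<bar>block_autocov h (\<lambda>t. Y T t \<omega>) b n k - c u (real k)\<bar>)"
      by (intro integrable_abs Bochner_Integration.integrable_diff block_autocov_integrable T) simp
  qed (use iS dec in auto)
  also have "\<dots> = expectation (\<lambda>\<omega>. \<bar>\<Sum>i<n-k. w i * (X i \<omega> * X (i + k) \<omega> - r i (i + k))\<bar>) + \<bar>\<mu>\<bar>"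
    using iS by (simp add: prob_space)
  also have "\<dots> \<le> 3 * R * sqrt ((2 * e)\<^sup>2 + 2 * real m * (F + e)\<^sup>2 / real n)
     + (R * e + F * ((q * L * real k + q\<^sup>2 * real k) / l\<^sup>2 / real n))"
    using fluct mean by (rule add_mono)
  finally show ?thesis
    by (simp add: R_def algebra_simps)
qed

text \<open>The thresholds depend on the lag k but not on the position of the block or on u, which
  permits averaging over arbitrarily many blocks.\<close>

lemma block_autocov_consistent:
  assumes h: "assumption_A2 h" and \<epsilon>: "\<epsilon> > 0"
  obtains \<delta> n0 T0 where "\<delta> > 0" "T0 \<ge> 1"
    "\<And>T b n u. T \<ge> T0 \<Longrightarrow> n \<ge> n0 \<Longrightarrow> b + n \<le> T \<Longrightarrow> u \<in> {0<..1} \<Longrightarrow>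
      (\<And>t. t \<in> {b+1..b+n} \<Longrightarrow> \<bar>real t / real T - u\<bar> < \<delta>) \<Longrightarrow>
      expectation (\<lambda>\<omega>. \<bar>block_autocov h (\<lambda>t. Y T t \<omega>) b n k - c u (real k)\<bar>) \<le> \<epsilon>"
proof -
  obtain l q L where hb: "0 < l" "\<And>x. x \<in> {0..1} \<Longrightarrow> l \<le> h x \<and> h x \<le> q" "0 \<le> L"
    "\<And>x y. x \<in> {0..1} \<Longrightarrow> y \<in> {0..1} \<Longrightarrow> \<bar>h x - h y\<bar> \<le> L * \<bar>x - y\<bar>"
    using taper_bounds[OF h] by blast
  obtain F where F: "F \<ge> 0" "\<And>u k. u \<in> {0<..1} \<Longrightarrow> \<bar>c u k\<bar> \<le> F" using A_bound by metis
  define R where "R = q\<^sup>2 / l\<^sup>2"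
  have R0: "R \<ge> 0" by (simp add: R_def)
  \<comment> \<open>This expression is the limit of the block error as n grows, since the root of (2
    e)^2 is 2 e. e is fixed first, then m, and n0 last, because m enters through m / n.\<close>
  have "((\<lambda>e. R * (3 * (2 * e) + e)) \<longlongrightarrow> R * (3 * (2 * 0) + 0)) (at_right 0)"
    by (intro tendsto_intros)
  then have "eventually (\<lambda>e. R * (3 * (2 * e) + e) < \<epsilon>) (at_right 0)"
    using \<epsilon> by (intro order_tendstoD(2)) auto
  moreover have "eventually (\<lambda>e. e > 0) (at_right (0::real))" by (rule eventually_at_right_less)
  ultimately have "eventually (\<lambda>e. R * (3 * (2 * e) + e) < \<epsilon> \<and> e > 0) (at_right 0)"
    by (rule eventually_conj)
  then obtain e where e: "R * (3 * (2 * e) + e) < \<epsilon>" "e > 0"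
    using eventually_happens[of _ "at_right (0::real)"] by auto
  obtain m where m: "\<And>u k. u \<in> {0<..1} \<Longrightarrow> k \<ge> m \<Longrightarrow> \<bar>c u (real k)\<bar> < e"
    using autocov_uniform_decay[OF e(2)] by blast
  obtain \<delta> T0 where \<delta>: "\<delta> > 0" "T0 \<ge> 1"
    "\<And>T s t u. T \<ge> T0 \<Longrightarrow> s \<in> {1..T} \<Longrightarrow> t \<in> {1..T} \<Longrightarrow> u \<in> {0<..1} \<Longrightarrow>
      \<bar>real s / real T - u\<bar> < \<delta> \<Longrightarrow> \<bar>real t / real T - u\<bar> < \<delta> \<Longrightarrow>
      \<bar>expectation (\<lambda>\<omega>. Y T s \<omega> * Y T t \<omega>) - c u (real s - real t)\<bar> < e"
    using covariance_approximation[OF e(2)] by blast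
  have inv: "(\<lambda>n. a / real n) \<longlonglongrightarrow> 0" for a
    using tendsto_mult[OF tendsto_const lim_1_over_n, of a] by simp
  have "(\<lambda>n. R * (3 * sqrt ((2 * e)\<^sup>2 + 2 * real m * (F + e)\<^sup>2 / real n) + e)
      + F * ((q * L * real k + q\<^sup>2 * real k) / l\<^sup>2 / real n)) \<longlonglongrightarrow> R * (3 * sqrt ((2 * e)\<^sup>2 + 0) + e) + F * 0"
    by (intro tendsto_intros inv)
  then have "eventually (\<lambda>n. R * (3 * sqrt ((2 * e)\<^sup>2 + 2 * real m * (F + e)\<^sup>2 / real n) + e)
      + F * ((q * L * real k + q\<^sup>2 * real k) / l\<^sup>2 / real n) < \<epsilon>) sequentially"
  proof (rule order_tendstoD(2))
    have "sqrt ((2 * e)\<^sup>2 + 0) = 2 * e" using e(2) real_sqrt_abs[of "2 * e"] by simp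
    then show "R * (3 * sqrt ((2 * e)\<^sup>2 + 0) + e) + F * 0 < \<epsilon>" using e(1) by (simp only: mult_zero_right add_0_right)
  qed
  then obtain n0 where n0: "\<And>n. n \<ge> n0 \<Longrightarrow> R * (3 * sqrt ((2 * e)\<^sup>2 + 2 * real m * (F + e)\<^sup>2 / real n) + e)
      + F * ((q * L * real k + q\<^sup>2 * real k) / l\<^sup>2 / real n) < \<epsilon>"
    unfolding eventually_sequentially by blast
  show thesis
  \<comment> \<open>The block error requires n \<ge> 1 and k \<le> n.\<close>
  proof (rule that[of \<delta> T0 "max n0 (max 1 k)"])
    fix T b n u
    assume T: "T \<ge> T0" and n: "n \<ge> max n0 (max 1 k)" and bn: "b + n \<le> T" and u: "u \<in> {0<..1::real}"
      and close: "\<And>t. t \<in> {b+1..b+n} \<Longrightarrow> \<bar>real t / real T - u\<bar> < \<delta>"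
    have "expectation (\<lambda>\<omega>. \<bar>block_autocov h (\<lambda>t. Y T t \<omega>) b n k - c u (real k)\<bar>)
      \<le> q\<^sup>2 / l\<^sup>2 * (3 * sqrt ((2 * e)\<^sup>2 + 2 * real m * (F + e)\<^sup>2 / real n) + e)
      + F * ((q * L * real k + q\<^sup>2 * real k) / l\<^sup>2 / real n)"
    proof (rule block_autocov_error[OF hb])
      fix i j assume ij: "i < n" "j < n"
      have "\<bar>expectation (\<lambda>\<omega>. Y T (b + i + 1) \<omega> * Y T (b + j + 1) \<omega>) - c u (real (b + i + 1) - real (b + j + 1))\<bar> < e"
        using ij bn by (intro \<delta>(3)[OF T _ _ u] close) auto
      then show "\<bar>expectation (\<lambda>\<omega>. Y T (b + i + 1) \<omega> * Y T (b + j + 1) \<omega>) - c u (real i - real j)\<bar> \<le> e"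
        by simp
    qed (use T \<delta>(2) n bn e F u m in \<open>auto intro: less_imp_le\<close>)
    then show "expectation (\<lambda>\<omega>. \<bar>block_autocov h (\<lambda>t. Y T t \<omega>) b n k - c u (real k)\<bar>) \<le> \<epsilon>"
      using n0[of n] n by (simp add: R_def)
  qed (use \<delta> in auto)
qed

end

section \<open>Cosine polynomials\<close>

text \<open>Cosine polynomials suffice, because the spectral densities are even in the frequency; on
  \<open>[0, pi]\<close> they separate points.\<close>

inductive_set cosine_polynomials :: "'p::euclidean_space set \<Rightarrow> ('p \<times> real \<times> real \<Rightarrow> real) set"
  for \<Theta> :: "'p set" where
  monomial: "continuous_on \<Theta> p \<Longrightarrow> continuous_on {0..1} q \<Longrightarrow>
    (\<lambda>(\<theta>, u, x). p \<theta> * q u * cos (real k * x)) \<in> cosine_polynomials \<Theta>"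
| add: "G \<in> cosine_polynomials \<Theta> \<Longrightarrow> G' \<in> cosine_polynomials \<Theta> \<Longrightarrow>
    (\<lambda>z. G z + G' z) \<in> cosine_polynomials \<Theta>"

lemma cosine_polynomials_const: "(\<lambda>_. a) \<in> cosine_polynomials \<Theta>"
  using cosine_polynomials.monomial[of \<Theta> "\<lambda>_. a" "\<lambda>_. 1" 0] by (simp add: case_prod_unfold)

lemma cosine_polynomials_even:
  "G \<in> cosine_polynomials \<Theta> \<Longrightarrow> G (\<theta>, u, - x) = G (\<theta>, u, x)"
  by (induction rule: cosine_polynomials.induct) auto

lemma cosine_polynomials_continuous_x:
  "G \<in> cosine_polynomials \<Theta> \<Longrightarrow> continuous_on X (\<lambda>x. G (\<theta>, u, x))"
  by (induction rule: cosine_polynomials.induct) (auto intro!: continuous_intros)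

lemma cosine_polynomials_continuous:
  assumes "G \<in> cosine_polynomials \<Theta>"
  shows "continuous_on (\<Theta> \<times> {0..1} \<times> X) G"
  using assms
proof induction
  case (monomial p q k)
  have "continuous_on (\<Theta> \<times> {0..1} \<times> X) (\<lambda>z. p (fst z))"
    by (rule continuous_on_compose2[OF monomial(1)]) (auto intro!: continuous_intros)
  moreover have "continuous_on (\<Theta> \<times> {0..1} \<times> X) (\<lambda>z. q (fst (snd z)))"
    by (rule continuous_on_compose2[OF monomial(2)]) (auto intro!: continuous_intros)
  ultimately show ?case
    by (auto simp: case_prod_unfold intro!: continuous_intros)
qed (intro continuous_intros)

text \<open>Closed by the product-to-sum formula; frequencies stay natural numbers since cosine is
  even and |k - l| can be used.\<close>

lemma cosine_polynomials_mult:
  assumes "G \<in> cosine_polynomials \<Theta>" "G' \<in> cosine_polynomials \<Theta>"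
  shows "(\<lambda>z. G z * G' z) \<in> cosine_polynomials \<Theta>"
  using assms(1)
proof induction
  case (monomial p q k)
  note m1 = monomial
  show ?case
    using assms(2)
  proof induction
    case (monomial p' q' l)
    have "cos (real k * x) * cos (real l * x)
      = (1/2) * cos (real (k + l) * x) + (1/2) * cos (real (if k \<le> l then l - k else k - l) * x)" for x
    proof -
      have "cos (real (if k \<le> l then l - k else k - l) * x) = cos (real k * x - real l * x)"
        using cos_minus[of "real k * x - real l * x"] by (auto simp: of_nat_diff left_diff_distrib)
      then show ?thesis by (simp add: cos_times_cos distrib_right)
    qed
    then have "(\<lambda>z. (\<lambda>(\<theta>, u, x). p \<theta> * q u * cos (real k * x)) z * (\<lambda>(\<theta>, u, x). p' \<theta> * q' u * cos (real l * x)) z)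
      = (\<lambda>z. (\<lambda>(\<theta>, u, x). (1/2 * (p \<theta> * p' \<theta>)) * (q u * q' u) * cos (real (k + l) * x)) z
        + (\<lambda>(\<theta>, u, x). (1/2 * (p \<theta> * p' \<theta>)) * (q u * q' u) * cos (real (if k \<le> l then l - k else k - l) * x)) z)"
    proof -
      have "p \<theta> * q u * cos (real k * x) * (p' \<theta> * q' u * cos (real l * x))
        = (p \<theta> * p' \<theta>) * (q u * q' u) * (cos (real k * x) * cos (real l * x))" for \<theta> u x
        by (simp add: mult_ac)
      then show ?thesis
        unfolding \<open>\<And>x. cos (real k * x) * cos (real l * x) = _ x\<close>
        by (auto simp: fun_eq_iff algebra_simps)
    qed
    also have "\<dots> \<in> cosine_polynomials \<Theta>"
      using m1 monomial by (intro cosine_polynomials.add cosine_polynomials.monomial continuous_intros) auto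
    finally show ?case .
  next
    case (add G1 G2)
    then show ?case
      using cosine_polynomials.add[OF add.IH] by (simp add: distrib_left)
  qed
next
  case (add G1 G2)
  then show ?case
    using cosine_polynomials.add[OF add.IH] by (simp add: distrib_right)
qed

text \<open>Coordinates separate \<theta>, the identity separates u, and cos separates x because it
  is injective on [0, pi].\<close>

lemma function_ring_cosine_polynomials:
  assumes "compact \<Theta>"
  shows "function_ring_on (cosine_polynomials \<Theta>) (\<Theta> \<times> {0..1} \<times> {0..pi})"
proof
  show "compact (\<Theta> \<times> {0..1::real} \<times> {0..pi})" by (intro compact_Times assms compact_Icc)
  fix z z' :: "'a \<times> real \<times> real"
  assume z: "z \<in> \<Theta> \<times> {0..1} \<times> {0..pi}" "z' \<in> \<Theta> \<times> {0..1} \<times> {0..pi}" "z \<noteq> z'"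
  obtain \<theta> u x \<theta>' u' x' where e: "z = (\<theta>, u, x)" "z' = (\<theta>', u', x')" by (cases z, cases z') auto
  consider "\<theta> \<noteq> \<theta>'" | "u \<noteq> u'" | "x \<noteq> x'" using z e by auto
  then show "\<exists>G\<in>cosine_polynomials \<Theta>. G z \<noteq> G z'"
  proof cases
    case 1
    then obtain b where b: "\<theta> \<bullet> b \<noteq> \<theta>' \<bullet> b" using euclidean_eqI by metis
    have "(\<lambda>(\<theta>, u, x). (\<theta> \<bullet> b) * 1 * cos (real 0 * x)) \<in> cosine_polynomials \<Theta>"
      by (rule cosine_polynomials.monomial) (auto intro!: continuous_intros)
    then show ?thesis by (rule bexI[rotated]) (use b in \<open>simp add: e\<close>)
  next
    case 2
    have "(\<lambda>(\<theta>, u, x). 1 * u * cos (real 0 * x)) \<in> cosine_polynomials \<Theta>"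
      by (rule cosine_polynomials.monomial) (auto intro!: continuous_intros)
    then show ?thesis by (rule bexI[rotated]) (use 2 in \<open>simp add: e\<close>)
  next
    case 3
    have c: "cos x \<noteq> cos x'" using 3 z e cos_inj_pi[of x x'] by auto
    have "(\<lambda>(\<theta>, u, x). 1 * 1 * cos (real 1 * x)) \<in> cosine_polynomials \<Theta>"
      by (rule cosine_polynomials.monomial) (auto intro!: continuous_intros)
    then show ?thesis by (rule bexI[rotated]) (use c in \<open>simp add: e\<close>)
  qed
qed (auto intro: cosine_polynomials.add cosine_polynomials_mult cosine_polynomials_const cosine_polynomials_continuous)

lemma cosine_polynomial_approximation:
  assumes "compact \<Theta>" "continuous_on (\<Theta> \<times> {0..1} \<times> {0..pi}) F" "\<epsilon> > 0"
  obtains G where "G \<in> cosine_polynomials \<Theta>"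
    "\<And>z. z \<in> \<Theta> \<times> {0..1} \<times> {0..pi} \<Longrightarrow> \<bar>F z - G z\<bar> < \<epsilon>"
  using function_ring_on.Stone_Weierstrass_basic[OF function_ring_cosine_polynomials[OF assms(1)] assms(2,3)]
  by blast

section \<open>Uniform deviation of the Whittle function\<close>

text \<open>Meant for d = periodogram minus density and g = density. The negative part of d is at
  most g, so the L1 norm of d is bounded by its plain integral plus twice that of g.\<close>

lemma integral_weight_change_le:
  fixes d a b g :: "'a \<Rightarrow> real"
  assumes i: "integrable M (\<lambda>x. d x * a x)" "integrable M (\<lambda>x. d x * b x)" "integrable M d" "integrable M g"
    and ab: "AE x in M. \<bar>a x - b x\<bar> \<le> e" and dg: "\<And>x. \<bar>d x\<bar> \<le> d x + 2 * g x"
  shows "\<bar>(LINT x|M. d x * a x) - (LINT x|M. d x * b x)\<bar> \<le> e * (LINT x|M. d x) + 2 * e * (LINT x|M. g x)"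
proof -
  have "\<bar>(LINT x|M. d x * a x) - (LINT x|M. d x * b x)\<bar> = \<bar>LINT x|M. d x * a x - d x * b x\<bar>"
    using i by simp
  also have "\<dots> \<le> (LINT x|M. \<bar>d x * a x - d x * b x\<bar>)"
    by (rule integral_abs_bound)
  also have "\<dots> \<le> (LINT x|M. e * (d x + 2 * g x))"
  proof (rule integral_mono_AE)
    show "AE x in M. \<bar>d x * a x - d x * b x\<bar> \<le> e * (d x + 2 * g x)"
      using ab
    proof eventually_elim
      case (elim x)
      have "\<bar>d x\<bar> * \<bar>a x - b x\<bar> \<le> (d x + 2 * g x) * e"
        using dg[of x] by (intro mult_mono elim) auto
      moreover have "\<bar>d x * a x - d x * b x\<bar> = \<bar>d x\<bar> * \<bar>a x - b x\<bar>"
        by (simp only: abs_mult[symmetric] right_diff_distrib)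
      ultimately show ?case by (simp only: mult.commute[of e])
    qed
  qed (use i in auto)
  also have "\<dots> = e * (LINT x|M. d x) + 2 * e * (LINT x|M. g x)"
    using i by (simp add: distrib_left)
  finally show ?thesis .
qed

locale whittle_setting = locally_stationary \<Theta> A P B Y A0 K \<theta>0
  for \<Theta> :: "'p::euclidean_space set" and A and P :: "'w measure" and B Y A0 K \<theta>0 +
  fixes h :: "real \<Rightarrow> real" and N S M :: "nat \<Rightarrow> nat"
  assumes A2: "assumption_A2 h" and A3: "assumption_A3 N S M"
    and blocks: "\<And>T. T \<ge> 1 \<Longrightarrow> M T \<ge> 1 \<and> T = S T * (M T - 1) + N T"
begin

definition mid :: "nat \<Rightarrow> nat \<Rightarrow> real" where
  "mid T j = block_midpoint T (N T) (S T) j"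

definition I :: "nat \<Rightarrow> 'w \<Rightarrow> nat \<Rightarrow> real \<Rightarrow> real" where
  "I T \<omega> j x = tapered_periodogram h (\<lambda>t. Y T t \<omega>) T (N T) (mid T j) x"

text \<open>Linear in the weight \<open>G\<close>. With \<open>G\<close> = 1 / f it is the random
  part of 4 pi times the Whittle function; with a cosine polynomial it reduces to finitely many
  lags.\<close>

definition average_deviation :: "('p \<times> real \<times> real \<Rightarrow> real) \<Rightarrow> nat \<Rightarrow> 'w \<Rightarrow> 'p \<Rightarrow> real" where
  "average_deviation G T \<omega> \<theta> = (\<Sum>j=1..M T. LINT x|freq.
      (I T \<omega> j x - f \<theta>0 (mid T j) x) * G (\<theta>, mid T j, x)) / real (M T)"

abbreviation whittle_deviation :: "nat \<Rightarrow> 'w \<Rightarrow> 'p \<Rightarrow> real" where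
  "whittle_deviation \<equiv> average_deviation (\<lambda>(\<theta>, u, x). inverse (f \<theta> u x))"

abbreviation L :: "nat \<Rightarrow> 'w \<Rightarrow> 'p \<Rightarrow> real" where
  "L T \<omega> \<equiv> whittle_function h A (\<lambda>t. Y T t \<omega>) T (N T) (S T) (M T)"

section \<open>Geometry of the blocks and deviation of each cosine coefficient\<close>

text \<open>From N = 3 on, ln N \<ge> 1, so (N/T)^2 is below N^3 log^2 N / T^2.\<close>

lemma N_over_T: "(\<lambda>T. real (N T) / real T) \<longlonglongrightarrow> 0"
proof -
  have Nt: "filterlim N at_top sequentially" and
    l: "(\<lambda>T. real (N T) ^ 3 * (ln (real (N T)))\<^sup>2 / (real T)\<^sup>2) \<longlonglongrightarrow> 0"
    using A3 by (auto simp: assumption_A3_def)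
  have "eventually (\<lambda>T. N T \<ge> 3) sequentially"
    using Nt by (simp add: filterlim_at_top)
  then have "eventually (\<lambda>T. norm ((real (N T) / real T)\<^sup>2)
      \<le> real (N T) ^ 3 * (ln (real (N T)))\<^sup>2 / (real T)\<^sup>2) sequentially"
  proof eventually_elim
    case (elim T)
    have "1 \<le> ln (real (N T))"
      using elim e_less_272 by (subst ln_ge_iff) auto
    then have "1 * 1 \<le> real (N T) * (ln (real (N T)))\<^sup>2"
      using elim by (intro mult_mono) auto
    then have "(real (N T))\<^sup>2 * 1 \<le> (real (N T))\<^sup>2 * (real (N T) * (ln (real (N T)))\<^sup>2)"
      by (intro mult_left_mono) auto
    then show ?case
      by (simp add: power_divide divide_right_mono power2_eq_square power3_eq_cube mult_ac)
  qed
  from tendsto_real_sqrt[OF Lim_null_comparison[OF this l]] show ?thesis by simp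
qed

text \<open>N \<ge> 1 keeps the first midpoint strictly positive; the decomposition of T keeps the
  last block inside the row.\<close>

lemma mid_in:
  assumes "T \<ge> 1" "N T \<ge> 1" "j \<in> {1..M T}"
  shows "mid T j \<in> {0<..1}"
    and "\<And>t. t \<in> {S T * (j - 1) + 1..S T * (j - 1) + N T} \<Longrightarrow> \<bar>real t / real T - mid T j\<bar> \<le> real (N T) / real T"
    and "S T * (j - 1) + N T \<le> T"
proof -
  have j: "real j - 1 = real (j - 1)" using assms(3) by auto
  have m: "mid T j = (real (S T * (j - 1)) + real (N T) / 2) / real T"
    by (simp add: mid_def block_midpoint_def j)
  have "S T * (j - 1) \<le> S T * (M T - 1)" using assms(3) by (intro mult_le_mono2) auto
  then show le: "S T * (j - 1) + N T \<le> T" using blocks[OF assms(1)] by linarith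
  then have "real (S T * (j - 1)) + real (N T) \<le> real T" by (metis of_nat_add of_nat_le_iff)
  then show "mid T j \<in> {0<..1}" using assms unfolding m by (auto simp: add_nonneg_pos simp del: of_nat_mult)
  fix t assume "t \<in> {S T * (j - 1) + 1..S T * (j - 1) + N T}"
  then have "real (S T * (j - 1)) + 1 \<le> real t" "real t \<le> real (S T * (j - 1)) + real (N T)"
    unfolding atLeastAtMost_iff by (metis of_nat_1 of_nat_add of_nat_le_iff)+
  then have "\<bar>real t - (real (S T * (j - 1)) + real (N T) / 2)\<bar> \<le> real (N T)" by linarith
  moreover have "real t / real T - mid T j = (real t - (real (S T * (j - 1)) + real (N T) / 2)) / real T"
    unfolding m by (simp add: diff_divide_distrib)
  ultimately show "\<bar>real t / real T - mid T j\<bar> \<le> real (N T) / real T"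
    by (simp add: divide_right_mono)
qed

lemma I_nonneg: "I T \<omega> j x \<ge> 0"
  by (simp add: I_def periodogram_nonneg)

lemma integrable_continuous_mult:
  fixes g k :: "real \<Rightarrow> real"
  assumes "integrable freq g" "continuous_on UNIV k"
  shows "integrable freq (\<lambda>x. g x * k x)"
proof -
  have "compact (k ` {-pi..pi})"
    by (intro compact_continuous_image continuous_on_subset[OF assms(2)]) auto
  then obtain C where C: "\<And>x. x \<in> {-pi..pi} \<Longrightarrow> \<bar>k x\<bar> \<le> C"
    unfolding compact_eq_bounded_closed bounded_iff by fastforce
  have m: "k \<in> borel_measurable freq"
    by (intro borel_measurable_freq borel_measurable_continuous_onI assms)
  show ?thesis
  proof (rule Bochner_Integration.integrable_bound[where f = "\<lambda>x. C * g x"])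
    show "AE x in freq. norm (g x * k x) \<le> norm (C * g x)"
    proof (rule AE_I2)
      fix x assume "x \<in> space freq"
      then have "\<bar>k x\<bar> \<le> \<bar>C\<bar>" using C[of x] by (force simp: space_restrict_space)
      from mult_left_mono[OF this, of "\<bar>g x\<bar>"] show "norm (g x * k x) \<le> norm (C * g x)"
        by (simp add: abs_mult mult.commute)
    qed
  qed (use assms m in auto)
qed

lemma I_integrable: "integrable freq (I T \<omega> j)"
  unfolding I_def by (rule continuous_imp_integrable_real[OF periodogram_continuous])

lemma deviation_integrable:
  assumes "T \<ge> 1" "N T \<ge> 1" "j \<in> {1..M T}" "continuous_on UNIV k"
  shows "integrable freq (\<lambda>x. (I T \<omega> j x - f \<theta>0 (mid T j) x) * k x)"
  by (rule integrable_continuous_mult[OF Bochner_Integration.integrable_diff[OF I_integrable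
        f_integrable[OF \<theta>0 mid_in(1)[OF assms(1-3)]]] assms(4)])

lemma block_deviation:
  assumes "T \<ge> 1" "N T \<ge> 1" "j \<in> {1..M T}"
  shows "(LINT x|freq. (I T \<omega> j x - f \<theta>0 (mid T j) x) * cos (real k * x))
    = block_autocov h (\<lambda>t. Y T t \<omega>) (S T * (j - 1)) (N T) k - c (mid T j) (real k)"
proof -
  have ct: "continuous_on UNIV (\<lambda>x::real. cos (real k * x))" by (intro continuous_intros)
  have "(LINT x|freq. (I T \<omega> j x - f \<theta>0 (mid T j) x) * cos (real k * x))
    = (LINT x|freq. I T \<omega> j x * cos (real k * x)) - (LINT x|freq. f \<theta>0 (mid T j) x * cos (real k * x))"
    unfolding left_diff_distrib
    by (rule Bochner_Integration.integral_diff[OF integrable_continuous_mult[OF I_integrable ct]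
        f_cos_integrable[OF \<theta>0 mid_in(1)[OF assms]]])
  also have "(LINT x|freq. I T \<omega> j x * cos (real k * x))
    = block_autocov h (\<lambda>t. Y T t \<omega>) (S T * (j - 1)) (N T) k"
    unfolding I_def mid_def using assms by (intro integral_tapered_periodogram_cos) auto
  finally show ?thesis by (simp add: autocov_def)
qed

text \<open>The side facts on T and N T are bundled in because every later argument about a block
  relies on them.\<close>

lemma block_deviation_uniformly_small:
  assumes "\<epsilon> > 0"
  shows "eventually (\<lambda>T. T \<ge> 1 \<and> N T \<ge> 1 \<and> (\<forall>j\<in>{1..M T}.
    expectation (\<lambda>\<omega>. \<bar>block_autocov h (\<lambda>t. Y T t \<omega>) (S T * (j - 1)) (N T) k - c (mid T j) (real k)\<bar>) \<le> \<epsilon>)) sequentially"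
proof (rule block_autocov_consistent[OF A2 assms, of k])
  fix \<delta> :: real and n0 T0 :: nat
  assume d: "\<delta> > 0" "T0 \<ge> 1"
    "\<And>T b n u. T \<ge> T0 \<Longrightarrow> n \<ge> n0 \<Longrightarrow> b + n \<le> T \<Longrightarrow> u \<in> {0<..1} \<Longrightarrow>
      (\<And>t. t \<in> {b+1..b+n} \<Longrightarrow> \<bar>real t / real T - u\<bar> < \<delta>) \<Longrightarrow>
      expectation (\<lambda>\<omega>. \<bar>block_autocov h (\<lambda>t. Y T t \<omega>) b n k - c u (real k)\<bar>) \<le> \<epsilon>"
  have "filterlim N at_top sequentially" using A3 by (simp add: assumption_A3_def)
  then have "\<forall>Z. eventually (\<lambda>T. Z \<le> N T) sequentially" unfolding filterlim_at_top .
  then have "eventually (\<lambda>T. max 1 n0 \<le> N T) sequentially" by (rule spec)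
  moreover have "eventually (\<lambda>T. real (N T) / real T < \<delta>) sequentially"
    by (rule order_tendstoD(2)[OF N_over_T d(1)])
  moreover have "eventually (\<lambda>T. T \<ge> T0) sequentially" by (rule eventually_ge_at_top)
  ultimately show ?thesis
  proof eventually_elim
    case (elim T)
    have T1: "T \<ge> 1" "N T \<ge> 1" using elim d(2) by auto
    show ?case
    proof (intro conjI ballI T1)
      fix j assume j: "j \<in> {1..M T}"
      show "expectation (\<lambda>\<omega>. \<bar>block_autocov h (\<lambda>t. Y T t \<omega>) (S T * (j - 1)) (N T) k - c (mid T j) (real k)\<bar>) \<le> \<epsilon>"
        using elim mid_in(2)[OF T1 j] by (intro d(3) mid_in[OF T1 j]) (auto intro: le_less_trans)
    qed
  qed
qed

section \<open>Majorants free of the parameter\<close>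

text \<open>In a monomial the parameter factors out of the integral and is bounded by compactness,
  so the average of the absolute block errors dominates for all \<theta> at once. Such a V avoids
  measurability questions about suprema.\<close>

lemma cosine_polynomial_deviation:
  assumes "G \<in> cosine_polynomials \<Theta>"
  shows "\<exists>V. (\<forall>T. integrable P (V T)) \<and> (\<forall>T \<omega>. 0 \<le> V T \<omega>) \<and> (\<lambda>T. expectation (V T)) \<longlonglongrightarrow> 0 \<and>
    eventually (\<lambda>T. \<forall>\<omega>\<in>space P. \<forall>\<theta>\<in>\<Theta>. \<bar>average_deviation G T \<omega> \<theta>\<bar> \<le> V T \<omega>) sequentially"
  using assms
proof induction
  case (monomial p q k)
  have "compact (p ` \<Theta>)" by (rule compact_continuous_image[OF monomial(1) compact_\<Theta>])
  then obtain Cp where Cp: "\<And>\<theta>. \<theta> \<in> \<Theta> \<Longrightarrow> \<bar>p \<theta>\<bar> \<le> Cp"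
    unfolding compact_eq_bounded_closed bounded_iff by fastforce
  have "compact (q ` {0..1})" by (rule compact_continuous_image[OF monomial(2) compact_Icc])
  then obtain Cq where Cq: "\<And>u. u \<in> {0..1} \<Longrightarrow> \<bar>q u\<bar> \<le> Cq"
    unfolding compact_eq_bounded_closed bounded_iff by fastforce
  define C where "C = \<bar>Cp\<bar> * \<bar>Cq\<bar>"
  define Dv where "Dv T j \<omega> = \<bar>block_autocov h (\<lambda>t. Y T t \<omega>) (S T * (j - 1)) (N T) k - c (mid T j) (real k)\<bar>" for T j \<omega>
  \<comment> \<open>For the finitely many early rows V is set to 0, so that integrability holds for
    every T.\<close>
  define V where "V T \<omega> = (if T \<ge> 1 \<and> N T \<ge> 1 then C * ((\<Sum>j=1..M T. Dv T j \<omega>) / real (M T)) else 0)" for T \<omega>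
  have iD: "integrable P (Dv T j)" if "T \<ge> 1" "N T \<ge> 1" "j \<in> {1..M T}" for T j
    unfolding Dv_def using mid_in(3)[OF that] that(1)
    by (intro integrable_abs Bochner_Integration.integrable_diff block_autocov_integrable) auto
  have iV: "integrable P (V T)" for T
  proof (cases "T \<ge> 1 \<and> N T \<ge> 1")
    case True
    then have "integrable P (\<lambda>\<omega>. C * ((\<Sum>j=1..M T. Dv T j \<omega>) / real (M T)))"
      by (intro integrable_mult_right integrable_divide Bochner_Integration.integrable_sum iD) auto
    then show ?thesis using True by (simp add: V_def[abs_def])
  next
    case False
    then have "V T = (\<lambda>\<omega>. 0)" unfolding V_def by (simp only: if_False)
    then show ?thesis by simp
  qed
  have C0: "C \<ge> 0" by (simp add: C_def)
  have "(\<lambda>T. expectation (V T)) \<longlonglongrightarrow> 0"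
  proof (rule LIMSEQ_I)
    fix r :: real assume r: "r > 0"
    \<comment> \<open>Adding 1 avoids a division by 0 when C vanishes.\<close>
    define Q where "Q = C + 1"
    have Q: "Q > 0" using C0 by (simp add: Q_def)
    define e where "e = r / (2 * Q)"
    have e: "e > 0" using r Q by (simp add: e_def)
    have Ce: "C * e < r"
    proof -
      have "C * e \<le> Q * e" using e by (intro mult_right_mono) (auto simp: Q_def)
      also have "\<dots> = r / 2" using Q by (simp add: e_def)
      finally show ?thesis using r by simp
    qed
    from block_deviation_uniformly_small[OF e, of k] obtain T0 where
      T0: "\<And>T. T \<ge> T0 \<Longrightarrow> T \<ge> 1 \<and> N T \<ge> 1 \<and> (\<forall>j\<in>{1..M T}. expectation (Dv T j) \<le> e)"
      unfolding eventually_sequentially Dv_def[abs_def] by blast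
    have "norm (expectation (V T) - 0) < r" if "T \<ge> T0" for T
    proof -
      have T1: "T \<ge> 1" "N T \<ge> 1" using T0[OF that] by auto
      have "expectation (V T) = C * ((\<Sum>j=1..M T. expectation (Dv T j)) / real (M T))"
        unfolding V_def using T1 iD[OF T1] by (simp add: Bochner_Integration.integral_sum)
      also have "\<dots> \<le> C * ((\<Sum>j=1..M T. e) / real (M T))"
        using T0[OF that] C0 by (intro mult_left_mono divide_right_mono sum_mono) auto
      also have "\<dots> = C * e" using blocks[OF T1(1)] by simp
      finally have "expectation (V T) < r" using Ce by linarith
      moreover have "0 \<le> expectation (V T)"
        by (intro Bochner_Integration.integral_nonneg) (simp add: V_def Dv_def C0 sum_nonneg)
      ultimately show ?thesis by simp
    qed
    then show "\<exists>no. \<forall>T\<ge>no. norm (expectation (V T) - 0) < r" by blast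
  qed
  moreover have "eventually (\<lambda>T. \<forall>\<omega>\<in>space P. \<forall>\<theta>\<in>\<Theta>.
      \<bar>average_deviation (\<lambda>(\<theta>, u, x). p \<theta> * q u * cos (real k * x)) T \<omega> \<theta>\<bar> \<le> V T \<omega>) sequentially"
    using block_deviation_uniformly_small[of 1 k, OF zero_less_one]
  proof eventually_elim
    case (elim T)
    then have T1: "T \<ge> 1" "N T \<ge> 1" by auto
    show ?case
    proof (intro ballI)
      fix \<omega> \<theta> assume "\<omega> \<in> space P" and t: "\<theta> \<in> \<Theta>"
      have "average_deviation (\<lambda>(\<theta>, u, x). p \<theta> * q u * cos (real k * x)) T \<omega> \<theta>
        = (\<Sum>j=1..M T. p \<theta> * q (mid T j) * (LINT x|freq. (I T \<omega> j x - f \<theta>0 (mid T j) x) * cos (real k * x))) / real (M T)"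
        unfolding average_deviation_def by (simp add: mult.left_commute flip: integral_mult_right_zero)
      also have "\<bar>\<dots>\<bar> \<le> (\<Sum>j=1..M T. C * Dv T j \<omega>) / real (M T)"
        unfolding abs_divide abs_of_nat
      proof (intro divide_right_mono order_trans[OF sum_abs sum_mono])
        fix j assume j: "j \<in> {1..M T}"
        have "\<bar>p \<theta> * q (mid T j)\<bar> \<le> C"
          unfolding C_def abs_mult using Cp[OF t] Cq[of "mid T j"] mid_in(1)[OF T1 j] by (intro mult_mono) auto
        then show "\<bar>p \<theta> * q (mid T j) * (LINT x|freq. (I T \<omega> j x - f \<theta>0 (mid T j) x) * cos (real k * x))\<bar> \<le> C * Dv T j \<omega>"
          unfolding abs_mult[of "p \<theta> * q (mid T j)"] block_deviation[OF T1 j] Dv_def by (intro mult_right_mono) auto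
      qed simp
      also have "\<dots> = V T \<omega>" using T1 by (simp add: V_def sum_distrib_left)
      finally show "\<bar>average_deviation (\<lambda>(\<theta>, u, x). p \<theta> * q u * cos (real k * x)) T \<omega> \<theta>\<bar> \<le> V T \<omega>" .
    qed
  qed
  moreover have "\<forall>T \<omega>. 0 \<le> V T \<omega>" by (simp add: V_def Dv_def C0 sum_nonneg)
  ultimately show ?case using iV by blast
next
  case (add G G')
  obtain V where V0: "\<And>T \<omega>. 0 \<le> V T \<omega>" and V: "\<And>T. integrable P (V T)" "(\<lambda>T. expectation (V T)) \<longlonglongrightarrow> 0"
    "eventually (\<lambda>T. \<forall>\<omega>\<in>space P. \<forall>\<theta>\<in>\<Theta>. \<bar>average_deviation G T \<omega> \<theta>\<bar> \<le> V T \<omega>) sequentially"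
    using add.IH(1) by blast
  obtain V' where V'0: "\<And>T \<omega>. 0 \<le> V' T \<omega>" and V': "\<And>T. integrable P (V' T)" "(\<lambda>T. expectation (V' T)) \<longlonglongrightarrow> 0"
    "eventually (\<lambda>T. \<forall>\<omega>\<in>space P. \<forall>\<theta>\<in>\<Theta>. \<bar>average_deviation G' T \<omega> \<theta>\<bar> \<le> V' T \<omega>) sequentially"
    using add.IH(2) by blast
  \<comment> \<open>The instance with \<epsilon> = 1 and k = 0 is called only to supply T \<ge> 1
    and N T \<ge> 1.\<close>
  have "eventually (\<lambda>T. \<forall>\<omega>\<in>space P. \<forall>\<theta>\<in>\<Theta>. \<bar>average_deviation (\<lambda>z. G z + G' z) T \<omega> \<theta>\<bar> \<le> V T \<omega> + V' T \<omega>) sequentially"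
    using V(3) V'(3) block_deviation_uniformly_small[of 1 0, OF zero_less_one]
  proof eventually_elim
    case (elim T)
    then have T1: "T \<ge> 1" "N T \<ge> 1" by auto
    show ?case
    proof (intro ballI)
      fix \<omega> \<theta> assume w: "\<omega> \<in> space P" and t: "\<theta> \<in> \<Theta>"
      have "average_deviation (\<lambda>z. G z + G' z) T \<omega> \<theta> = average_deviation G T \<omega> \<theta> + average_deviation G' T \<omega> \<theta>"
        unfolding average_deviation_def add_divide_distrib[symmetric] sum.distrib[symmetric]
        using deviation_integrable[OF T1 _ cosine_polynomials_continuous_x[OF add.hyps(1)]]
          deviation_integrable[OF T1 _ cosine_polynomials_continuous_x[OF add.hyps(2)]]
        by (simp add: distrib_left)
      moreover have "\<bar>average_deviation G T \<omega> \<theta>\<bar> \<le> V T \<omega>" "\<bar>average_deviation G' T \<omega> \<theta>\<bar> \<le> V' T \<omega>"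
        using elim w t by auto
      ultimately show "\<bar>average_deviation (\<lambda>z. G z + G' z) T \<omega> \<theta>\<bar> \<le> V T \<omega> + V' T \<omega>" by linarith
    qed
  qed
  moreover have "(\<lambda>T. expectation (\<lambda>\<omega>. V T \<omega> + V' T \<omega>)) \<longlonglongrightarrow> 0"
    using tendsto_add[OF V(2) V'(2)] V(1) V'(1) by simp
  ultimately show ?case
    using V(1) V'(1) V0 V'0 by (intro exI[of _ "\<lambda>T \<omega>. V T \<omega> + V' T \<omega>"]) auto
qed

lemma inverse_f_measurable:
  assumes "\<theta> \<in> \<Theta>" "u \<in> {0<..1}"
  shows "(\<lambda>x. inverse (f \<theta> u x)) \<in> borel_measurable freq"
  using borel_measurable_integrable[OF f_integrable[OF assms]] by simp

lemma inverse_f_bounded: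
  obtains C where "C \<ge> 0" "\<And>\<theta> u x. \<theta> \<in> \<Theta> \<Longrightarrow> u \<in> {0..1} \<Longrightarrow> x \<in> frequencies \<Longrightarrow> inverse (f \<theta> u x) \<le> C"
proof -
  have "compact ((\<lambda>(\<theta>, u, x). inv_density \<theta> u x) ` (\<Theta> \<times> {0..1} \<times> {-pi..pi}))"
    by (intro compact_continuous_image inv_density_continuous compact_Times compact_\<Theta> compact_Icc)
  then obtain C where C: "\<And>z. z \<in> \<Theta> \<times> {0..1} \<times> {-pi..pi} \<Longrightarrow> \<bar>(\<lambda>(\<theta>, u, x). inv_density \<theta> u x) z\<bar> \<le> C"
    unfolding compact_eq_bounded_closed bounded_iff by fastforce
  show thesis
  proof (rule that[of "\<bar>C\<bar>"])
    fix \<theta> u x assume t: "\<theta> \<in> \<Theta>" "u \<in> {0..1::real}" "x \<in> frequencies"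
    then have "\<bar>inv_density \<theta> u x\<bar> \<le> C" using C[of "(\<theta>, u, x)"] by (auto simp: frequencies_def)
    then show "inverse (f \<theta> u x) \<le> \<bar>C\<bar>" using t(3) by (auto simp: inv_density_def frequencies_def abs_le_iff)
  qed simp
qed

lemma integrable_mult_inverse_f:
  assumes "integrable freq g" "\<theta> \<in> \<Theta>" "u \<in> {0<..1}"
  shows "integrable freq (\<lambda>x. g x * inverse (f \<theta> u x))"
proof -
  obtain C where C: "C \<ge> 0" "\<And>\<theta> u x. \<theta> \<in> \<Theta> \<Longrightarrow> u \<in> {0..1} \<Longrightarrow> x \<in> frequencies \<Longrightarrow> inverse (f \<theta> u x) \<le> C"
    using inverse_f_bounded by blast
  show ?thesis
  proof (rule Bochner_Integration.integrable_bound[where f = "\<lambda>x. C * g x"])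
    show "(\<lambda>x. g x * inverse (f \<theta> u x)) \<in> borel_measurable freq"
      by (intro borel_measurable_times inverse_f_measurable assms borel_measurable_integrable)
    show "AE x in freq. norm (g x * inverse (f \<theta> u x)) \<le> norm (C * g x)"
    proof (rule eventually_mono[OF AE_freq])
      fix x assume x: "x \<in> frequencies"
      have "u \<in> {0..1}" using assms by auto
      from C(2)[OF assms(2) this x] f_pos[OF assms(2) this x]
      have "\<bar>inverse (f \<theta> u x)\<bar> \<le> C" by simp
      from mult_left_mono[OF this, of "\<bar>g x\<bar>"] show "norm (g x * inverse (f \<theta> u x)) \<le> norm (C * g x)"
        using C(1) by (simp add: abs_mult mult.commute)
    qed
  qed (use assms in auto)
qed

text \<open>Replacing 1 / f by a cosine polynomial within e costs e times the L1 mass of periodogram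
  minus density, that is, e times its plain integral plus 2 e times the mass of the density.\<close>

lemma whittle_deviation_bound:
  assumes "\<epsilon> > 0"
  shows "\<exists>V. (\<forall>T. integrable P (V T)) \<and> (\<forall>T \<omega>. 0 \<le> V T \<omega>) \<and> (\<lambda>T. expectation (V T)) \<longlonglongrightarrow> 0 \<and>
    eventually (\<lambda>T. \<forall>\<omega>\<in>space P. \<forall>\<theta>\<in>\<Theta>.
      \<bar>whittle_deviation T \<omega> \<theta>\<bar> \<le> V T \<omega> + \<epsilon>) sequentially"
proof -
  obtain F where F: "F \<ge> 0" "\<And>u. u \<in> {0<..1} \<Longrightarrow> (LINT x|freq. f \<theta>0 u x) \<le> F"
    using A_bound by metis
  \<comment> \<open>Chosen so that 2 e F \<le> \<epsilon>, with 1 added in case F = 0.\<close>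
  define e where "e = \<epsilon> / (2 * F + 1)"
  have e: "e > 0" using assms F by (simp add: e_def)
  have eF: "2 * e * F \<le> \<epsilon>"
  proof -
    have "2 * e * F \<le> e * (2 * F + 1)" using e by (simp add: algebra_simps)
    also have "\<dots> = \<epsilon>" using F by (simp add: e_def)
    finally show ?thesis .
  qed
  \<comment> \<open>The approximation is made on [0, pi] and extended to negative frequencies by
    evenness of both sides.\<close>
  have "continuous_on (\<Theta> \<times> {0..1} \<times> {0..pi}) (\<lambda>(\<theta>, u, x). inv_density \<theta> u x)"
    by (rule continuous_on_subset[OF inv_density_continuous]) auto
  from cosine_polynomial_approximation[OF compact_\<Theta> this e] obtain G where G: "G \<in> cosine_polynomials \<Theta>"
    and GF: "\<And>z. z \<in> \<Theta> \<times> {0..1} \<times> {0..pi} \<Longrightarrow> \<bar>(\<lambda>(\<theta>, u, x). inv_density \<theta> u x) z - G z\<bar> < e" by blast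
  have GD: "\<bar>inverse (f \<theta> u x) - G (\<theta>, u, x)\<bar> \<le> e"
    if t: "\<theta> \<in> \<Theta>" and u: "u \<in> {0<..1}" and x: "x \<in> frequencies" for \<theta> u x
  proof -
    have "\<bar>inv_density \<theta> u \<bar>x\<bar> - G (\<theta>, u, \<bar>x\<bar>)\<bar> < e"
      using GF[of "(\<theta>, u, \<bar>x\<bar>)"] t u x by (auto simp: frequencies_def)
    moreover have "G (\<theta>, u, \<bar>x\<bar>) = G (\<theta>, u, x)"
      using cosine_polynomials_even[OF G] by (simp add: abs_if)
    moreover have "inv_density \<theta> u \<bar>x\<bar> = inverse (f \<theta> u x)"
      using hermitian(2)[OF t u] x by (simp add: inv_density_def frequencies_def abs_if)
    ultimately show ?thesis by simp
  qed
  obtain V where V0: "\<And>T \<omega>. 0 \<le> V T \<omega>" and V: "\<And>T. integrable P (V T)" "(\<lambda>T. expectation (V T)) \<longlonglongrightarrow> 0"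
    "eventually (\<lambda>T. \<forall>\<omega>\<in>space P. \<forall>\<theta>\<in>\<Theta>. \<bar>average_deviation G T \<omega> \<theta>\<bar> \<le> V T \<omega>) sequentially"
    using cosine_polynomial_deviation[OF G] by blast
  \<comment> \<open>The constant weight 1 is the lag-0 coefficient; it controls the plain integral
    of periodogram minus density.\<close>
  obtain V' where V'0: "\<And>T \<omega>. 0 \<le> V' T \<omega>" and V': "\<And>T. integrable P (V' T)" "(\<lambda>T. expectation (V' T)) \<longlonglongrightarrow> 0"
    "eventually (\<lambda>T. \<forall>\<omega>\<in>space P. \<forall>\<theta>\<in>\<Theta>. \<bar>average_deviation (\<lambda>_. 1) T \<omega> \<theta>\<bar> \<le> V' T \<omega>) sequentially"
    using cosine_polynomial_deviation[OF cosine_polynomials_const] by blast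
  have "eventually (\<lambda>T. \<forall>\<omega>\<in>space P. \<forall>\<theta>\<in>\<Theta>.
      \<bar>whittle_deviation T \<omega> \<theta>\<bar> \<le> (V T \<omega> + e * V' T \<omega>) + \<epsilon>) sequentially"
    using V(3) V'(3) block_deviation_uniformly_small[of 1 0, OF zero_less_one]
  proof eventually_elim
    case (elim T)
    then have T1: "T \<ge> 1" "N T \<ge> 1" by auto
    have M1: "real (M T) > 0" using blocks[OF T1(1)] by simp
    show ?case
    proof (intro ballI)
      fix \<omega> \<theta> assume w: "\<omega> \<in> space P" and t: "\<theta> \<in> \<Theta>"
      define d where "d j x = I T \<omega> j x - f \<theta>0 (mid T j) x" for j x
      have id: "integrable freq (d j)" if "j \<in> {1..M T}" for j
        unfolding d_def[abs_def] using f_integrable[OF \<theta>0 mid_in(1)[OF T1 that]] I_integrable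
        by (intro Bochner_Integration.integrable_diff) auto
      have idf: "integrable freq (\<lambda>x. d j x * inverse (f \<theta> (mid T j) x))" if "j \<in> {1..M T}" for j
        by (rule integrable_mult_inverse_f[OF id[OF that] t mid_in(1)[OF T1 that]])
      have idG: "integrable freq (\<lambda>x. d j x * G (\<theta>, mid T j, x))" if "j \<in> {1..M T}" for j
        by (rule integrable_continuous_mult[OF id[OF that] cosine_polynomials_continuous_x[OF G]])
      \<comment> \<open>The factor 1 is kept so that the sum over blocks is literally the deviation
        with constant weight.\<close>
      have one: "\<bar>(LINT x|freq. d j x * inverse (f \<theta> (mid T j) x)) - (LINT x|freq. d j x * G (\<theta>, mid T j, x))\<bar>
          \<le> e * (LINT x|freq. d j x * 1) + \<epsilon>" if j: "j \<in> {1..M T}" for j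
      proof -
        note u = mid_in(1)[OF T1 j]
        have f0: "integrable freq (f \<theta>0 (mid T j))" by (rule f_integrable[OF \<theta>0 u])
        have "\<bar>(LINT x|freq. d j x * inverse (f \<theta> (mid T j) x)) - (LINT x|freq. d j x * G (\<theta>, mid T j, x))\<bar>
          \<le> e * (LINT x|freq. d j x) + 2 * e * (LINT x|freq. f \<theta>0 (mid T j) x)"
        proof (rule integral_weight_change_le[OF idf[OF j] idG[OF j] id[OF j] f0])
          show "AE x in freq. \<bar>inverse (f \<theta> (mid T j) x) - G (\<theta>, mid T j, x)\<bar> \<le> e"
            by (rule eventually_mono[OF AE_freq GD[OF t u]])
          fix x
          have "0 \<le> f \<theta>0 (mid T j) x" unfolding tv_spectral_density_def by (rule zero_le_power2)
          then show "\<bar>d j x\<bar> \<le> d j x + 2 * f \<theta>0 (mid T j) x"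
            using I_nonneg[of T \<omega> j x] unfolding d_def by linarith
        qed
        also have "2 * e * (LINT x|freq. f \<theta>0 (mid T j) x) \<le> \<epsilon>"
          using mult_left_mono[OF F(2)[OF u], of "2 * e"] e eF by linarith
        finally show ?thesis by simp
      qed
      have "\<bar>whittle_deviation T \<omega> \<theta> - average_deviation G T \<omega> \<theta>\<bar>
        = \<bar>\<Sum>j=1..M T. (LINT x|freq. d j x * inverse (f \<theta> (mid T j) x)) - (LINT x|freq. d j x * G (\<theta>, mid T j, x))\<bar> / real (M T)"
        by (simp add: average_deviation_def d_def sum_subtractf flip: diff_divide_distrib)
      also have "\<dots> \<le> (\<Sum>j=1..M T. e * (LINT x|freq. d j x * 1) + \<epsilon>) / real (M T)"
        by (intro divide_right_mono order_trans[OF sum_abs sum_mono] one) auto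
      also have "\<dots> = e * average_deviation (\<lambda>_. 1) T \<omega> \<theta> + \<epsilon>"
        using M1 by (simp add: average_deviation_def d_def sum.distrib add_divide_distrib flip: sum_distrib_left)
      finally have "\<bar>whittle_deviation T \<omega> \<theta> - average_deviation G T \<omega> \<theta>\<bar>
        \<le> e * average_deviation (\<lambda>_. 1) T \<omega> \<theta> + \<epsilon>" .
      moreover have "e * average_deviation (\<lambda>_. 1) T \<omega> \<theta> \<le> e * V' T \<omega>"
        using elim(2) w t e by (intro mult_left_mono) (auto simp: abs_le_iff)
      moreover have "\<bar>average_deviation G T \<omega> \<theta>\<bar> \<le> V T \<omega>" using elim(1) w t by auto
      ultimately show "\<bar>whittle_deviation T \<omega> \<theta>\<bar> \<le> (V T \<omega> + e * V' T \<omega>) + \<epsilon>"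
        by linarith
    qed
  qed
  moreover have "(\<lambda>T. expectation (\<lambda>\<omega>. V T \<omega> + e * V' T \<omega>)) \<longlonglongrightarrow> 0"
    using tendsto_add[OF V(2) tendsto_mult[OF tendsto_const V'(2), of e]] V(1) V'(1) by simp
  ultimately show ?thesis
    using V(1) V'(1) V0 V'0 e by (intro exI[of _ "\<lambda>T \<omega>. V T \<omega> + e * V' T \<omega>"]) auto
qed

end

section \<open>Identification and consistency\<close>

context whittle_setting
begin

text \<open>The integrand of a Kullback-Leibler type divergence of \<open>f \<theta>\<close> from \<open>f \<theta>0\<close>.\<close>

definition contrast :: "'p \<Rightarrow> real \<Rightarrow> real \<Rightarrow> real" where
  "contrast \<theta> u x = ln (f \<theta> u x) - ln (f \<theta>0 u x) + f \<theta>0 u x * inverse (f \<theta> u x) - 1"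

lemma contrast_eq:
  assumes "\<theta> \<in> \<Theta>" "u \<in> {0..1}" "x \<in> frequencies"
  shows "contrast \<theta> u x = (f \<theta>0 u x / f \<theta> u x - 1) - ln (f \<theta>0 u x / f \<theta> u x)"
  using f_pos[OF assms] f_pos[OF \<theta>0 assms(2,3)] 
  unfolding contrast_def divide_inverse[symmetric] by (simp add: ln_div)

lemma contrast_nonneg:
  assumes "\<theta> \<in> \<Theta>" "u \<in> {0..1}" "x \<in> frequencies"
  shows "0 \<le> contrast \<theta> u x"
  unfolding contrast_eq[OF assms]
  using ln_le_minus_one[of "f \<theta>0 u x / f \<theta> u x"] f_pos[OF assms] f_pos[OF \<theta>0 assms(2,3)] by simp

text \<open>ln y = y - 1 holds only at y = 1, here y is the ratio of the densities.\<close>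

lemma contrast_pos:
  assumes "\<theta> \<in> \<Theta>" "u \<in> {0..1}" "x \<in> frequencies" "f \<theta> u x \<noteq> f \<theta>0 u x"
  shows "0 < contrast \<theta> u x"
proof -
  have p: "f \<theta> u x > 0" "f \<theta>0 u x > 0" using f_pos assms \<theta>0 by auto
  have "contrast \<theta> u x \<noteq> 0"
  proof
    assume "contrast \<theta> u x = 0"
    then have "ln (f \<theta>0 u x / f \<theta> u x) = f \<theta>0 u x / f \<theta> u x - 1"
      unfolding contrast_eq[OF assms(1-3)] by simp
    then have "f \<theta>0 u x / f \<theta> u x = 1" by (rule ln_eq_minus_one[rotated]) (use p in simp)
    then show False using p assms(4) by simp
  qed
  then show ?thesis using contrast_nonneg[OF assms(1-3)] by simp
qed

lemma contrast_continuous: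
  "continuous_on (\<Theta> \<times> {0..1} \<times> frequencies) (\<lambda>(\<theta>, u, x). contrast \<theta> u x)"
proof -
  let ?W = "\<Theta> \<times> {0..1::real} \<times> frequencies"
  have f: "continuous_on ?W (\<lambda>z. f (fst z) (fst (snd z)) (snd (snd z)))"
    using f_continuous by (simp add: case_prod_unfold)
  have "continuous_on ?W (\<lambda>z. (\<lambda>(\<theta>, u, x). f \<theta> u x) (\<theta>0, fst (snd z), snd (snd z)))"
    by (rule continuous_on_compose2[OF f_continuous]) (use \<theta>0 in \<open>auto intro!: continuous_intros\<close>)
  then have f0: "continuous_on ?W (\<lambda>z. f \<theta>0 (fst (snd z)) (snd (snd z)))"
    by (simp add: case_prod_unfold)
  have p: "f (fst z) (fst (snd z)) (snd (snd z)) \<noteq> 0" "f \<theta>0 (fst (snd z)) (snd (snd z)) \<noteq> 0"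
    if "z \<in> ?W" for z
    using f_pos[of "fst z" "fst (snd z)" "snd (snd z)"] f_pos[OF \<theta>0, of "fst (snd z)" "snd (snd z)"] that
    by auto
  show ?thesis
    unfolding contrast_def case_prod_unfold
    by (intro continuous_intros f f0) (use p in auto)
qed

text \<open>ln y \<le> y - 1, applied to f and to 1 / f, bounds |ln f| by f + 1 / f.\<close>

lemma ln_f_integrable:
  assumes "\<theta> \<in> \<Theta>" "u \<in> {0<..1}"
  shows "integrable freq (\<lambda>x. ln (f \<theta> u x))"
proof -
  have i: "integrable freq (\<lambda>x. f \<theta> u x + 1 * inverse (f \<theta> u x))"
    using finite_measure.integrable_const[OF finite_measure_freq, of "1::real"]
    by (intro Bochner_Integration.integrable_add f_integrable integrable_mult_inverse_f assms)
  show ?thesis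
  proof (rule Bochner_Integration.integrable_bound[OF i])
    show "(\<lambda>x. ln (f \<theta> u x)) \<in> borel_measurable freq"
      using borel_measurable_integrable[OF f_integrable[OF assms]] by simp
    show "AE x in freq. norm (ln (f \<theta> u x)) \<le> norm (f \<theta> u x + 1 * inverse (f \<theta> u x))"
      using AE_freq
    proof eventually_elim
      case (elim x)
      have p: "f \<theta> u x > 0" using f_pos[OF assms(1) _ elim, of u] assms(2) by auto
      have "ln (f \<theta> u x) \<le> f \<theta> u x - 1" using p by (rule ln_le_minus_one)
      moreover have "- ln (f \<theta> u x) \<le> inverse (f \<theta> u x) - 1"
        using ln_le_minus_one[of "inverse (f \<theta> u x)"] p by (simp add: ln_inverse)
      moreover have "inverse (f \<theta> u x) > 0" using p by simp
      ultimately show ?case using p unfolding real_norm_def by linarith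
    qed
  qed
qed

lemma contrast_integrable:
  assumes "\<theta> \<in> \<Theta>" "u \<in> {0<..1}"
  shows "integrable freq (contrast \<theta> u)"
  unfolding contrast_def[abs_def]
  using ln_f_integrable[OF assms] ln_f_integrable[OF \<theta>0 assms(2)]
    integrable_mult_inverse_f[OF f_integrable[OF \<theta>0 assms(2)] assms]
    finite_measure.integrable_const[OF finite_measure_freq, of "1::real"]
  by (intro Bochner_Integration.integrable_add Bochner_Integration.integrable_diff)

text \<open>One point of disagreement has positive contrast a; by joint continuity the contrast
  exceeds a / 2 on a box around it, and it is nonnegative elsewhere, so integrating over the
  frequency side of the box gives the bound.\<close>

lemma contrast_integral_locally_bounded_below:
  assumes t: "\<theta>' \<in> \<Theta>" and u: "u' \<in> {0..1}" and x: "x' \<in> frequencies" and ne: "f \<theta>' u' x' \<noteq> f \<theta>0 u' x'"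
  obtains \<delta> \<kappa> where "\<delta> > 0" "\<kappa> > 0"
    "\<And>\<theta> u. \<theta> \<in> \<Theta> \<Longrightarrow> dist \<theta> \<theta>' < \<delta> \<Longrightarrow> u \<in> {0<..1} \<Longrightarrow> \<bar>u - u'\<bar> < \<delta> \<Longrightarrow>
      \<kappa> \<le> (LINT x|freq. contrast \<theta> u x)"
proof -
  define a where "a = contrast \<theta>' u' x'"
  have a: "a > 0" unfolding a_def by (rule contrast_pos[OF t u x ne])
  have z: "(\<theta>', u', x') \<in> \<Theta> \<times> {0..1} \<times> frequencies" using t u x by simp
  from contrast_continuous[unfolded continuous_on_iff, rule_format, OF z, of "a / 2"] a
  obtain d where d: "d > 0" and dz: "\<And>z. z \<in> \<Theta> \<times> {0..1} \<times> frequencies \<Longrightarrow> dist z (\<theta>', u', x') < d \<Longrightarrow>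
      dist ((\<lambda>(\<theta>, u, x). contrast \<theta> u x) z) a < a / 2"
    by (auto simp: a_def)
  \<comment> \<open>The distance of triples is at most the sum of the three coordinate
    distances.\<close>
  define \<delta> where "\<delta> = d / 3"
  have \<delta>: "\<delta> > 0" using d by (simp add: \<delta>_def)
  \<comment> \<open>Clipping matters when x' is at or near pi or -pi; one side of the interval
    always survives.\<close>
  define lo hi where "lo = max (-pi) (x' - \<delta>)" and "hi = min pi (x' + \<delta>)"
  have xr: "-pi \<le> x'" "x' \<le> pi" using x by (auto simp: frequencies_def)
  have lohi: "lo < hi" using xr \<delta> pi_gt_zero unfolding lo_def hi_def by linarith
  have X: "{lo<..<hi} \<subseteq> {-pi..pi}" by (auto simp: lo_def hi_def)
  have Xs: "{lo<..<hi} \<in> sets freq" using X by (simp add: sets_restrict_space_iff)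
  have Xm: "measure freq {lo<..<hi} = hi - lo"
    using X lohi by (simp add: measure_restrict_space)
  show thesis
  proof (rule that[of \<delta> "a / 2 * (hi - lo)"])
    show "a / 2 * (hi - lo) > 0" using a lohi by simp
    fix \<theta> u assume th: "\<theta> \<in> \<Theta>" "dist \<theta> \<theta>' < \<delta>" and uu: "u \<in> {0<..1::real}" "\<bar>u - u'\<bar> < \<delta>"
    have u01: "u \<in> {0..1}" using uu by auto
    have Xi: "integrable freq (indicator {lo<..<hi} :: real \<Rightarrow> real)"
      using Xs finite_measure.emeasure_finite[OF finite_measure_freq, of "{lo<..<hi}"]
      by (simp add: less_top)
    have "a / 2 * (hi - lo) = (LINT x|freq. a / 2 * indicator {lo<..<hi} x)"
      using Xs Xm X by (simp add: Int_absorb2 space_restrict_space)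
    also have "\<dots> \<le> (LINT x|freq. contrast \<theta> u x)"
    proof (rule integral_mono_AE)
      show "AE x in freq. a / 2 * indicator {lo<..<hi} x \<le> contrast \<theta> u x"
        using AE_freq
      proof eventually_elim
        case (elim x)
        show ?case
        proof (cases "x \<in> {lo<..<hi}")
          case True
          then have xx: "dist x x' < \<delta>" by (auto simp: lo_def hi_def dist_real_def)
          have "dist (\<theta>, u, x) (\<theta>', u', x') \<le> dist \<theta> \<theta>' + (dist u u' + dist x x')"
            unfolding dist_Pair_Pair
            by (intro order_trans[OF sqrt_sum_squares_le_sum] add_left_mono) auto
          also have "\<dots> < d" using th uu xx by (simp add: \<delta>_def dist_real_def)
          finally have "dist (contrast \<theta> u x) a < a / 2" using dz[of "(\<theta>, u, x)"] th u01 elim by simp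
          then have "\<bar>contrast \<theta> u x - a\<bar> < a / 2" by (simp only: dist_real_def)
          then have "a / 2 \<le> contrast \<theta> u x" by linarith
          then show ?thesis using True by simp
        next
          case False
          then show ?thesis using contrast_nonneg[OF th(1) u01 elim] by simp
        qed
      qed
    qed (use Xi contrast_integrable[OF th(1) uu(1)] in auto)
    finally show "a / 2 * (hi - lo) \<le> (LINT x|freq. contrast \<theta> u x)" .
  qed (rule \<delta>)
qed

section \<open>Block midpoints as an asymptotically regular grid\<close>

text \<open>Inserting T = S (M - 1) + N, the terms S j M cancel in the difference of the two
  fractions and only multiples of S and N of size at most M remain.\<close>

lemma mid_near_grid:
  assumes "T \<ge> 1" "j \<in> {1..M T}"
  shows "\<bar>mid T j - real j / real (M T)\<bar> \<le> (real (S T) + real (N T)) / real T"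
proof -
  define s n m t where "s = real (S T)" and "n = real (N T)" and "m = real (M T)" and "t = real T"
  have b: "M T \<ge> 1" "T = S T * (M T - 1) + N T" using blocks[OF assms(1)] by auto
  have tm: "t = s * (m - 1) + n"
    unfolding t_def s_def m_def n_def
    by (subst b(2)) (use b(1) in \<open>simp add: of_nat_diff del: of_nat_Suc\<close>)
  have pos: "t > 0" "m > 0" using assms b by (auto simp: t_def m_def)
  have j: "1 \<le> real j" "real j \<le> m" using assms(2) by (auto simp: m_def)
  have sn: "s \<ge> 0" "n \<ge> 0" by (auto simp: s_def n_def)
  have "mid T j - real j / m = ((s * (real j - 1) + n / 2) * m - real j * t) / (t * m)"
    using pos by (simp add: mid_def block_midpoint_def s_def n_def t_def divide_simps)
  also have "(s * (real j - 1) + n / 2) * m - real j * t = - s * (m - real j) + n * (m / 2 - real j)"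
    unfolding tm by (simp add: algebra_simps)
  also have "\<bar>\<dots> / (t * m)\<bar> \<le> (s * m + n * m) / (t * m)"
  proof -
    have "\<bar>s * (m - real j)\<bar> \<le> s * m" unfolding abs_mult using sn j by (intro mult_mono) auto
    moreover have "\<bar>n * (m / 2 - real j)\<bar> \<le> n * m" unfolding abs_mult using sn j by (intro mult_mono) auto
    ultimately have "\<bar>- s * (m - real j) + n * (m / 2 - real j)\<bar> \<le> s * m + n * m" by linarith
    then show ?thesis using pos by (simp add: divide_right_mono)
  qed
  also have "\<dots> = (s + n) / t" using pos by (simp add: distrib_right[symmetric])
  finally show ?thesis by (simp add: s_def n_def m_def t_def)
qed

text \<open>Grid points in an interval of length at least \<delta> number at least \<delta> m -
  1.\<close>

lemma grid_count:
  assumes "u \<in> {0..1}" "0 < \<delta>" "\<delta> \<le> 1" "m \<ge> 1"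
  shows "\<delta> * real m - 1 \<le> real (card {j\<in>{1..m}. \<bar>real j / real m - u\<bar> < \<delta>})"
proof -
  \<comment> \<open>At an endpoint of [0,1] half of the window is cut off, but since \<delta> \<le>
    1 a length of at least \<delta> remains.\<close>
  define a b where "a = max 0 (u - \<delta>)" and "b = min 1 (u + \<delta>)"
  have ab: "0 \<le> a" "b \<le> 1" "\<delta> \<le> b - a" using assms by (auto simp: a_def b_def min_def max_def)
  define p q where "p = nat \<lfloor>a * real m\<rfloor>" and "q = nat \<lceil>b * real m\<rceil>"
  have bm: "0 \<le> b * real m" using assms by (simp add: b_def)
  have p: "real p \<le> a * real m" "a * real m < real p + 1"
    using ab(1) by (auto simp: p_def of_nat_nat floor_correct)
  have q: "b * real m \<le> real q" "real q < b * real m + 1"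
    using bm by (auto simp: q_def of_nat_nat ceiling_correct) linarith+
  have sub: "{p+1..<q} \<subseteq> {j\<in>{1..m}. \<bar>real j / real m - u\<bar> < \<delta>}"
  proof
    fix j assume j: "j \<in> {p+1..<q}"
    then have "real p + 1 \<le> real j" "real j + 1 \<le> real q" by auto
    then have aj: "a * real m < real j" "real j < b * real m" using p q by linarith+
    have m0: "real m > 0" using assms(4) by simp
    have "b * real m \<le> 1 * real m" using ab(2) by (intro mult_right_mono) auto
    then have jm: "j \<le> m" using aj by linarith
    have "a < real j / real m" "real j / real m < b" using aj m0 by (simp_all add: field_simps)
    then have "\<bar>real j / real m - u\<bar> < \<delta>" unfolding a_def b_def by linarith
    then show "j \<in> {j\<in>{1..m}. \<bar>real j / real m - u\<bar> < \<delta>}" using j jm by auto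
  qed
  have "\<delta> * real m \<le> (b - a) * real m" using ab(3) by (intro mult_right_mono) auto
  then have "\<delta> * real m - 1 \<le> real q - real p - 1" using p q by (simp add: left_diff_distrib)
  also have "\<dots> \<le> real (card {p+1..<q})" by simp
  also have "\<dots> \<le> real (card {j\<in>{1..m}. \<bar>real j / real m - u\<bar> < \<delta>})"
    using sub by (intro of_nat_mono card_mono) auto
  finally show ?thesis .
qed

lemma S_N_over_T: "(\<lambda>T. (real (S T) + real (N T)) / real T) \<longlonglongrightarrow> 0"
proof -
  have SN: "(\<lambda>T. real (S T) / real (N T)) \<longlonglongrightarrow> 0" and Nt: "filterlim N at_top sequentially"
    using A3 by (auto simp: assumption_A3_def)
  have lim: "(\<lambda>T. real (S T) / real (N T) * (real (N T) / real T) + real (N T) / real T) \<longlonglongrightarrow> 0"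
    using tendsto_add[OF tendsto_mult[OF SN N_over_T] N_over_T] by simp
  have "\<forall>Z. eventually (\<lambda>T. Z \<le> N T) sequentially" using Nt unfolding filterlim_at_top .
  then have "eventually (\<lambda>T. 1 \<le> N T) sequentially" by (rule spec)
  then have "eventually (\<lambda>T. real (S T) / real (N T) * (real (N T) / real T) + real (N T) / real T
    = (real (S T) + real (N T)) / real T) sequentially"
    by eventually_elim (simp add: add_divide_distrib)
  with lim show ?thesis by (rule Lim_transform_eventually)
qed

definition average_contrast :: "nat \<Rightarrow> 'p \<Rightarrow> real" where
  "average_contrast T \<theta> = (\<Sum>j=1..M T. LINT x|freq. contrast \<theta> (mid T j) x) / real (M T)"

text \<open>A fixed positive fraction of the midpoints falls near u', each contributing at least
  \<kappa>, and no block contributes a negative amount.\<close>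

lemma average_contrast_locally_bounded_below:
  assumes t: "\<theta>' \<in> \<Theta>" and u: "u' \<in> {0..1}" and x: "x' \<in> frequencies" and ne: "f \<theta>' u' x' \<noteq> f \<theta>0 u' x'"
  obtains \<delta> \<eta> where "\<delta> > 0" "\<eta> > 0"
    "eventually (\<lambda>T. \<forall>\<theta>\<in>\<Theta>. dist \<theta> \<theta>' < \<delta> \<longrightarrow> \<eta> \<le> average_contrast T \<theta>) sequentially"
proof -
  obtain \<delta> \<kappa> where d: "\<delta> > 0" "\<kappa> > 0" and low:
    "\<And>\<theta> u. \<theta> \<in> \<Theta> \<Longrightarrow> dist \<theta> \<theta>' < \<delta> \<Longrightarrow> u \<in> {0<..1} \<Longrightarrow> \<bar>u - u'\<bar> < \<delta> \<Longrightarrow>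
      \<kappa> \<le> (LINT x|freq. contrast \<theta> u x)"
    using contrast_integral_locally_bounded_below[OF assms] by metis
  \<comment> \<open>Half of \<delta> is spent on grid point versus u', the other half on midpoint
    versus grid point.\<close>
  define \<gamma> where "\<gamma> = min 1 (\<delta> / 2)"
  have \<gamma>: "0 < \<gamma>" "\<gamma> \<le> 1" "\<gamma> \<le> \<delta> / 2" using d by (auto simp: \<gamma>_def)
  have "filterlim M at_top sequentially" using A3 by (simp add: assumption_A3_def)
  then have "\<forall>Z. eventually (\<lambda>T. Z \<le> M T) sequentially" unfolding filterlim_at_top .
  \<comment> \<open>M \<ge> 2 / \<gamma> absorbs the -1 of the count into half of \<gamma>
    M.\<close>
  then have eM: "eventually (\<lambda>T. nat \<lceil>2 / \<gamma>\<rceil> \<le> M T) sequentially" by (rule spec)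
  have eS: "eventually (\<lambda>T. (real (S T) + real (N T)) / real T < \<delta> / 2) sequentially"
    by (rule order_tendstoD(2)[OF S_N_over_T]) (use d in simp)
  have "eventually (\<lambda>T. \<forall>\<theta>\<in>\<Theta>. dist \<theta> \<theta>' < \<delta> \<longrightarrow> \<kappa> * \<gamma> / 2 \<le> average_contrast T \<theta>) sequentially"
    using eM eS block_deviation_uniformly_small[of 1 0, OF zero_less_one]
  proof eventually_elim
    case (elim T)
    then have T1: "T \<ge> 1" "N T \<ge> 1" by auto
    have M1: "M T \<ge> 1" using blocks[OF T1(1)] by simp
    have "2 / \<gamma> \<le> real (M T)" using elim(1) by linarith
    then have gM: "\<gamma> * real (M T) / 2 \<le> \<gamma> * real (M T) - 1" using \<gamma>(1) by (simp add: field_simps)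
    let ?J = "{j\<in>{1..M T}. \<bar>real j / real (M T) - u'\<bar> < \<gamma>}"
    show ?case
    proof (intro ballI impI)
      fix \<theta> assume th: "\<theta> \<in> \<Theta>" "dist \<theta> \<theta>' < \<delta>"
      have nn: "0 \<le> (LINT x|freq. contrast \<theta> (mid T j) x)" if j: "j \<in> {1..M T}" for j
      proof (rule integral_nonneg_AE)
        have "mid T j \<in> {0..1}" using mid_in(1)[OF T1 j] by auto
        then show "AE x in freq. 0 \<le> contrast \<theta> (mid T j) x"
          by (intro eventually_mono[OF AE_freq] contrast_nonneg th)
      qed
      have "\<gamma> * real (M T) / 2 \<le> real (card ?J)"
        using gM grid_count[OF u \<gamma>(1,2) M1] by linarith
      then have "\<kappa> * (\<gamma> * real (M T) / 2) \<le> (\<Sum>j\<in>?J. \<kappa>)"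
        using d(2) by (simp add: mult.commute)
      also have "\<dots> \<le> (\<Sum>j\<in>?J. LINT x|freq. contrast \<theta> (mid T j) x)"
      proof (rule sum_mono)
        fix j assume j: "j \<in> ?J"
        then have jM: "j \<in> {1..M T}" and jd: "\<bar>real j / real (M T) - u'\<bar> < \<gamma>" by auto
        have "\<bar>mid T j - u'\<bar> < \<delta>"
          using mid_near_grid[OF T1(1) jM] jd elim(2) \<gamma>(3) by linarith
        then show "\<kappa> \<le> (LINT x|freq. contrast \<theta> (mid T j) x)"
          by (rule low[OF th mid_in(1)[OF T1 jM]])
      qed
      also have "\<dots> \<le> (\<Sum>j=1..M T. LINT x|freq. contrast \<theta> (mid T j) x)"
        by (rule sum_mono2) (use nn in auto)
      finally show "\<kappa> * \<gamma> / 2 \<le> average_contrast T \<theta>"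
        using M1 by (simp add: average_contrast_def pos_le_divide_eq)
    qed
  qed
  with d \<gamma> show thesis by (intro that[of \<delta> "\<kappa> * \<gamma> / 2"]) auto
qed

text \<open>The local bounds have thresholds in T that depend on the centre. The parameters at
  distance at least r form a compact set, and a finite subcover makes both the threshold and \<eta>
  common.\<close>

lemma average_contrast_separates:
  assumes ident: "\<And>\<theta>. \<theta> \<in> \<Theta> \<Longrightarrow> (\<And>u x. u \<in> {0..1} \<Longrightarrow> x \<in> frequencies \<Longrightarrow> f \<theta> u x = f \<theta>0 u x) \<Longrightarrow> \<theta> = \<theta>0"
    and r: "r > 0"
  obtains \<eta> where "\<eta> > 0"
    "eventually (\<lambda>T. \<forall>\<theta>\<in>\<Theta>. r \<le> dist \<theta> \<theta>0 \<longrightarrow> \<eta> \<le> average_contrast T \<theta>) sequentially"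
proof -
  define K where "K = \<Theta> \<inter> {\<theta>. r \<le> dist \<theta> \<theta>0}"
  have "closed {\<theta>. r \<le> dist \<theta> \<theta>0}" by (intro closed_Collect_le continuous_intros)
  then have cK: "compact K" unfolding K_def by (intro compact_Int_closed compact_\<Theta>)
  have "\<forall>\<theta>'\<in>K. \<exists>p. fst p > 0 \<and> snd p > 0 \<and>
    eventually (\<lambda>T. \<forall>\<theta>\<in>\<Theta>. dist \<theta> \<theta>' < fst p \<longrightarrow> snd p \<le> average_contrast T \<theta>) sequentially"
  proof
    fix \<theta>' assume "\<theta>' \<in> K"
    then have t: "\<theta>' \<in> \<Theta>" "\<theta>' \<noteq> \<theta>0" using r by (auto simp: K_def)
    then obtain u x where "u \<in> {0..1}" "x \<in> frequencies" "f \<theta>' u x \<noteq> f \<theta>0 u x" using ident by metis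
    from average_contrast_locally_bounded_below[OF t(1) this] obtain \<delta> \<eta> where "\<delta> > 0" "\<eta> > 0"
      "eventually (\<lambda>T. \<forall>\<theta>\<in>\<Theta>. dist \<theta> \<theta>' < \<delta> \<longrightarrow> \<eta> \<le> average_contrast T \<theta>) sequentially" by blast
    then show "\<exists>p. fst p > 0 \<and> snd p > 0 \<and>
      eventually (\<lambda>T. \<forall>\<theta>\<in>\<Theta>. dist \<theta> \<theta>' < fst p \<longrightarrow> snd p \<le> average_contrast T \<theta>) sequentially"
      by (intro exI[of _ "(\<delta>, \<eta>)"]) simp
  qed
  from bchoice[OF this] obtain p where p: "\<And>\<theta>'. \<theta>' \<in> K \<Longrightarrow> fst (p \<theta>') > 0" "\<And>\<theta>'. \<theta>' \<in> K \<Longrightarrow> snd (p \<theta>') > 0"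
    "\<And>\<theta>'. \<theta>' \<in> K \<Longrightarrow>
      eventually (\<lambda>T. \<forall>\<theta>\<in>\<Theta>. dist \<theta> \<theta>' < fst (p \<theta>') \<longrightarrow> snd (p \<theta>') \<le> average_contrast T \<theta>) sequentially"
    by blast
  have "K \<subseteq> (\<Union>\<theta>'\<in>K. ball \<theta>' (fst (p \<theta>')))" using p(1) by force
  then obtain C where C: "C \<subseteq> K" "finite C" "K \<subseteq> (\<Union>\<theta>'\<in>C. ball \<theta>' (fst (p \<theta>')))"
    by (rule compactE_image[OF cK open_ball])
  \<comment> \<open>The inserted 1 covers an empty subcover, when no parameter is that far from
    \<theta>0.\<close>
  define \<eta> where "\<eta> = Min (insert 1 ((\<lambda>\<theta>'. snd (p \<theta>')) ` C))"
  have \<eta>0: "\<eta> > 0" using C p(2) by (auto simp: \<eta>_def)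
  have \<eta>le: "\<eta> \<le> snd (p \<theta>')" if "\<theta>' \<in> C" for \<theta>' using C(2) that by (auto simp: \<eta>_def)
  have "eventually (\<lambda>T. \<forall>\<theta>'\<in>C. \<forall>\<theta>\<in>\<Theta>. dist \<theta> \<theta>' < fst (p \<theta>') \<longrightarrow> snd (p \<theta>') \<le> average_contrast T \<theta>) sequentially"
    using C p(3) by (intro eventually_ball_finite) auto
  then have "eventually (\<lambda>T. \<forall>\<theta>\<in>\<Theta>. r \<le> dist \<theta> \<theta>0 \<longrightarrow> \<eta> \<le> average_contrast T \<theta>) sequentially"
  proof eventually_elim
    case (elim T)
    show ?case
    proof (intro ballI impI)
      fix \<theta> assume t: "\<theta> \<in> \<Theta>" "r \<le> dist \<theta> \<theta>0"
      then have "\<theta> \<in> K" by (simp add: K_def)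
      then obtain \<theta>' where c: "\<theta>' \<in> C" "\<theta> \<in> ball \<theta>' (fst (p \<theta>'))" using C(3) by blast
      then have "snd (p \<theta>') \<le> average_contrast T \<theta>" using elim t(1) by (auto simp: dist_commute)
      then show "\<eta> \<le> average_contrast T \<theta>" using \<eta>le[OF c(1)] by linarith
    qed
  qed
  with \<eta>0 show thesis by (rule that)
qed

section \<open>Comparison of the Whittle function with its limit\<close>

text \<open>Centring the periodogram at the true density in both terms isolates the deterministic
  contrast; what is left is linear in periodogram minus density.\<close>

lemma whittle_function_diff:
  assumes T1: "T \<ge> 1" "N T \<ge> 1" and t: "\<theta> \<in> \<Theta>"
  shows "4 * pi * (L T \<omega> \<theta>
      - L T \<omega> \<theta>0)
    = average_contrast T \<theta> + whittle_deviation T \<omega> \<theta>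
      - whittle_deviation T \<omega> \<theta>0"
proof -
  have M1: "real (M T) > 0" using blocks[OF T1(1)] by simp
  define W where "W \<theta> j = (LINT x|freq. ln (f \<theta> (mid T j) x) + I T \<omega> j x * inverse (f \<theta> (mid T j) x))" for \<theta> j
  have iW: "integrable freq (\<lambda>x. ln (f \<theta> (mid T j) x) + I T \<omega> j x * inverse (f \<theta> (mid T j) x))"
    if "\<theta> \<in> \<Theta>" "j \<in> {1..M T}" for \<theta> j
    by (intro Bochner_Integration.integrable_add ln_f_integrable integrable_mult_inverse_f I_integrable that mid_in(1)[OF T1])
  have wf: "4 * pi * L T \<omega> \<theta> = (\<Sum>j=1..M T. W \<theta> j) / real (M T)"
    if "\<theta> \<in> \<Theta>" for \<theta>
  proof -
    have "(LINT x|freq. (\<Sum>j=1..M T. ln (f \<theta> (mid T j) x) + I T \<omega> j x / f \<theta> (mid T j) x)) = (\<Sum>j=1..M T. W \<theta> j)"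
      unfolding W_def divide_inverse by (intro Bochner_Integration.integral_sum iW that)
    then show ?thesis
      by (simp add: whittle_function_def I_def mid_def)
  qed
  have one: "W \<theta> j - W \<theta>0 j = (LINT x|freq. contrast \<theta> (mid T j) x)
      + (LINT x|freq. (I T \<omega> j x - f \<theta>0 (mid T j) x) * inverse (f \<theta> (mid T j) x))
      - (LINT x|freq. (I T \<omega> j x - f \<theta>0 (mid T j) x) * inverse (f \<theta>0 (mid T j) x))"
    if j: "j \<in> {1..M T}" for j
  proof -
    note u = mid_in(1)[OF T1 j]
    have id: "integrable freq (\<lambda>x. (I T \<omega> j x - f \<theta>0 (mid T j) x) * inverse (f \<theta> (mid T j) x))"
      if "\<theta> \<in> \<Theta>" for \<theta>
      by (intro integrable_mult_inverse_f Bochner_Integration.integrable_diff I_integrable f_integrable \<theta>0 u that)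
    have "W \<theta> j - W \<theta>0 j = (LINT x|freq. (ln (f \<theta> (mid T j) x) + I T \<omega> j x * inverse (f \<theta> (mid T j) x))
       - (ln (f \<theta>0 (mid T j) x) + I T \<omega> j x * inverse (f \<theta>0 (mid T j) x)))"
      unfolding W_def by (rule Bochner_Integration.integral_diff[symmetric, OF iW[OF t j] iW[OF \<theta>0 j]])
    also have "\<dots> = (LINT x|freq. contrast \<theta> (mid T j) x
       + (I T \<omega> j x - f \<theta>0 (mid T j) x) * inverse (f \<theta> (mid T j) x)
       - (I T \<omega> j x - f \<theta>0 (mid T j) x) * inverse (f \<theta>0 (mid T j) x))"
    proof (rule integral_cong_AE)
      show "AE x in freq. (ln (f \<theta> (mid T j) x) + I T \<omega> j x * inverse (f \<theta> (mid T j) x))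
       - (ln (f \<theta>0 (mid T j) x) + I T \<omega> j x * inverse (f \<theta>0 (mid T j) x)) = contrast \<theta> (mid T j) x
       + (I T \<omega> j x - f \<theta>0 (mid T j) x) * inverse (f \<theta> (mid T j) x)
       - (I T \<omega> j x - f \<theta>0 (mid T j) x) * inverse (f \<theta>0 (mid T j) x)"
        using AE_freq
      proof eventually_elim
        case (elim x)
        have "f \<theta>0 (mid T j) x > 0" using u elim by (intro f_pos \<theta>0) auto
        \<comment> \<open>This quotient supplies the -1 in \<open>contrast\<close>; it needs
          positivity, hence equality only almost everywhere.\<close>
        then have "f \<theta>0 (mid T j) x * inverse (f \<theta>0 (mid T j) x) = 1" by simp
        then show ?case by (simp add: contrast_def left_diff_distrib)
      qed
      show "(\<lambda>x. (ln (f \<theta> (mid T j) x) + I T \<omega> j x * inverse (f \<theta> (mid T j) x))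
       - (ln (f \<theta>0 (mid T j) x) + I T \<omega> j x * inverse (f \<theta>0 (mid T j) x))) \<in> borel_measurable freq"
        by (intro borel_measurable_integrable Bochner_Integration.integrable_diff iW t j \<theta>0)
      show "(\<lambda>x. contrast \<theta> (mid T j) x
       + (I T \<omega> j x - f \<theta>0 (mid T j) x) * inverse (f \<theta> (mid T j) x)
       - (I T \<omega> j x - f \<theta>0 (mid T j) x) * inverse (f \<theta>0 (mid T j) x)) \<in> borel_measurable freq"
        by (rule borel_measurable_integrable[OF Bochner_Integration.integrable_diff[OF
              Bochner_Integration.integrable_add[OF contrast_integrable[OF t u] id[OF t]] id[OF \<theta>0]]])
    qed
    also have "\<dots> = (LINT x|freq. contrast \<theta> (mid T j) x)
      + (LINT x|freq. (I T \<omega> j x - f \<theta>0 (mid T j) x) * inverse (f \<theta> (mid T j) x))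
      - (LINT x|freq. (I T \<omega> j x - f \<theta>0 (mid T j) x) * inverse (f \<theta>0 (mid T j) x))"
      using contrast_integrable[OF t u] id[OF t] id[OF \<theta>0] by simp
    finally show ?thesis .
  qed
  have "4 * pi * (L T \<omega> \<theta>
      - L T \<omega> \<theta>0)
    = (\<Sum>j=1..M T. W \<theta> j - W \<theta>0 j) / real (M T)"
    unfolding right_diff_distrib wf[OF t] wf[OF \<theta>0] by (simp add: sum_subtractf diff_divide_distrib)
  also have "(\<Sum>j=1..M T. W \<theta> j - W \<theta>0 j) = (\<Sum>j=1..M T. (LINT x|freq. contrast \<theta> (mid T j) x)
      + (LINT x|freq. (I T \<omega> j x - f \<theta>0 (mid T j) x) * inverse (f \<theta> (mid T j) x))
      - (LINT x|freq. (I T \<omega> j x - f \<theta>0 (mid T j) x) * inverse (f \<theta>0 (mid T j) x)))"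
    by (intro sum.cong refl one)
  also have "\<dots> / real (M T) = average_contrast T \<theta> + whittle_deviation T \<omega> \<theta>
      - whittle_deviation T \<omega> \<theta>0"
    by (simp add: average_contrast_def average_deviation_def sum.distrib sum_subtractf add_divide_distrib diff_divide_distrib)
  finally show ?thesis .
qed

text \<open>A minimiser far from \<theta>0 must make up a contrast of at least \<eta> by random
  deviations, which forces the majorant V above a fixed level; Markov's inequality bounds the
  probability of that.\<close>

lemma whittle_estimator_consistent:
  assumes ident: "\<And>\<theta>. \<theta> \<in> \<Theta> \<Longrightarrow> (\<And>u x. u \<in> {0..1} \<Longrightarrow> x \<in> frequencies \<Longrightarrow> f \<theta> u x = f \<theta>0 u x) \<Longrightarrow> \<theta> = \<theta>0"
    and est: "whittle_estimator P Y \<Theta> A h N S M \<theta>h" and r: "r > 0"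
  shows "(\<lambda>T. measure P {\<omega> \<in> space P. dist (\<theta>h T \<omega>) \<theta>0 > r}) \<longlonglongrightarrow> 0"
proof -
  obtain \<eta> where \<eta>: "\<eta> > 0"
    and sep: "eventually (\<lambda>T. \<forall>\<theta>\<in>\<Theta>. r \<le> dist \<theta> \<theta>0 \<longrightarrow> \<eta> \<le> average_contrast T \<theta>) sequentially"
    using average_contrast_separates[OF ident r] by blast
  obtain V where V: "\<And>T. integrable P (V T)" "\<And>T \<omega>. 0 \<le> V T \<omega>" "(\<lambda>T. expectation (V T)) \<longlonglongrightarrow> 0"
    and Vd: "eventually (\<lambda>T. \<forall>\<omega>\<in>space P. \<forall>\<theta>\<in>\<Theta>.
      \<bar>whittle_deviation T \<omega> \<theta>\<bar> \<le> V T \<omega> + \<eta> / 4) sequentially"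
    using whittle_deviation_bound[of "\<eta> / 4"] \<eta> by auto
  have lim: "(\<lambda>T. expectation (V T) / (\<eta> / 4)) \<longlonglongrightarrow> 0"
    using tendsto_divide[OF V(3) tendsto_const, of "\<eta> / 4"] \<eta> by simp
  have "eventually (\<lambda>T. norm (measure P {\<omega> \<in> space P. dist (\<theta>h T \<omega>) \<theta>0 > r}) \<le> expectation (V T) / (\<eta> / 4)) sequentially"
    using sep Vd block_deviation_uniformly_small[of 1 0, OF zero_less_one]
  proof eventually_elim
    case (elim T)
    then have T1: "T \<ge> 1" "N T \<ge> 1" by auto
    have sub: "{\<omega> \<in> space P. dist (\<theta>h T \<omega>) \<theta>0 > r} \<subseteq> {\<omega> \<in> space P. V T \<omega> \<ge> \<eta> / 4}"
    proof
      fix \<omega> assume w: "\<omega> \<in> {\<omega> \<in> space P. dist (\<theta>h T \<omega>) \<theta>0 > r}"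
      then have wP: "\<omega> \<in> space P" and far: "r \<le> dist (\<theta>h T \<omega>) \<theta>0" by auto
      have "is_arg_min (L T \<omega>) (\<lambda>\<theta>. \<theta> \<in> \<Theta>) (\<theta>h T \<omega>)"
        using est T1(1) wP unfolding whittle_estimator_def by blast
      then have t: "\<theta>h T \<omega> \<in> \<Theta>" and le: "L T \<omega> (\<theta>h T \<omega>)
          \<le> L T \<omega> \<theta>0"
        using \<theta>0 by (auto simp: is_arg_min_def not_less)
      have "4 * pi * (L T \<omega> (\<theta>h T \<omega>)
          - L T \<omega> \<theta>0) \<le> 0"
        using le by (intro mult_nonneg_nonpos) auto
      moreover have "\<eta> \<le> average_contrast T (\<theta>h T \<omega>)" using elim(1) t far by blast
      moreover have "\<bar>whittle_deviation T \<omega> (\<theta>h T \<omega>)\<bar> \<le> V T \<omega> + \<eta> / 4"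
        "\<bar>whittle_deviation T \<omega> \<theta>0\<bar> \<le> V T \<omega> + \<eta> / 4"
        using elim(2) wP t \<theta>0 by blast+
      \<comment> \<open>Minimality gives \<eta> \<le> 2 (V + \<eta> / 4), so the quarter chosen for
        the approximation error leaves exactly a quarter for V.\<close>
      ultimately have "\<eta> / 4 \<le> V T \<omega>"
        unfolding whittle_function_diff[OF T1 t] by linarith
      then show "\<omega> \<in> {\<omega> \<in> space P. V T \<omega> \<ge> \<eta> / 4}" using wP by simp
    qed
    have "measure P {\<omega> \<in> space P. dist (\<theta>h T \<omega>) \<theta>0 > r} \<le> measure P {\<omega> \<in> space P. V T \<omega> \<ge> \<eta> / 4}"
      using V(1) by (intro finite_measure_mono sub) auto
    also have "\<dots> \<le> expectation (V T) / (\<eta> / 4)"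
      using V(1,2) \<eta> by (intro integral_Markov_inequality_measure[where A = "{}"]) auto
    finally show ?case by simp
  qed
  from Lim_null_comparison[OF this lim] show ?thesis .
qed

end

theorem theorem2p1:
  fixes P :: "'w measure"
    and Y :: "nat \<Rightarrow> nat \<Rightarrow> 'w \<Rightarrow> real"
    and \<Theta> :: "'p::euclidean_space set"
    and \<theta>0 :: 'p
    and A :: "'p \<Rightarrow> real \<Rightarrow> real \<Rightarrow> complex"
    and h :: "real \<Rightarrow> real"
    and N S M :: "nat \<Rightarrow> nat"
    and \<theta>h :: "nat \<Rightarrow> 'w \<Rightarrow> 'p"
  assumes "prob_space P"
    and "compact \<Theta>"
    and "\<And>\<theta>. \<theta> \<in> \<Theta> \<Longrightarrow> transfer_function (A \<theta>)"
    and "true_value P Y \<Theta> A \<theta>0"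
    and "\<And>T. T \<ge> 1 \<Longrightarrow> M T \<ge> 1 \<and> T = S T * (M T - 1) + N T"
    and "whittle_estimator P Y \<Theta> A h N S M \<theta>h"
    and "assumption_A1 \<Theta> A"
    and "assumption_A2 h"
    and "assumption_A3 N S M"
  shows "\<forall>\<epsilon>>0. (\<lambda>T. measure P {\<omega> \<in> space P. dist (\<theta>h T \<omega>) \<theta>0 > \<epsilon>}) \<longlonglongrightarrow> 0"
proof -
  have \<theta>0: "\<theta>0 \<in> \<Theta>" and ls: "gaussian_locally_stationary P Y (A \<theta>0)"
    and ident: "\<And>\<theta>. \<theta> \<in> \<Theta> \<Longrightarrow> (\<And>u x. u \<in> {0..1} \<Longrightarrow> x \<in> frequencies \<Longrightarrow>
         tv_spectral_density (A \<theta>) u x = tv_spectral_density (A \<theta>0) u x) \<Longrightarrow> \<theta> = \<theta>0"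
    using assms(4) unfolding true_value_def by blast+
  obtain B A0 K where B: "hermitian_brownian_motion P B"
    and Y: "\<And>T t. T \<ge> 1 \<Longrightarrow> t \<in> {1..T} \<Longrightarrow> has_stochastic_integral P B
             (\<lambda>x. A0 T t x * exp (\<i> * of_real (x * real t))) (\<lambda>\<omega>. of_real (Y T t \<omega>))"
    and K: "\<And>T t x. T \<ge> 1 \<Longrightarrow> t \<in> {1..T} \<Longrightarrow> x \<in> frequencies \<Longrightarrow>
           cmod (A0 T t x - A \<theta>0 (real t / real T) x) \<le> K / real T"
    using ls unfolding gaussian_locally_stationary_def by blast
  interpret prob_space P by (rule assms(1))
  interpret whittle_setting \<Theta> A P B Y A0 K \<theta>0 h N S M
    by unfold_locales (use assms(2,3,5,7,8,9) B Y K \<theta>0 in auto)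
  show ?thesis
    using whittle_estimator_consistent[OF ident assms(6)] by blast
qed

end
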